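(* Let $\mathbf{v}_0$ be an initial datum on $B_{r_0}$ with $\operatorname{curl}\mathbf{v}_0\in L_1(B_{r_0})$ satisfying the no-slip condition $\mathbf{v}_0(\mathbf{x})=0$ for $|\mathbf{x}|=r_0$, the infinity condition $\mathbf{v}_0(\mathbf{x})\to\mathbf{v}_\infty$ as $|\mathbf{x}|\to\infty$, and the zero-circularity condition $\lim_{R\to\infty}\oint_{|\mathbf{x}|=R}\mathbf{v}_0\cdot d\mathbf{l}=0$. Let $\mathbf{v}(t,\mathbf{x})$ be the solution in $B_{r_0}$ of the Navier-Stokes problem $$\partial_t\mathbf{v}-\Delta\mathbf{v}+(\mathbf{v},\nabla)\mathbf{v}=\nabla p,\quad \operatorname{div}\mathbf{v}(t,\mathbf{x})=0,\quad \mathbf{v}(0,\mathbf{x})=\mathbf{v}_0(\mathbf{x}),$$ $$\mathbf{v}(t,\mathbf{x})=0\ \text{ for } |\mathbf{x}|=r_0,\qquad \mathbf{v}(t,\mathbf{x})\to\mathbf{v}_\infty\ \text{ as } |\mathbf{x}|\to\infty .$$ Then $w(t,\mathbf{x})=\operatorname{curl}\mathbf{v}(t,\mathbf{x})$ satisfies $$r_0\frac{\partial w_k(t,r)}{\partial r}\Big|_{r=r_0}+|k|\,w_k(t,r_0)=\begin{cases}\dfrac{|k|r_0^{|k|}}{2\pi}\displaystyle\int_{B_{r_0}}(\mathbf{v}^{\mathbb{C}}_\infty-\mathbf{v}^{\mathbb{C}})\,z^{-|k|-1}\,w(t,\mathbf{x})\,d\mathbf{x}, & k\ge 0,\\[2ex]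 \dfrac{|k|r_0^{|k|}}{2\pi}\displaystyle\int_{B_{r_0}}\overline{(\mathbf{v}^{\mathbb{C}}_\infty-\mathbf{v}^{\mathbb{C}})\,z^{-|k|-1}}\,w(t,\mathbf{x})\,d\mathbf{x}, & k<0,\end{cases}$$ for all $k\in\mathbb{Z}$.
   Context: Let $r_0>0$ and $B_{r_0}=\{\mathbf{x}\in\mathbb{R}^2: |\mathbf{x}|>r_0\}$. Points $\mathbf{x}=(x_1,x_2)$ are identified with $z=x_1+ix_2=re^{i\varphi}$. For $\mathbf{v}=(v_1,v_2)$, $\operatorname{curl}\mathbf{v}=\partial_{x_1}v_2-\partial_{x_2}v_1$; $p(t,\mathbf{x})$ is the (scalar) pressure. The constant $\mathbf{v}_\infty=(v_{1,\infty},v_{2,\infty})\in\mathbb{R}^2$ is given, and $\mathbf{v}^{\mathbb{C}}=v_1+iv_2$, $\mathbf{v}^{\mathbb{C}}_\infty=v_{1,\infty}+iv_{2,\infty}$. For a function $w$ on $B_{r_0}$, $w_k(t,r)=\frac1{2\pi}\int_0^{2\pi}w(t,r,\varphi)e^{-ik\varphi}\,d\varphi$ is its $k$-th angular Fourier coefficient. *)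

theory Defs
  imports "HOL-Analysis.Analysis"
begin

text \<open>
  The plane is identified with \<^typ>\<open>complex\<close>, for points and for vectors alike: a vector
  field \<open>u = (u\<^sub>1, u\<^sub>2)\<close> is the complex function with \<open>u\<^sub>1 = Re u\<close> and \<open>u\<^sub>2 = Im u\<close>.
\<close>

definition ext_dom :: "real \<Rightarrow> complex set" where
  "ext_dom r0 = {z. r0 < cmod z}"

definition ext_dom_cl :: "real \<Rightarrow> complex set" where
  "ext_dom_cl r0 = {z. r0 \<le> cmod z}"

text \<open>
  Derivative in the direction \<open>e\<close>, relative to the closed exterior domain. On the open domain this
  is the ordinary derivative; on the circle \<open>cmod z = r0\<close> it is the derivative up to the boundary
  (which is unique there, since the domain contains a half-disc to first order).
  The operators \<open>\<partial>\<^sub>1\<close> and \<open>\<partial>\<^sub>2\<close> are the cases \<open>e = 1\<close> and \<open>e = \<i>\<close>.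
\<close>

definition pd :: "real \<Rightarrow> complex \<Rightarrow> (complex \<Rightarrow> 'a::real_normed_vector) \<Rightarrow> complex \<Rightarrow> 'a" where
  "pd r0 e f z = frechet_derivative f (at z within ext_dom_cl r0) e"

definition curl :: "real \<Rightarrow> (complex \<Rightarrow> complex) \<Rightarrow> complex \<Rightarrow> real" where
  "curl r0 u z = Im (pd r0 1 u z) - Re (pd r0 \<i> u z)"

definition divergence :: "real \<Rightarrow> (complex \<Rightarrow> complex) \<Rightarrow> complex \<Rightarrow> real" where
  "divergence r0 u z = Re (pd r0 1 u z) + Im (pd r0 \<i> u z)"

definition laplacian :: "real \<Rightarrow> (complex \<Rightarrow> complex) \<Rightarrow> complex \<Rightarrow> complex" where
  "laplacian r0 u z = pd r0 1 (pd r0 1 u) z + pd r0 \<i> (pd r0 \<i> u) z"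

definition gradient :: "real \<Rightarrow> (complex \<Rightarrow> real) \<Rightarrow> complex \<Rightarrow> complex" where
  "gradient r0 q z = Complex (pd r0 1 q z) (pd r0 \<i> q z)"

text \<open>The term \<open>(u, \<nabla>) u\<close>.\<close>

definition convection :: "real \<Rightarrow> (complex \<Rightarrow> complex) \<Rightarrow> complex \<Rightarrow> complex" where
  "convection r0 u z = Re (u z) *\<^sub>R pd r0 1 u z + Im (u z) *\<^sub>R pd r0 \<i> u z"

text \<open>
  The curl of the initial datum is taken in the sense of distributions, so that the datum need not
  be differentiable. Since it is only paired with continuous fields and locally integrable
  functions, \<open>C\<^sup>1\<close> test functions are as good as smooth ones.
\<close>

definition test_function :: "real \<Rightarrow> (complex \<Rightarrow> real) \<Rightarrow> bool" where
  "test_function r0 \<psi> \<longleftrightarrow>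
     \<psi> differentiable_on UNIV \<and>
     (\<forall>e. continuous_on UNIV (\<lambda>z. frechet_derivative \<psi> (at z) e)) \<and>
     compact (closure {z. \<psi> z \<noteq> 0}) \<and> closure {z. \<psi> z \<noteq> 0} \<subseteq> ext_dom r0"

definition has_weak_curl :: "real \<Rightarrow> (complex \<Rightarrow> complex) \<Rightarrow> (complex \<Rightarrow> real) \<Rightarrow> bool" where
  "has_weak_curl r0 u \<omega> \<longleftrightarrow>
     (\<forall>\<psi>. test_function r0 \<psi> \<longrightarrow>
        (LINT z:ext_dom r0|lborel. Re (u z) * pd r0 \<i> \<psi> z - Im (u z) * pd r0 1 \<psi> z) =
        (LINT z:ext_dom r0|lborel. \<omega> z * \<psi> z))"

text \<open>The circulation \<open>\<integral> u \<cdot> dl\<close> along the circle of radius \<open>R\<close>, counterclockwise.\<close>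

definition circulation :: "(complex \<Rightarrow> complex) \<Rightarrow> real \<Rightarrow> real" where
  "circulation u R =
     integral {0..2*pi} (\<lambda>\<phi>. u (of_real R * cis \<phi>) \<bullet> (of_real R * \<i> * cis \<phi>))"

text \<open>
  Continuity up to the boundary gives a meaning to the boundary values, to the limit at infinity
  and to the circulations.
\<close>

definition initial_datum :: "real \<Rightarrow> complex \<Rightarrow> (complex \<Rightarrow> complex) \<Rightarrow> bool" where
  "initial_datum r0 vinf v0 \<longleftrightarrow>
     continuous_on (ext_dom_cl r0) v0 \<and>
     (\<exists>\<omega>. has_weak_curl r0 v0 \<omega> \<and> set_integrable lborel (ext_dom r0) \<omega>) \<and>
     (\<forall>z. cmod z = r0 \<longrightarrow> v0 z = 0) \<and>
     (v0 \<longlongrightarrow> vinf) at_infinity \<and>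
     (circulation v0 \<longlongrightarrow> 0) at_top"

text \<open>
  Classical regularity for positive times: one time derivative and two space derivatives,
  jointly continuous up to the boundary. No regularity is asked for at time 0.
\<close>

definition velocity_regular :: "real \<Rightarrow> real \<Rightarrow> (real \<Rightarrow> complex \<Rightarrow> complex) \<Rightarrow> bool" where
  "velocity_regular r0 T v \<longleftrightarrow>
     (let Q = {0<..<T} \<times> ext_dom_cl r0 in
       (\<forall>(t, z)\<in>Q. (\<lambda>s. v s z) differentiable (at t)) \<and>
       (\<forall>t\<in>{0<..<T}. v t differentiable_on ext_dom_cl r0) \<and>
       (\<forall>t\<in>{0<..<T}. \<forall>e\<in>{1, \<i>}. pd r0 e (v t) differentiable_on ext_dom_cl r0) \<and>
       continuous_on Q (\<lambda>(t, z). v t z) \<and>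
       continuous_on Q (\<lambda>(t, z). vector_derivative (\<lambda>s. v s z) (at t)) \<and>
       (\<forall>e\<in>{1, \<i>}. continuous_on Q (\<lambda>(t, z). pd r0 e (v t) z)) \<and>
       (\<forall>e\<in>{1, \<i>}. \<forall>e'\<in>{1, \<i>}. continuous_on Q (\<lambda>(t, z). pd r0 e (pd r0 e' (v t)) z)))"

text \<open>
  Solutions on the time interval from 0 to \<open>T\<close> (a global solution is one for every \<open>T\<close>).
  The initial datum is attained pointwise, the limit at infinity is uniform on compact
  time intervals, and the vorticity stays in \<open>L\<^sub>1\<close>, the space prescribed for the curl of the datum.
  The sign of \<open>p\<close> is such that \<open>\<nabla>p\<close> stands on the right-hand side.
\<close>

definition NS_solution ::
  "real \<Rightarrow> real \<Rightarrow> complex \<Rightarrow> (complex \<Rightarrow> complex) \<Rightarrow>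
   (real \<Rightarrow> complex \<Rightarrow> complex) \<Rightarrow> (real \<Rightarrow> complex \<Rightarrow> real) \<Rightarrow> bool" where
  "NS_solution r0 T vinf v0 v p \<longleftrightarrow>
     velocity_regular r0 T v \<and>
     (\<forall>t\<in>{0<..<T}. p t differentiable_on ext_dom r0) \<and>
     (\<forall>t\<in>{0<..<T}. \<forall>z\<in>ext_dom r0.
        vector_derivative (\<lambda>s. v s z) (at t) - laplacian r0 (v t) z + convection r0 (v t) z
          = gradient r0 (p t) z) \<and>
     (\<forall>t\<in>{0<..<T}. \<forall>z\<in>ext_dom r0. divergence r0 (v t) z = 0) \<and>
     (\<forall>z\<in>ext_dom r0. v 0 z = v0 z \<and> ((\<lambda>t. v t z) \<longlongrightarrow> v0 z) (at_right 0)) \<and>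
     (\<forall>t\<in>{0<..<T}. \<forall>z. cmod z = r0 \<longrightarrow> v t z = 0) \<and>
     (\<forall>a b. 0 < a \<and> b < T \<longrightarrow> uniform_limit {a..b} (\<lambda>z t. v t z) (\<lambda>t. vinf) at_infinity) \<and>
     (\<forall>t\<in>{0<..<T}. set_integrable lborel (ext_dom r0) (curl r0 (v t)))"

text \<open>The \<open>k\<close>-th angular Fourier coefficient on the circle of radius \<open>r\<close>.\<close>

definition ang_coeff :: "(complex \<Rightarrow> real) \<Rightarrow> int \<Rightarrow> real \<Rightarrow> complex" where
  "ang_coeff w k r =
     1 / (2 * of_real pi) *
     integral {0..2*pi} (\<lambda>\<phi>. of_real (w (of_real r * cis \<phi>)) * exp (- \<i> * of_int k * of_real \<phi>))"

end

theory Submission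
  imports Defs
begin

text \<open>
  Points and vectors are complex numbers, \<open>2\<partial> = \<partial>\<^sub>1 - \<i>\<partial>\<^sub>2\<close> and
  \<open>2\<partial>' = \<partial>\<^sub>1 + \<i>\<partial>\<^sub>2\<close>. A divergence-free field \<open>v\<close> of vorticity \<open>w\<close> satisfies
  \<open>2\<partial>v = \<i>w\<close>, and the momentum equation reads
  \<open>\<partial>\<^sub>tv - \<Delta>v + \<i>wv = 2\<partial>'(p - \<bar>v\<bar>\<^sup>2/2)\<close>.

  Formally the theorem is the vorticity equation \<open>\<partial>\<^sub>tw + div(wv) = \<Delta>w\<close> tested against the
  harmonic function \<open>z\<^sup>-\<^sup>k\<close>, \<open>k \<ge> 1\<close>. Green's formula turns \<open>\<Delta>w\<close> into the boundary term
  \<open>-2\<pi>r\<^sub>0\<^sup>-\<^sup>k(r\<^sub>0 \<partial>\<^sub>rw\<^sub>k + kw\<^sub>k)\<close>, and the transport term becomes the integral of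
  \<open>k w v z\<^sup>-\<^sup>k\<^sup>-\<^sup>1\<close>. The no-slip condition removes everything else: when
  \<open>z\<^sup>-\<^sup>kw = 2\<i>\<partial>'(z\<^sup>-\<^sup>k cnj v)\<close> is integrated, the circle contributes nothing, so that the moment
  of \<open>w\<close> against \<open>z\<^sup>-\<^sup>k\<close> is read off from \<open>v\<close> at infinity and is constant in time, while the moment against \<open>z\<^sup>-\<^sup>k\<^sup>-\<^sup>1\<close> vanishes,
  which is why \<open>vinf\<close> may be subtracted from \<open>v\<close>. For \<open>k = 0\<close> the formula says that a pressure
  gradient has no circulation, and negative \<open>k\<close> follow by conjugation, \<open>w\<close> being real.

  The difficulty is that \<open>v\<close> has only two space derivatives and that nothing is known at infinity
  about the pressure or about derivatives of \<open>v\<close>; nor is the \<open>L\<^sub>1\<close> norm of \<open>w\<close> bounded uniformly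
  in time. The proof therefore works with single angular modes. Each first-order relation
  becomes an ordinary differential equation in \<open>r\<close> (\<open>mode_derivative_dz\<close>,
  \<open>mode_derivative_dzbar\<close>), the mode of the pressure can be eliminated
  (\<open>momentum_balance\<close>), and integration from \<open>r\<^sub>0\<close> to \<open>R\<close> gives the desired
  relation up to terms on the circle of radius \<open>R\<close> (\<open>balance\<close>). These terms contain derivatives
  without any known bound. Two facts dispose of them. Since \<open>wv = -\<i>\<partial>(v\<^sup>2)\<close>, the transport
  integral over \<open>r\<^sub>0 < \<bar>z\<bar> < R\<close> converges as \<open>R \<rightarrow> \<infinity>\<close> uniformly on compact time
  intervals (\<open>flux_Cauchy\<close>), so the defect in the relation is a continuous function of time. And its
  integral over any time interval vanishes (\<open>integral_defect\<close>): otherwise, integrating the radial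
  equations twice, the time integral of a mode of the bounded field \<open>v\<close> would grow like \<open>r\<^sup>k\<^sup>+\<^sup>1\<close>.
  Polar coordinates (\<open>polar_integral\<close>) convert the result into the integral over the plane domain.
\<close>

section \<open>Wirtinger derivatives and angular Fourier modes\<close>

definition annular :: "real set \<Rightarrow> complex set" where
  "annular U = {z. cmod z \<in> U}"

text \<open>
  Not divided by \<open>2 * pi\<close>, so that the integral of \<open>f z * z powi (- j)\<close> over an annulus is the radial
  integral of \<open>r powi (1 - j)\<close> times the mode.
\<close>
definition mode :: "int \<Rightarrow> (complex \<Rightarrow> complex) \<Rightarrow> real \<Rightarrow> complex" where
  "mode j f r = integral {0..2*pi} (\<lambda>\<phi>. f (of_real r * cis \<phi>) * cis (- of_int j * \<phi>))"

text \<open>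
  Continuous differentiability relative to \<open>D\<close>, with \<open>a = 2\<partial>f\<close> and \<open>b = 2\<partial>'f\<close>. The derivative is taken
  within \<open>D\<close>, so that domains which include the boundary circle need no separate treatment.
\<close>
definition wirtinger_on ::
  "complex set \<Rightarrow> (complex \<Rightarrow> complex) \<Rightarrow> (complex \<Rightarrow> complex) \<Rightarrow> (complex \<Rightarrow> complex) \<Rightarrow> bool" where
  "wirtinger_on D f a b \<longleftrightarrow>
     (\<forall>z\<in>D. (f has_derivative (\<lambda>h. (h * a z + cnj h * b z) / 2)) (at z within D)) \<and>
     continuous_on D a \<and> continuous_on D b"

lemma wirtinger_on_continuous: "wirtinger_on D f a b \<Longrightarrow> continuous_on D f"
  unfolding wirtinger_on_def
  by (meson continuous_on_eq_continuous_within has_derivative_continuous)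

lemma wirtinger_on_cong:
  assumes "wirtinger_on D f a b" "\<And>z. z \<in> D \<Longrightarrow> f z = f' z"
    "\<And>z. z \<in> D \<Longrightarrow> a z = a' z" "\<And>z. z \<in> D \<Longrightarrow> b z = b' z"
  shows "wirtinger_on D f' a' b'"
  unfolding wirtinger_on_def
proof (intro conjI ballI)
  fix z assume z: "z \<in> D"
  have "(f has_derivative (\<lambda>h. (h * a z + cnj h * b z) / 2)) (at z within D)"
    using assms(1) z by (simp add: wirtinger_on_def)
  then show "(f' has_derivative (\<lambda>h. (h * a' z + cnj h * b' z) / 2)) (at z within D)"
    using assms(2-4) z by (auto intro: has_derivative_transform[where f=f])
next
  show "continuous_on D a'" "continuous_on D b'"
    using assms by (auto simp: wirtinger_on_def cong: continuous_on_cong)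
qed

lemma wirtinger_on_subset:
  "wirtinger_on D f a b \<Longrightarrow> D' \<subseteq> D \<Longrightarrow> wirtinger_on D' f a b"
  unfolding wirtinger_on_def by (meson continuous_on_subset has_derivative_subset subsetD)

lemma wirtinger_on_mult:
  assumes "wirtinger_on D f a b" "wirtinger_on D g c d"
  shows "wirtinger_on D (\<lambda>z. f z * g z) (\<lambda>z. a z * g z + f z * c z) (\<lambda>z. b z * g z + f z * d z)"
  unfolding wirtinger_on_def
proof (intro conjI ballI)
  fix z assume z: "z \<in> D"
  have 1: "(f has_derivative (\<lambda>h. (h * a z + cnj h * b z) / 2)) (at z within D)"
    and 2: "(g has_derivative (\<lambda>h. (h * c z + cnj h * d z) / 2)) (at z within D)"
    using assms z by (simp_all add: wirtinger_on_def)
  show "((\<lambda>z. f z * g z) has_derivative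
      (\<lambda>h. (h * (a z * g z + f z * c z) + cnj h * (b z * g z + f z * d z)) / 2)) (at z within D)"
    by (rule has_derivative_eq_rhs[OF has_derivative_mult[OF 1 2]]) (auto simp: fun_eq_iff field_simps)
next
  show "continuous_on D (\<lambda>z. a z * g z + f z * c z)" "continuous_on D (\<lambda>z. b z * g z + f z * d z)"
    using assms wirtinger_on_continuous[OF assms(1)] wirtinger_on_continuous[OF assms(2)]
    by (auto simp: wirtinger_on_def intro!: continuous_intros)
qed

lemma wirtinger_on_diff:
  assumes "wirtinger_on D f a b" "wirtinger_on D g c d"
  shows "wirtinger_on D (\<lambda>z. f z - g z) (\<lambda>z. a z - c z) (\<lambda>z. b z - d z)"
  unfolding wirtinger_on_def
proof (intro conjI ballI)
  fix z assume z: "z \<in> D"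
  have 1: "(f has_derivative (\<lambda>h. (h * a z + cnj h * b z) / 2)) (at z within D)"
    and 2: "(g has_derivative (\<lambda>h. (h * c z + cnj h * d z) / 2)) (at z within D)"
    using assms z by (simp_all add: wirtinger_on_def)
  show "((\<lambda>z. f z - g z) has_derivative
      (\<lambda>h. (h * (a z - c z) + cnj h * (b z - d z)) / 2)) (at z within D)"
    by (rule has_derivative_eq_rhs[OF has_derivative_diff[OF 1 2]]) (auto simp: fun_eq_iff field_simps)
next
  show "continuous_on D (\<lambda>z. a z - c z)" "continuous_on D (\<lambda>z. b z - d z)"
    using assms by (auto simp: wirtinger_on_def intro!: continuous_intros)
qed

lemma wirtinger_on_const: "wirtinger_on D (\<lambda>z. c) (\<lambda>z. 0) (\<lambda>z. 0)"
  by (simp add: wirtinger_on_def)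

lemma wirtinger_on_cmult:
  assumes "wirtinger_on D f a b"
  shows "wirtinger_on D (\<lambda>z. c * f z) (\<lambda>z. c * a z) (\<lambda>z. c * b z)"
  using wirtinger_on_mult[OF wirtinger_on_const[of D c] assms] by simp

lemma wirtinger_on_cnj:
  assumes "wirtinger_on D f a b"
  shows "wirtinger_on D (\<lambda>z. cnj (f z)) (\<lambda>z. cnj (b z)) (\<lambda>z. cnj (a z))"
  unfolding wirtinger_on_def
proof (intro conjI ballI)
  fix z assume z: "z \<in> D"
  have 1: "(f has_derivative (\<lambda>h. (h * a z + cnj h * b z) / 2)) (at z within D)"
    using assms z by (simp_all add: wirtinger_on_def)
  show "((\<lambda>z. cnj (f z)) has_derivative
      (\<lambda>h. (h * cnj (b z) + cnj h * cnj (a z)) / 2)) (at z within D)"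
    by (rule has_derivative_eq_rhs[OF has_derivative_cnj[OF 1]])
      (auto simp: fun_eq_iff field_simps)
next
  show "continuous_on D (\<lambda>z. cnj (b z))" "continuous_on D (\<lambda>z. cnj (a z))"
    using assms by (auto simp: wirtinger_on_def intro!: continuous_intros)
qed

lemma annular_circle: "r \<in> U \<Longrightarrow> 0 < r \<Longrightarrow> of_real r * cis \<phi> \<in> annular U"
  by (simp add: annular_def norm_mult)

lemma continuous_on_circle_compose:
  assumes "continuous_on (annular U) f" "U \<subseteq> {0<..}" "\<And>x. x \<in> S \<Longrightarrow> g x \<in> U"
    "continuous_on S g" "continuous_on S h"
  shows "continuous_on S (\<lambda>x. f (of_real (g x) * cis (h x)))"
  by (rule continuous_on_compose2[OF assms(1)])
    (use assms in \<open>auto intro!: continuous_intros annular_circle continuous_on_cis\<close>)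

lemma mode_integrand_continuous:
  assumes "continuous_on (annular U) f" "U \<subseteq> {0<..}" "r \<in> U"
  shows "continuous_on S (\<lambda>\<phi>. f (of_real r * cis \<phi>) * cis (- of_int j * \<phi>))"
  by (intro continuous_intros continuous_on_circle_compose[OF assms(1,2)] continuous_on_cis)
    (use assms in auto)

lemma mode_integrable:
  assumes "continuous_on (annular U) f" "U \<subseteq> {0<..}" "r \<in> U"
  shows "(\<lambda>\<phi>. f (of_real r * cis \<phi>) * cis (- of_int j * \<phi>)) integrable_on {0..2*pi}"
  by (intro integrable_continuous_real mode_integrand_continuous[OF assms])

lemma mode_has_integral:
  assumes "continuous_on (annular U) f" "U \<subseteq> {0<..}" "r \<in> U"
  shows "((\<lambda>\<phi>. f (of_real r * cis \<phi>) * cis (- of_int j * \<phi>)) has_integral mode j f r) {0..2*pi}"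
  unfolding mode_def using mode_integrable[OF assms] by (rule integrable_integral)

lemma mode_cnj: "mode j (\<lambda>z. cnj (f z)) r = cnj (mode (-j) f r)"
  unfolding mode_def integral_cnj by (simp add: cis_cnj)

lemma mode_cmult: "mode j (\<lambda>z. c * f z) r = c * mode j f r"
  unfolding mode_def by (simp add: mult.assoc)

lemma mode_diff:
  assumes "continuous_on (annular U) f" "continuous_on (annular U) g" "U \<subseteq> {0<..}" "r \<in> U"
  shows "mode j (\<lambda>z. f z - g z) r = mode j f r - mode j g r"
  unfolding mode_def left_diff_distrib
  using mode_integrable[OF assms(1,3,4)] mode_integrable[OF assms(2,3,4)]
  by (rule Henstock_Kurzweil_Integration.integral_diff)

lemma mode_add:
  assumes "continuous_on (annular U) f" "continuous_on (annular U) g" "U \<subseteq> {0<..}" "r \<in> U"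
  shows "mode j (\<lambda>z. f z + g z) r = mode j f r + mode j g r"
  unfolding mode_def distrib_right
  using mode_integrable[OF assms(1,3,4)] mode_integrable[OF assms(2,3,4)]
  by (rule Henstock_Kurzweil_Integration.integral_add)

lemma has_vector_derivative_cis_compose:
  assumes "(g has_real_derivative g') (at x within S)"
  shows "((\<lambda>x. cis (g x)) has_vector_derivative of_real g' * \<i> * cis (g x)) (at x within S)"
proof -
  have "((\<lambda>x. cis (g x)) has_derivative (\<lambda>t. (t * g') *\<^sub>R (\<i> * cis (g x)))) (at x within S)"
    using has_derivative_cis[OF assms[unfolded has_field_derivative_def]]
    by (simp add: mult.commute)
  then show ?thesis
    by (simp add: has_vector_derivative_def scaleR_conv_of_real mult_ac)
qed

lemma wirtinger_on_curve:
  assumes "wirtinger_on D f a b" "(g has_vector_derivative g') (at x within S)"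
    "g ` S \<subseteq> D" "x \<in> S"
  shows "((\<lambda>x. f (g x)) has_vector_derivative (g' * a (g x) + cnj g' * b (g x)) / 2) (at x within S)"
proof -
  have "(f has_derivative (\<lambda>h. (h * a (g x) + cnj h * b (g x)) / 2)) (at (g x) within g ` S)"
    by (rule has_derivative_subset[OF _ assms(3)]) (use assms(1,3,4) in \<open>auto simp: wirtinger_on_def\<close>)
  from diff_chain_within[OF assms(2)[unfolded has_vector_derivative_def] this] show ?thesis
    by (auto simp: has_vector_derivative_def o_def fun_eq_iff scaleR_conv_of_real field_simps
        elim: has_derivative_eq_rhs)
qed

text \<open>
  On the ray of angle \<open>\<phi>\<close> the radial derivative is \<open>(cis \<phi> * 2\<partial>f + cnj (cis \<phi>) * 2\<partial>'f) / 2\<close>;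
  the two factors shift the mode by one in opposite directions.
\<close>
lemma mode_radial_derivative:
  assumes f: "wirtinger_on (annular U) f a b" and U: "U \<subseteq> {0<..}" "convex U" "r \<in> U"
  shows "(mode j f has_vector_derivative (mode (j - 1) a r + mode (j + 1) b r) / 2) (at r within U)"
proof -
  have ca: "continuous_on (annular U) a" and cb: "continuous_on (annular U) b"
    using f by (auto simp: wirtinger_on_def)
  note cf = wirtinger_on_continuous[OF f]
  let ?d = "\<lambda>r \<phi>. (cis \<phi> * a (of_real r * cis \<phi>) + cnj (cis \<phi>) * b (of_real r * cis \<phi>)) / 2
      * cis (- of_int j * \<phi>)"
  have "((\<lambda>r. integral (cbox 0 (2*pi)) (\<lambda>\<phi>. f (of_real r * cis \<phi>) * cis (- of_int j * \<phi>)))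
      has_vector_derivative integral (cbox 0 (2*pi)) (?d r)) (at r within U)"
  proof (rule leibniz_rule_vector_derivative)
    fix x t :: real assume x: "x \<in> U"
    have "((\<lambda>x. of_real x * cis t) has_vector_derivative cis t) (at x within U)"
      by (auto simp: has_vector_derivative_def scaleR_conv_of_real intro!: derivative_eq_intros)
    then have "((\<lambda>x. f (of_real x * cis t)) has_vector_derivative
        (cis t * a (of_real x * cis t) + cnj (cis t) * b (of_real x * cis t)) / 2) (at x within U)"
      by (rule wirtinger_on_curve[OF f]) (use x U in \<open>auto intro: annular_circle\<close>)
    then show "((\<lambda>x. f (of_real x * cis t) * cis (- of_int j * t)) has_vector_derivative ?d x t) (at x within U)"
      by (rule has_vector_derivative_mult_left)
  next
    show "(\<lambda>\<phi>. f (of_real x * cis \<phi>) * cis (- of_int j * \<phi>)) integrable_on cbox 0 (2*pi)"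
      if "x \<in> U" for x
      using mode_integrable[OF cf U(1) that] by simp
  next
    show "continuous_on (U \<times> cbox 0 (2 * pi)) (\<lambda>(r, \<phi>). ?d r \<phi>)"
      unfolding case_prod_unfold
      by (intro continuous_intros continuous_on_cis continuous_on_circle_compose[OF ca U(1)]
          continuous_on_circle_compose[OF cb U(1)]) auto
  qed (use U in auto)
  moreover have "(?d r has_integral (mode (j - 1) a r + mode (j + 1) b r) / 2) {0..2*pi}"
  proof -
    have "((\<lambda>\<phi>. (a (of_real r * cis \<phi>) * cis (- of_int (j - 1) * \<phi>)
        + b (of_real r * cis \<phi>) * cis (- of_int (j + 1) * \<phi>)) / 2)
        has_integral (mode (j - 1) a r + mode (j + 1) b r) / 2) {0..2*pi}"
      by (intro has_integral_divide has_integral_add mode_has_integral[OF ca U(1,3)]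
          mode_has_integral[OF cb U(1,3)])
    moreover have "?d r \<phi> = (a (of_real r * cis \<phi>) * cis (- of_int (j - 1) * \<phi>)
        + b (of_real r * cis \<phi>) * cis (- of_int (j + 1) * \<phi>)) / 2" for \<phi>
    proof -
      have "cis (- of_int (j - 1) * \<phi>) = cis \<phi> * cis (- of_int j * \<phi>)"
        "cis (- of_int (j + 1) * \<phi>) = cnj (cis \<phi>) * cis (- of_int j * \<phi>)"
        by (simp_all add: cis_mult cis_cnj algebra_simps)
      then show ?thesis by (simp add: algebra_simps add_divide_distrib)
    qed
    ultimately show ?thesis by simp
  qed
  moreover have "mode j f = (\<lambda>r. integral (cbox 0 (2*pi)) (\<lambda>\<phi>. f (of_real r * cis \<phi>) * cis (- of_int j * \<phi>)))"
    by (simp add: mode_def fun_eq_iff)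
  ultimately show ?thesis
    by (simp only: cbox_interval integral_unique)
qed

text \<open>
  Integration by parts over the full circle, where the periodic boundary terms cancel. Together with
  the radial derivative this gives the two first-order equations below, each of which involves only
  one of \<open>\<partial>f\<close> and \<open>\<partial>'f\<close>.
\<close>
lemma mode_angular_derivative:
  assumes f: "wirtinger_on (annular U) f a b" and U: "U \<subseteq> {0<..}" "r \<in> U"
  shows "mode (j - 1) a r - mode (j + 1) b r = 2 * of_int j / of_real r * mode j f r"
proof -
  have ca: "continuous_on (annular U) a" and cb: "continuous_on (annular U) b"
    using f by (auto simp: wirtinger_on_def)
  have r: "r > 0" using U by auto
  note cf = wirtinger_on_continuous[OF f]
  let ?F = "\<lambda>\<phi>. f (of_real r * cis \<phi>) * cis (- of_int j * \<phi>)"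
  let ?d = "\<lambda>\<phi>. (\<i> * of_real r / 2) * (a (of_real r * cis \<phi>) * cis (- of_int (j - 1) * \<phi>)
        - b (of_real r * cis \<phi>) * cis (- of_int (j + 1) * \<phi>)) - \<i> * of_int j * ?F \<phi>"
  have "(?F has_vector_derivative ?d \<phi>) (at \<phi> within {0..2*pi})" if "\<phi> \<in> {0..2*pi}" for \<phi>
  proof -
    have "((\<lambda>x. of_real r * cis x) has_vector_derivative of_real r * \<i> * cis \<phi>) (at \<phi> within {0..2*pi})"
      using has_vector_derivative_cis_compose[of "\<lambda>x. x" 1 \<phi> "{0..2*pi}"]
      by (auto intro: has_vector_derivative_eq_rhs[OF has_vector_derivative_mult_right])
    then have 1: "((\<lambda>x. f (of_real r * cis x)) has_vector_derivative
        (of_real r * \<i> * cis \<phi> * a (of_real r * cis \<phi>)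
          + cnj (of_real r * \<i> * cis \<phi>) * b (of_real r * cis \<phi>)) / 2) (at \<phi> within {0..2*pi})"
      by (rule wirtinger_on_curve[OF f]) (use U r that in \<open>auto intro: annular_circle\<close>)
    have 2: "((\<lambda>x. cis (- of_int j * x)) has_vector_derivative of_real (- of_int j) * \<i> * cis (- of_int j * \<phi>))
        (at \<phi> within {0..2*pi})"
      by (rule has_vector_derivative_cis_compose) (auto intro!: derivative_eq_intros)
    have 3: "cis (- of_int (j - 1) * \<phi>) = cis \<phi> * cis (- of_int j * \<phi>)"
        "cis (- of_int (j + 1) * \<phi>) = cnj (cis \<phi>) * cis (- of_int j * \<phi>)"
      by (simp_all add: cis_mult cis_cnj algebra_simps)
    show ?thesis
      by (rule has_vector_derivative_eq_rhs[OF has_vector_derivative_mult[OF 1 2]])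
        (unfold 3, simp add: field_simps)
  qed
  then have "(?d has_integral (?F (2*pi) - ?F 0)) {0..2*pi}"
    by (intro fundamental_theorem_of_calculus) auto
  moreover have "cis (- of_int j * (2*pi)) = 1"
    using cis_multiple_2pi[of "- of_int j"] by (simp add: mult_ac)
  ultimately have "(?d has_integral 0) {0..2*pi}"
    by simp
  moreover have "(?d has_integral (\<i> * of_real r / 2) * (mode (j - 1) a r - mode (j + 1) b r)
      - \<i> * of_int j * mode j f r) {0..2*pi}"
    by (intro has_integral_diff has_integral_mult_right mode_has_integral[OF ca U]
        mode_has_integral[OF cb U] mode_has_integral[OF cf U])
  ultimately have "(\<i> * of_real r / 2) * (mode (j - 1) a r - mode (j + 1) b r)
      - \<i> * of_int j * mode j f r = 0"
    by (rule has_integral_unique[THEN sym])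
  then have "\<i> * (of_real r * (mode (j - 1) a r - mode (j + 1) b r) - 2 * of_int j * mode j f r) = 0"
    by (simp add: algebra_simps)
  then have "of_real r * (mode (j - 1) a r - mode (j + 1) b r) - 2 * of_int j * mode j f r = 0"
    using complex_i_not_zero mult_eq_0_iff by blast
  then show ?thesis using r
    by (simp add: field_simps)
qed

lemma mode_derivative_dz:
  assumes "wirtinger_on (annular U) f a b" "U \<subseteq> {0<..}" "convex U" "r \<in> U"
  shows "(mode j f has_vector_derivative (mode (j - 1) a r - of_int j / of_real r * mode j f r)) (at r within U)"
  by (rule has_vector_derivative_eq_rhs[OF mode_radial_derivative[OF assms]])
    (use mode_angular_derivative[OF assms(1,2,4), of j] in \<open>simp add: field_simps\<close>)

lemma mode_derivative_dzbar:
  assumes "wirtinger_on (annular U) f a b" "U \<subseteq> {0<..}" "convex U" "r \<in> U"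
  shows "(mode j f has_vector_derivative (mode (j + 1) b r + of_int j / of_real r * mode j f r)) (at r within U)"
  by (rule has_vector_derivative_eq_rhs[OF mode_radial_derivative[OF assms]])
    (use mode_angular_derivative[OF assms(1,2,4), of j] in \<open>simp add: field_simps\<close>)

text \<open>
  The integrating factors \<open>r powi m\<close> absorb the terms \<open>j / r\<close> of the mode equations.
\<close>
lemma has_vector_derivative_power_int_mult:
  fixes f :: "real \<Rightarrow> complex"
  assumes "(f has_vector_derivative f') (at r within U)" "r \<noteq> 0"
  shows "((\<lambda>r. of_real r powi m * f r) has_vector_derivative
    of_real r powi m * (f' + of_int m / of_real r * f r)) (at r within U)"
proof -
  have "((\<lambda>z. z powi m) has_field_derivative of_int m * of_real r powi (m - 1)) (at (complex_of_real r))"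
    using assms(2) by (auto intro!: derivative_eq_intros)
  then have "((\<lambda>r. complex_of_real r powi m) has_vector_derivative of_int m * of_real r powi (m - 1)) (at r within U)"
    using has_vector_derivative_real_field by blast
  from has_vector_derivative_mult[OF this assms(1)] show ?thesis
    using assms(2) by (elim has_vector_derivative_eq_rhs)
      (simp add: field_simps power_int_diff)
qed

text \<open>
  This replaces the symmetry of second derivatives: with \<open>a = 2\<partial>f\<close> and \<open>b = 2\<partial>'f\<close> it says that
  \<open>\<partial>\<partial>'f\<close> and \<open>\<partial>'\<partial>f\<close> have the same modes. Both can be expressed through the same second-order
  radial operator applied to the mode of \<open>f\<close>.
\<close>
lemma second_order_modes_agree:
  assumes U: "U \<subseteq> {0<..}" "convex U" "open U" "r \<in> U"
    and f: "wirtinger_on (annular U) f a b"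
    and a: "wirtinger_on (annular U) a a1 a2" and b: "wirtinger_on (annular U) b b1 b2"
  shows "mode j b1 r = mode j a2 r"
proof -
  have nz: "x \<noteq> 0" if "x \<in> U" for x using U(1) that by auto
  note at = at_within_open[OF U(4,3)]
  note [simp] = nz[OF U(4)]
  have b': "(mode (j + 1) b has_vector_derivative (mode j b1 r - of_int (j + 1) / of_real r * mode (j + 1) b r)) (at r)"
    using mode_derivative_dz[OF b U(1,2,4), of "j + 1"] by (simp add: at)
  have a': "(mode (j - 1) a has_vector_derivative (mode j a2 r + of_int (j - 1) / of_real r * mode (j - 1) a r)) (at r)"
    using mode_derivative_dzbar[OF a U(1,2,4), of "j - 1"] by (simp add: at)
  have f': "(mode j f has_vector_derivative (mode (j - 1) a r - of_int j / of_real r * mode j f r)) (at r)"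
    using mode_derivative_dz[OF f U(1,2,4), of j] by (simp add: at)
  \<comment> \<open>differentiate the angular relation between the modes of \<open>a\<close> and \<open>b\<close> and compare\<close>
  have ba: "mode (j - 1) a x - 2 * of_int j * (of_real x powi (-1) * mode j f x) = mode (j + 1) b x" if "x \<in> U" for x
    using mode_angular_derivative[OF f U(1) that, of j] nz[OF that]
    by (simp add: power_int_minus field_simps)
  have "((\<lambda>x. mode (j - 1) a x - 2 * of_int j * (of_real x powi (-1) * mode j f x)) has_vector_derivative
      (mode j a2 r + of_int (j - 1) / of_real r * mode (j - 1) a r)
      - 2 * of_int j * (of_real r powi (-1) * ((mode (j - 1) a r - of_int j / of_real r * mode j f r) + of_int (-1) / of_real r * mode j f r)))
    (at r)"
    by (intro has_vector_derivative_diff has_vector_derivative_mult_right a' has_vector_derivative_power_int_mult f') simp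
  then have "(mode (j + 1) b has_vector_derivative
      (mode j a2 r + of_int (j - 1) / of_real r * mode (j - 1) a r)
      - 2 * of_int j * (of_real r powi (-1) * ((mode (j - 1) a r - of_int j / of_real r * mode j f r) + of_int (-1) / of_real r * mode j f r)))
    (at r)"
    by (rule has_vector_derivative_transform_within_open[OF _ U(3,4)]) (use ba in auto)
  from vector_derivative_unique_at[OF b' this] show ?thesis
    unfolding ba[OF U(4), symmetric] by (simp add: divide_inverse algebra_simps)
qed

lemma mode_continuous:
  assumes "continuous_on (annular U) f" "U \<subseteq> {0<..}"
  shows "continuous_on U (mode j f)"
proof -
  have "continuous_on (U \<times> cbox 0 (2*pi)) (\<lambda>(r, \<phi>). f (of_real r * cis \<phi>) * cis (- of_int j * \<phi>))"
    unfolding case_prod_unfold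
    by (intro continuous_intros continuous_on_cis continuous_on_circle_compose[OF assms]) auto
  from integral_continuous_on_param[OF this] show ?thesis
    by (simp add: mode_def[abs_def])
qed

lemma mode_joint_continuous:
  assumes "continuous_on (I \<times> annular U) (\<lambda>(t, z). f t z)" "U \<subseteq> {0<..}"
  shows "continuous_on (I \<times> U) (\<lambda>(t, r). mode j (f t) r)"
proof -
  have "continuous_on ((I \<times> U) \<times> cbox 0 (2*pi))
      (\<lambda>(x, \<phi>). f (fst x) (of_real (snd x) * cis \<phi>) * cis (- of_int j * \<phi>))"
    unfolding case_prod_unfold
    by (intro continuous_intros continuous_on_cis
        continuous_on_compose2[OF assms(1)[unfolded case_prod_unfold], of _ "\<lambda>x. (fst (fst x), of_real (snd (fst x)) * cis (snd x))", simplified])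
      (use assms(2) in \<open>auto simp: norm_mult annular_def subset_iff less_imp_le\<close>)
  from integral_continuous_on_param[OF this] show ?thesis
    by (simp add: mode_def case_prod_unfold)
qed

lemma mode_time_derivative:
  assumes U: "U \<subseteq> {0<..}" "r \<in> U" and I: "open I" "convex I" "t \<in> I"
    and f: "\<And>t z. t \<in> I \<Longrightarrow> z \<in> annular U \<Longrightarrow> ((\<lambda>t. f t z) has_vector_derivative f' t z) (at t)"
    and cf: "\<And>t. t \<in> I \<Longrightarrow> continuous_on (annular U) (f t)"
    and cf': "continuous_on (I \<times> annular U) (\<lambda>(t, z). f' t z)"
  shows "((\<lambda>t. mode j (f t) r) has_vector_derivative mode j (f' t) r) (at t)"
proof -
  have r: "r > 0" using U by auto
  have "((\<lambda>t. integral (cbox 0 (2*pi)) (\<lambda>\<phi>. f t (of_real r * cis \<phi>) * cis (- of_int j * \<phi>))) has_vector_derivative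
     integral (cbox 0 (2*pi)) (\<lambda>\<phi>. f' t (of_real r * cis \<phi>) * cis (- of_int j * \<phi>))) (at t within I)"
  proof (rule leibniz_rule_vector_derivative)
    fix s \<phi> assume "s \<in> I"
    then show "((\<lambda>t. f t (of_real r * cis \<phi>) * cis (- of_int j * \<phi>)) has_vector_derivative
        f' s (of_real r * cis \<phi>) * cis (- of_int j * \<phi>)) (at s within I)"
      using U r by (intro has_vector_derivative_mult_left has_vector_derivative_at_within[OF f] annular_circle) auto
  next
    fix s assume "s \<in> I"
    then show "(\<lambda>\<phi>. f s (of_real r * cis \<phi>) * cis (- of_int j * \<phi>)) integrable_on cbox 0 (2*pi)"
      using mode_integrable[OF cf U] by simp
  next
    show "continuous_on (I \<times> cbox 0 (2*pi)) (\<lambda>(t, \<phi>). f' t (of_real r * cis \<phi>) * cis (- of_int j * \<phi>))"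
      unfolding case_prod_unfold
      by (intro continuous_intros continuous_on_cis
          continuous_on_compose2[OF cf'[unfolded case_prod_unfold], of _ "\<lambda>x. (fst x, of_real r * cis (snd x))", simplified])
        (use U r in \<open>auto simp: norm_mult annular_def\<close>)
  qed (use I in auto)
  then show ?thesis
    unfolding at_within_open[OF I(3,1)] by (simp add: mode_def)
qed

lemma norm_mode_le:
  assumes "\<And>\<phi>. norm (f (of_real r * cis \<phi>)) \<le> K"
  shows "norm (mode j f r) \<le> 2 * pi * K"
proof (cases "(\<lambda>\<phi>. f (of_real r * cis \<phi>) * cis (- of_int j * \<phi>)) integrable_on {0..2*pi}")
  case True
  have "0 \<le> K" using assms[of 0] norm_ge_zero order_trans by blast
  then have "norm (integral (cbox 0 (2*pi)) (\<lambda>\<phi>. f (of_real r * cis \<phi>) * cis (- of_int j * \<phi>))) \<le> K * measure lborel (cbox 0 (2*pi))"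
    using True assms by (intro integrable_bound) (auto simp: norm_mult)
  then show ?thesis by (simp add: mode_def mult.commute)
next
  case False
  have "0 \<le> K" using assms[of 0] norm_ge_zero order_trans by blast
  then show ?thesis using False by (simp add: mode_def not_integrable_integral)
qed

text \<open>
  The limit is written as a mode of a constant function at the radius \<open>r0\<close>; such a mode does not
  depend on the radius.
\<close>
lemma mode_tendsto:
  assumes f: "continuous_on (annular {r0..}) f" "0 < r0" and lim: "(f \<longlongrightarrow> c) at_infinity"
  shows "(mode j f \<longlongrightarrow> mode j (\<lambda>_. c) r0) at_top"
proof (rule tendstoI)
  fix e :: real assume e: "0 < e"
  then have "0 < e / (4 * pi)" by simp
  with lim have "\<forall>\<^sub>F z in at_infinity. dist (f z) c < e / (4 * pi)"
    by (rule tendstoD)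
  then obtain b where b: "\<And>z. b \<le> norm z \<Longrightarrow> dist (f z) c < e / (4 * pi)"
    by (auto simp: eventually_at_infinity)
  show "\<forall>\<^sub>F r in at_top. dist (mode j f r) (mode j (\<lambda>_. c) r0) < e"
    using eventually_ge_at_top[of "max b r0"]
  proof eventually_elim
    case (elim r)
    have "mode j f r - mode j (\<lambda>_. c) r = mode j (\<lambda>z. f z - c) r"
      by (rule mode_diff[OF f(1), symmetric]) (use elim f in auto)
    moreover have "norm (mode j (\<lambda>z. f z - c) r) \<le> 2 * pi * (e / (4 * pi))"
      using elim f b by (intro norm_mode_le less_imp_le) (auto simp: norm_mult dist_norm)
    moreover have "mode j (\<lambda>_. c) r = mode j (\<lambda>_. c) r0"
      by (simp add: mode_def)
    ultimately show ?case
      using e by (simp add: dist_norm)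
  qed
qed

section \<open>Integration in polar coordinates\<close>

text \<open>
  Jacobian determinants belong to \<open>real ^ 2\<close>, while the integrals of interest live on \<open>complex\<close> and on
  \<open>real \<times> real\<close>. The obvious isometries match the coordinate axes and hence map boxes to boxes.
\<close>
lemma lborel_distr_orthonormal:
  fixes e :: "'a::euclidean_space \<Rightarrow> 'b::euclidean_space"
  assumes lin: "linear e" and bij: "bij_betw e Basis Basis"
    and iso: "\<And>x b. b \<in> Basis \<Longrightarrow> e x \<bullet> e b = x \<bullet> b"
  shows "distr lborel borel e = lborel"
proof (rule lborel_eqI[symmetric])
  have [measurable]: "e \<in> borel_measurable borel"
    by (intro borel_measurable_continuous_onI linear_continuous_on linear_conv_bounded_linear[THEN iffD1] lin)
  fix l u :: 'b assume lu: "\<And>b. b \<in> Basis \<Longrightarrow> l \<bullet> b \<le> u \<bullet> b"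
  define pull where "pull c = (\<Sum>b\<in>Basis. (c \<bullet> e b) *\<^sub>R b)" for c
  have pull: "pull c \<bullet> b = c \<bullet> e b" if "b \<in> Basis" for c b
    using that by (simp add: pull_def)
  have "e -` box l u = {x. \<forall>b\<in>Basis. l \<bullet> e b < e x \<bullet> e b \<and> e x \<bullet> e b < u \<bullet> e b}"
    unfolding box_def bij_betw_imp_surj_on[OF bij, symmetric] by auto
  also have "\<dots> = box (pull l) (pull u)"
    by (auto simp: box_def pull iso)
  finally have "emeasure (distr lborel borel e) (box l u) = emeasure lborel (box (pull l) (pull u))"
    by (simp add: emeasure_distr)
  also have "\<dots> = (\<Prod>b\<in>Basis. (pull u - pull l) \<bullet> b)"
    using lu bij by (intro emeasure_lborel_box) (auto simp: pull bij_betw_apply)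
  also have "(\<Prod>b\<in>Basis. (pull u - pull l) \<bullet> b) = (\<Prod>b\<in>Basis. (u - l) \<bullet> b)"
    using prod.reindex_bij_betw[OF bij, of "\<lambda>b. (u - l) \<bullet> b"] by (simp add: inner_diff_left pull)
  finally show "emeasure (distr lborel borel e) (box l u) = (\<Prod>b\<in>Basis. (u - l) \<bullet> b)" .
qed simp

definition vec_complex :: "real ^ 2 \<Rightarrow> complex" where
  "vec_complex x = Complex (x $ 1) (x $ 2)"

definition vec_pair :: "real ^ 2 \<Rightarrow> real \<times> real" where
  "vec_pair x = (x $ 1, x $ 2)"

lemma Basis_real_2: "(Basis :: (real ^ 2) set) = {axis 1 1, axis 2 1}"
  by (auto simp: Basis_vec_def UNIV_2)

lemma linear_vec_complex: "linear vec_complex"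
  by (auto simp: linear_iff vec_complex_def complex_eq_iff)

lemma linear_vec_pair: "linear vec_pair"
  by (auto simp: linear_iff vec_pair_def)

lemma lborel_distr_vec_complex: "distr lborel borel vec_complex = lborel"
proof (rule lborel_distr_orthonormal[OF linear_vec_complex])
  show "bij_betw vec_complex Basis Basis"
    by (auto simp: bij_betw_def inj_on_def Basis_real_2 Basis_complex_def vec_complex_def axis_def complex_eq_iff
        i_squared)
  show "vec_complex x \<bullet> vec_complex b = x \<bullet> b" for x b
    by (simp add: vec_complex_def inner_vec_def sum_2 inner_complex_def)
qed

lemma lborel_distr_vec_pair: "distr lborel borel vec_pair = lborel"
proof (rule lborel_distr_orthonormal[OF linear_vec_pair])
  show "bij_betw vec_pair Basis Basis"
    by (auto simp: bij_betw_def inj_on_def Basis_real_2 Basis_prod_def vec_pair_def axis_def)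
  show "vec_pair x \<bullet> vec_pair b = x \<bullet> b" for x b
    by (simp add: vec_pair_def inner_vec_def sum_2)
qed

lemma set_integral_pullback:
  fixes f :: "'b::euclidean_space \<Rightarrow> 'c::{banach, second_countable_topology}"
    and e :: "'a::euclidean_space \<Rightarrow> 'b"
  assumes distr: "distr lborel borel e = lborel" and e: "e \<in> borel_measurable borel"
    and f: "set_integrable lborel A f"
  shows "set_integrable lborel (e -` A) (\<lambda>x. f (e x))"
    and "(LINT x:e -` A|lborel. f (e x)) = (LINT z:A|lborel. f z)"
proof -
  have ind: "indicat_real (e -` A) x *\<^sub>R f (e x) = indicat_real A (e x) *\<^sub>R f (e x)" for x
    by (simp add: indicator_def)
  have "integrable (distr lborel borel e) (\<lambda>z. indicat_real A z *\<^sub>R f z)"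
    using f by (simp add: distr set_integrable_def)
  then have "integrable lborel (\<lambda>x. indicat_real A (e x) *\<^sub>R f (e x))"
    by (rule integrable_distr[rotated]) (use e in simp)
  then show "set_integrable lborel (e -` A) (\<lambda>x. f (e x))"
    by (simp add: set_integrable_def ind)
  have "(LINT z|distr lborel borel e. indicat_real A z *\<^sub>R f z) = (LINT x|lborel. indicat_real A (e x) *\<^sub>R f (e x))"
    using f e by (intro integral_distr) (auto simp: set_integrable_def)
  then show "(LINT x:e -` A|lborel. f (e x)) = (LINT z:A|lborel. f z)"
    by (simp add: set_lebesgue_integral_def ind distr)
qed

text \<open>
  Polar coordinates on a half-open annulus: there the polar map is injective on a half-open rectangle,
  and its Jacobian is the radius. The rectangle is closed afterwards at the cost of a null set.
\<close>
lemma polar_integral: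
  fixes f :: "complex \<Rightarrow> complex"
  assumes r0: "0 < r0" "r0 \<le> R" and f: "continuous_on {z. r0 \<le> cmod z \<and> cmod z \<le> R} f"
  shows "(LINT z:{z. r0 < cmod z \<and> cmod z \<le> R}|lborel. f z) =
    integral {r0..R} (\<lambda>r. of_real r * integral {0..2*pi} (\<lambda>\<phi>. f (of_real r * cis \<phi>)))"
proof -
  let ?ann = "{z. r0 < cmod z \<and> cmod z \<le> R}"
  let ?cann = "{z. r0 \<le> cmod z \<and> cmod z \<le> R}"
  define S :: "(real ^ 2) set" where "S = {x. r0 < x $ 1 \<and> x $ 1 \<le> R \<and> 0 \<le> x $ 2 \<and> x $ 2 < 2 * pi}"
  define g :: "real ^ 2 \<Rightarrow> real ^ 2" where "g x = vector [x $ 1 * cos (x $ 2), x $ 1 * sin (x $ 2)]" for x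
  define g' :: "real ^ 2 \<Rightarrow> real ^ 2 \<Rightarrow> real ^ 2" where
    "g' x h = vector [h $ 1 * cos (x $ 2) - x $ 1 * sin (x $ 2) * h $ 2, h $ 1 * sin (x $ 2) + x $ 1 * cos (x $ 2) * h $ 2]" for x h
  have e_g: "vec_complex (g x) = of_real (x $ 1) * cis (x $ 2)" for x
    by (simp add: vec_complex_def g_def complex_eq_iff)
  have meas: "vec_complex \<in> borel_measurable borel" "vec_pair \<in> borel_measurable borel"
    using linear_vec_complex linear_vec_pair
    by (auto intro!: borel_measurable_continuous_onI linear_continuous_on simp: linear_conv_bounded_linear)
  have inj_e: "vec_complex x = vec_complex y \<longleftrightarrow> x = y" for x y
    by (simp add: vec_complex_def vec_eq_iff forall_2)
  have image: "g ` S = vec_complex -` ?ann"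
  proof (intro equalityI subsetI)
    fix y assume "y \<in> g ` S"
    then show "y \<in> vec_complex -` ?ann"
      using r0 by (auto simp: e_g S_def norm_mult)
  next
    fix y assume y: "y \<in> vec_complex -` ?ann"
    define x :: "real ^ 2" where "x = vector [cmod (vec_complex y), Arg2pi (vec_complex y)]"
    have "vec_complex (g x) = vec_complex y"
      by (simp add: e_g x_def cis_conv_exp Arg2pi_eq[symmetric] mult.commute)
    moreover have "x \<in> S"
      using y Arg2pi by (auto simp: S_def x_def)
    ultimately show "y \<in> g ` S"
      by (metis inj_e image_eqI)
  qed
  have inj: "inj_on g S"
  proof (rule inj_onI)
    fix x y assume x: "x \<in> S" and y: "y \<in> S" and "g x = g y"
    then have eq: "of_real (x $ 1) * cis (x $ 2) = of_real (y $ 1) * cis (y $ 2)"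
      by (metis e_g)
    have pos: "x $ 1 > 0" "y $ 1 > 0"
      using x y r0 by (auto simp: S_def)
    have "cmod (of_real (x $ 1) * cis (x $ 2)) = cmod (of_real (y $ 1) * cis (y $ 2))"
      using eq by simp
    then have 1: "x $ 1 = y $ 1"
      using pos by (simp add: norm_mult)
    have "x $ 2 = Arg2pi (of_real (x $ 1) * cis (x $ 2))" "y $ 2 = Arg2pi (of_real (y $ 1) * cis (y $ 2))"
      using x y pos by (auto simp: S_def cis_conv_exp intro!: Arg2pi_unique[symmetric])
    then have 2: "x $ 2 = y $ 2"
      using eq by simp
    show "x = y" using 1 2 by (simp add: vec_eq_iff forall_2)
  qed
  have der: "(g has_derivative g' x) (at x within S)" for x
  proof -
    note [derivative_intros] = bounded_linear.has_derivative[OF bounded_linear_vec_nth]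
    have "((\<lambda>x. (x $ 1 * cos (x $ 2)) *\<^sub>R axis 1 1 + (x $ 1 * sin (x $ 2)) *\<^sub>R axis 2 1) has_derivative g' x)
      (at x within S)"
      by (auto intro!: derivative_eq_intros simp: fun_eq_iff vec_eq_iff forall_2 g'_def axis_def algebra_simps)
    moreover have "g = (\<lambda>x. (x $ 1 * cos (x $ 2)) *\<^sub>R axis 1 1 + (x $ 1 * sin (x $ 2)) *\<^sub>R axis 2 1)"
      by (auto simp: fun_eq_iff vec_eq_iff forall_2 g_def axis_def)
    ultimately show ?thesis by simp
  qed
  have det: "\<bar>det (matrix (g' x))\<bar> = x $ 1" if "x \<in> S" for x
  proof -
    have "det (matrix (g' x)) = x $ 1 * (cos (x $ 2) * cos (x $ 2)) + x $ 1 * (sin (x $ 2) * sin (x $ 2))"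
      unfolding det_2 matrix_def by (simp add: g'_def axis_def algebra_simps)
    also have "\<dots> = x $ 1 * (cos (x $ 2) * cos (x $ 2) + sin (x $ 2) * sin (x $ 2))"
      by (simp only: distrib_left)
    also have "\<dots> = x $ 1"
      by simp
    finally have "det (matrix (g' x)) = x $ 1" .
    then show ?thesis
      using that r0 by (simp add: S_def)
  qed

  have cont_h: "continuous_on (cbox (r0, 0) (R, 2*pi)) (\<lambda>(r, \<phi>). r *\<^sub>R f (of_real r * cis \<phi>))"
    unfolding case_prod_unfold
    by (intro continuous_intros continuous_on_compose2[OF f] continuous_on_cis)
      (use r0 in \<open>auto simp: norm_mult cbox_Pair_eq\<close>)
  have int_h: "set_integrable lborel (cbox (r0, 0) (R, 2*pi)) (\<lambda>(r, \<phi>). r *\<^sub>R f (of_real r * cis \<phi>))"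
    using borel_integrable_compact[OF compact_cbox cont_h] by (simp add: set_integrable_def)
  have cann: "compact ?cann"
  proof -
    have "?cann = cball 0 R \<inter> - ball 0 r0" by auto
    then show ?thesis by (simp add: compact_Int_closed closed_Compl)
  qed
  have int_f: "set_integrable lborel ?ann f"
    by (rule set_integrable_subset[of _ ?cann])
      (use borel_integrable_compact[OF cann f] in \<open>auto simp: set_integrable_def\<close>)
  note int_fe = set_integral_pullback(1)[OF lborel_distr_vec_complex meas(1) int_f]
  have S_meas: "S \<in> sets lebesgue"
  proof -
    have [measurable]: "(\<lambda>x::real^2. x $ i) \<in> borel_measurable borel" for i
      by (intro borel_measurable_continuous_onI continuous_intros)
    have "S \<in> sets borel"
      unfolding S_def by measurable
    then show ?thesis by (simp add: sets_completionI_sets)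
  qed
  \<comment> \<open>\<open>F\<close> is \<open>f\<close> in Cartesian coordinates, for domain and range alike\<close>
  define e' :: "complex \<Rightarrow> real ^ 2" where "e' c = vector [Re c, Im c]" for c
  have e': "vec_complex (e' c) = c" for c
    by (simp add: vec_complex_def e'_def)
  have lin_e': "bounded_linear e'"
    unfolding linear_conv_bounded_linear[symmetric]
    by (auto simp: linear_iff e'_def vec_eq_iff forall_2)
  have lin_e: "bounded_linear vec_complex"
    using linear_vec_complex by (simp add: linear_conv_bounded_linear)
  define F where "F x = e' (f (vec_complex x))" for x
  have "(\<lambda>x. f (vec_complex x)) absolutely_integrable_on g ` S"
    unfolding image using int_fe by (auto simp: set_integrable_def integrable_completion)
  then have F: "F absolutely_integrable_on g ` S"
    using absolutely_integrable_linear[OF _ lin_e'] by (simp add: F_def[abs_def] o_def)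
  then have F': "(\<lambda>x. \<bar>det (matrix (g' x))\<bar> *\<^sub>R F (g x)) absolutely_integrable_on S"
    using absolutely_integrable_change_of_variables[OF S_meas der inj] by blast
  have "(LINT z:?ann|lborel. f z) = (LINT x:vec_complex -` ?ann|lborel. f (vec_complex x))"
    by (rule set_integral_pullback(2)[OF lborel_distr_vec_complex meas(1) int_f, symmetric])
  also have "\<dots> = integral (g ` S) (vec_complex \<circ> F)"
    unfolding image by (subst set_borel_integral_eq_integral(2)[OF int_fe]) (simp add: F_def o_def e')
  also have "\<dots> = vec_complex (integral (g ` S) F)"
    using F by (intro integral_linear lin_e) (auto simp: absolutely_integrable_on_def)
  also have "\<dots> = vec_complex (integral S (\<lambda>x. \<bar>det (matrix (g' x))\<bar> *\<^sub>R F (g x)))"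
    using F by (subst integral_change_of_variables[OF S_meas der inj]) auto
  also have "\<dots> = integral S (vec_complex \<circ> (\<lambda>x. \<bar>det (matrix (g' x))\<bar> *\<^sub>R F (g x)))"
    using F' by (intro integral_linear[symmetric] lin_e) (auto simp: absolutely_integrable_on_def)
  also have "\<dots> = integral S (\<lambda>x. x $ 1 *\<^sub>R f (of_real (x $ 1) * cis (x $ 2)))"
    by (rule integral_cong) (simp add: F_def det linear_scale[OF linear_vec_complex] e' e_g)
  also have "\<dots> = integral (cbox (vector [r0, 0]) (vector [R, 2*pi])) (\<lambda>x::real^2. x $ 1 *\<^sub>R f (of_real (x $ 1) * cis (x $ 2)))"
  proof (rule integral_spike_set)
    let ?N = "{x::real^2. x $ 1 = r0} \<union> {x. x $ 2 = 2 * pi}"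
    have "negligible ?N"
      using negligible_standard_hyperplane[of "axis 1 1 :: real^2" r0]
        negligible_standard_hyperplane[of "axis 2 1 :: real^2" "2 * pi"]
      by (intro negligible_Un) (simp_all add: Basis_real_2 cart_eq_inner_axis)
    moreover have "cbox (vector [r0, 0]) (vector [R, 2*pi]) - S \<subseteq> ?N" "S - cbox (vector [r0, 0]) (vector [R, 2*pi]) = {}"
      by (auto simp: S_def mem_box_cart forall_2)
    ultimately show "negligible {x \<in> cbox (vector [r0, 0]) (vector [R, 2*pi]) - S. x $ 1 *\<^sub>R f (of_real (x $ 1) * cis (x $ 2)) \<noteq> 0}"
      "negligible {x \<in> S - cbox (vector [r0, 0]) (vector [R, 2*pi]). x $ 1 *\<^sub>R f (of_real (x $ 1) * cis (x $ 2)) \<noteq> 0}"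
      by (blast intro: negligible_subset)+
  qed
  also have "\<dots> = integral (cbox (r0, 0) (R, 2*pi)) (\<lambda>(r, \<phi>). r *\<^sub>R f (of_real r * cis \<phi>))"
  proof -
    have "cbox (vector [r0, 0]) (vector [R, 2*pi]) = vec_pair -` cbox (r0, 0) (R, 2*pi)"
      by (auto simp: mem_box_cart forall_2 vec_pair_def cbox_Pair_eq)
    moreover note set_integral_pullback[OF lborel_distr_vec_pair meas(2) int_h]
      set_borel_integral_eq_integral(2)[OF set_integral_pullback(1)[OF lborel_distr_vec_pair meas(2) int_h]]
      set_borel_integral_eq_integral(2)[OF int_h]
    ultimately show ?thesis
      by (simp add: vec_pair_def)
  qed
  also have "\<dots> = integral {r0..R} (\<lambda>r. of_real r * integral {0..2*pi} (\<lambda>\<phi>. f (of_real r * cis \<phi>)))"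
    using integral_prod_continuous[OF cont_h] by (simp add: scaleR_conv_of_real)
  finally show ?thesis .
qed

section \<open>Growth at infinity\<close>

lemma power_int_neg_tendsto_0:
  assumes "k \<ge> 1"
  shows "((\<lambda>R::real. R powi (- k)) \<longlongrightarrow> 0) at_top"
proof -
  have "filterlim (\<lambda>R::real. R ^ nat k) at_top at_top"
    using assms by (intro filterlim_pow_at_top filterlim_ident) auto
  then have "((\<lambda>R::real. inverse (R ^ nat k)) \<longlongrightarrow> 0) at_top"
    by (rule tendsto_inverse_0_at_top)
  moreover have "R powi (- k) = inverse (R ^ nat k)" for R :: real
    using assms by (simp add: power_int_minus power_int_def power_inverse)
  ultimately show ?thesis
    by simp
qed

lemma power_int_neg_tendsto_0_mult_bounded:
  fixes g :: "real \<Rightarrow> complex"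
  assumes "k \<ge> 1" and "\<And>R. R \<ge> a \<Longrightarrow> norm (g R) \<le> K"
  shows "((\<lambda>R. of_real R powi (- k) * g R) \<longlongrightarrow> 0) at_top"
proof (rule Lim_null_comparison)
  show "\<forall>\<^sub>F R in at_top. norm (of_real R powi (- k) * g R) \<le> R powi (- k) * K"
    using eventually_ge_at_top[of "max a 0"]
    by eventually_elim (auto simp: norm_mult norm_power_int intro!: mult_left_mono assms)
  show "((\<lambda>R. R powi (- k) * K) \<longlongrightarrow> 0) at_top"
    using tendsto_mult_right[OF power_int_neg_tendsto_0[OF assms(1)], of K] by simp
qed

text \<open>
  L'Hopital's rule in the form of comparison with powers.
\<close>
lemma real_growth_from_derivative:
  fixes f f' :: "real \<Rightarrow> real"
  assumes "m \<ge> 1" "\<And>r. r > a \<Longrightarrow> (f has_real_derivative f' r) (at r)"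
    and "((\<lambda>r. f' r / r powi (m - 1)) \<longlongrightarrow> c) at_top"
  shows "((\<lambda>r. f r / r powi m) \<longlongrightarrow> c / of_int m) at_top"
proof (rule lhospital_at_top_at_top)
  have "filterlim (\<lambda>R::real. R ^ nat m) at_top at_top"
    using assms by (intro filterlim_pow_at_top filterlim_ident) auto
  moreover have "r powi m = r ^ nat m" for r :: real
    using assms(1) by (simp add: power_int_def)
  ultimately show "LIM r at_top. (r::real) powi m :> at_top"
    by (simp only:)
  show "\<forall>\<^sub>F r in at_top. of_int m * (r::real) powi (m - 1) \<noteq> 0"
    using eventually_gt_at_top[of 0] by eventually_elim (use assms in auto)
  show "\<forall>\<^sub>F r in at_top. (f has_real_derivative f' r) (at r)"
    using eventually_gt_at_top[of a] by eventually_elim (use assms in auto)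
  show "\<forall>\<^sub>F r in at_top. ((\<lambda>r::real. r powi m) has_real_derivative of_int m * r powi (m - 1)) (at r)"
    using eventually_gt_at_top[of 0] by eventually_elim (auto intro!: derivative_eq_intros)
  show "((\<lambda>r. f' r / (of_int m * r powi (m - 1))) \<longlongrightarrow> c / of_int m) at_top"
    using tendsto_divide[OF assms(3) tendsto_const, of "of_int m"] assms(1) by (simp add: mult.commute)
qed

lemma growth_from_derivative:
  fixes f f' :: "real \<Rightarrow> complex"
  assumes m: "m \<ge> 1" and d: "\<And>r. r > a \<Longrightarrow> (f has_vector_derivative f' r) (at r)"
    and l: "((\<lambda>r. f' r / of_real r powi (m - 1)) \<longlongrightarrow> c) at_top"
  shows "((\<lambda>r. f r / of_real r powi m) \<longlongrightarrow> c / of_int m) at_top"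
proof -
  have dR: "((\<lambda>r. Re (f r)) has_real_derivative Re (f' r)) (at r)"
    and dI: "((\<lambda>r. Im (f r)) has_real_derivative Im (f' r)) (at r)" if "r > a" for r
    using d[OF that] by (simp_all add: has_vector_derivative_complex_iff)
  have Re_div: "Re (z / of_real r powi n) = Re z / r powi n"
    and Im_div: "Im (z / of_real r powi n) = Im z / r powi n" for z r n
    by (metis Re_divide_of_real of_real_power_int, metis Im_divide_of_real of_real_power_int)
  have "((\<lambda>r. Re (f' r) / r powi (m - 1)) \<longlongrightarrow> Re c) at_top"
      and "((\<lambda>r. Im (f' r) / r powi (m - 1)) \<longlongrightarrow> Im c) at_top"
    using tendsto_Re[OF l] tendsto_Im[OF l] unfolding Re_div Im_div .
  note real_growth_from_derivative[OF m dR this(1)] real_growth_from_derivative[OF m dI this(2)]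
  moreover have "c / of_int m = c / of_real (of_int m)"
    by simp
  ultimately show ?thesis
    unfolding tendsto_complex_iff Re_div Im_div by simp
qed

text \<open>
  Used to pass from statements integrated in time to statements at every single time.
\<close>
lemma continuous_zero_if_integrals_zero:
  fixes l :: "real \<Rightarrow> complex"
  assumes "\<And>s1 s2. 0 < s1 \<Longrightarrow> s1 < s2 \<Longrightarrow> s2 < T \<Longrightarrow> continuous_on {s1..s2} l"
    and "\<And>s1 s2. 0 < s1 \<Longrightarrow> s1 < s2 \<Longrightarrow> s2 < T \<Longrightarrow> integral {s1..s2} l = 0"
    and "t \<in> {0<..<T}"
  shows "l t = 0"
proof -
  define a where "a = t / 2"
  define b where "b = (t + T) / 2"
  have ab: "0 < a" "a < t" "t < b" "b < T"
    using assms(3) by (auto simp: a_def b_def)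
  have c: "continuous_on {a..b} l" using ab by (intro assms) auto
  have "((\<lambda>u. integral {a..u} l) has_vector_derivative l t) (at t within {a..b})"
    by (rule integral_has_vector_derivative[OF c]) (use ab in auto)
  then have "((\<lambda>u. integral {a..u} l) has_vector_derivative l t) (at t)"
    using ab by (simp add: at_within_Icc_at)
  moreover have "((\<lambda>u. integral {a..u} l) has_vector_derivative 0) (at t)"
  proof (rule has_vector_derivative_transform_within_open[OF has_vector_derivative_const])
    show "open {a<..<b}" "t \<in> {a<..<b}" using ab by auto
    show "0 = integral {a..u} l" if "u \<in> {a<..<b}" for u
      using assms(2)[of a u] that ab by auto
  qed
  ultimately show ?thesis by (rule vector_derivative_unique_at)
qed

section \<open>The radial equations of one angular mode\<close>

text \<open>
  The system satisfied by the angular modes of a flow, for one \<open>k \<ge> 1\<close>. With \<open>v\<close> the complex velocity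
  and \<open>w\<close> the vorticity, the functions of \<open>t\<close> and \<open>r\<close> stand for the modes
  \<open>A\<close>: \<open>v\<close>, of order \<open>k + 1\<close>; \<open>B\<close>: \<open>cnj v\<close>, of order \<open>k - 1\<close>; \<open>Om\<close>: \<open>w\<close>, of order \<open>k\<close>;
  \<open>P\<close>: \<open>w v\<close>, of order \<open>k + 1\<close>; \<open>Pb\<close>: \<open>w cnj v\<close>, of order \<open>k - 1\<close>; \<open>S\<close>: \<open>v\<^sup>2\<close>, of order
  \<open>k + 2\<close>; \<open>Sb\<close>: \<open>(cnj v)\<^sup>2\<close>, of order \<open>k - 2\<close>. Further, \<open>Om1\<close> is the radial derivative of \<open>Om\<close>,
  and \<open>At\<close>, \<open>Bt\<close> are the time derivatives of \<open>A\<close>, \<open>B\<close>.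
  
  The assumptions on radial derivatives are \<open>2\<partial>v = \<i>w\<close>, \<open>2\<partial>(v\<^sup>2) = 2\<i>wv\<close> and their conjugates.
  The assumption \<open>momentum\<close> is the momentum equation with the pressure already eliminated; it is
  assumed for \<open>r > r0\<close> only, as the equation of motion holds in the open domain.
\<close>
locale angular_mode_flow =
  fixes r0 T :: real and k :: int
    and A B Om Om1 P Pb S Sb At Bt :: "real \<Rightarrow> real \<Rightarrow> complex"
  assumes r0: "r0 > 0" and k: "k \<ge> 1"
    and cont: "\<And>X. X \<in> {A, B, Om, Om1, P, Pb, S, Sb, At, Bt} \<Longrightarrow>
      continuous_on ({0<..<T} \<times> {r0..}) (\<lambda>(t, r). X t r)"
    and A_deriv: "\<And>t r. 0 < t \<Longrightarrow> t < T \<Longrightarrow> r0 \<le> r \<Longrightarrow>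
      (A t has_vector_derivative \<i> * Om t r - of_int (k + 1) / of_real r * A t r) (at r within {r0..})"
    and B_deriv: "\<And>t r. 0 < t \<Longrightarrow> t < T \<Longrightarrow> r0 \<le> r \<Longrightarrow>
      (B t has_vector_derivative - \<i> * Om t r + of_int (k - 1) / of_real r * B t r) (at r within {r0..})"
    and Om_deriv: "\<And>t r. 0 < t \<Longrightarrow> t < T \<Longrightarrow> r0 \<le> r \<Longrightarrow>
      (Om t has_vector_derivative Om1 t r) (at r within {r0..})"
    and S_deriv: "\<And>t r. 0 < t \<Longrightarrow> t < T \<Longrightarrow> r0 \<le> r \<Longrightarrow>
      (S t has_vector_derivative 2 * \<i> * P t r - of_int (k + 2) / of_real r * S t r) (at r within {r0..})"
    and Sb_deriv: "\<And>t r. 0 < t \<Longrightarrow> t < T \<Longrightarrow> r0 \<le> r \<Longrightarrow>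
      (Sb t has_vector_derivative - 2 * \<i> * Pb t r + of_int (k - 2) / of_real r * Sb t r) (at r within {r0..})"
    and A_time: "\<And>t r. 0 < t \<Longrightarrow> t < T \<Longrightarrow> r0 \<le> r \<Longrightarrow> ((\<lambda>t. A t r) has_vector_derivative At t r) (at t)"
    and B_time: "\<And>t r. 0 < t \<Longrightarrow> t < T \<Longrightarrow> r0 \<le> r \<Longrightarrow> ((\<lambda>t. B t r) has_vector_derivative Bt t r) (at t)"
    and momentum: "\<And>t r. 0 < t \<Longrightarrow> t < T \<Longrightarrow> r0 < r \<Longrightarrow>
      ((\<lambda>r. of_real r powi (1 - k) * (Bt t r - At t r + 2 * \<i> * Om1 t r - \<i> * (P t r + Pb t r)) / (2 * of_int k)
          + \<i> * of_real r powi (- k) * Om t r)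
        has_vector_derivative of_real r powi (- k) * (At t r + \<i> * P t r)) (at r)"
    and boundary: "\<And>X t. X \<in> {A, B, P, Pb, At, Bt} \<Longrightarrow> 0 < t \<Longrightarrow> t < T \<Longrightarrow> X t r0 = 0"
    and bounded: "\<And>s1 s2. 0 < s1 \<Longrightarrow> s2 < T \<Longrightarrow>
      \<exists>K. \<forall>X\<in>{A, S, Sb}. \<forall>t\<in>{s1..s2}. \<forall>r\<ge>r0. norm (X t r) \<le> K"
    and far_field: "\<exists>L. \<forall>t. 0 < t \<and> t < T \<longrightarrow> (B t \<longlongrightarrow> L) at_top"
begin

lemma cont_radial:
  assumes "X \<in> {A, B, Om, Om1, P, Pb, S, Sb, At, Bt}" "0 < t" "t < T"
  shows "continuous_on {r0..} (X t)"
proof -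
  have "continuous_on {r0..} (\<lambda>r. case (t, r) of (t, r) \<Rightarrow> X t r)"
    by (rule continuous_on_compose2[OF cont[OF assms(1)]]) (use assms in \<open>auto intro!: continuous_intros\<close>)
  then show ?thesis by simp
qed

lemma cont_time:
  assumes "X \<in> {A, B, Om, Om1, P, Pb, S, Sb, At, Bt}" "0 < s1" "s2 < T" "r0 \<le> r"
  shows "continuous_on {s1..s2} (\<lambda>t. X t r)"
proof -
  have "continuous_on {s1..s2} (\<lambda>t. case (t, r) of (t, r) \<Rightarrow> X t r)"
    by (rule continuous_on_compose2[OF cont[OF assms(1)]]) (use assms in \<open>auto intro!: continuous_intros\<close>)
  then show ?thesis by simp
qed

text \<open>
  The two equations for \<open>A\<close> and \<open>B\<close> combine to \<open>(r powi (1 - k) * (A + B))' = - 2 k r powi (- k) * A\<close>,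
  which no longer contains the vorticity.
\<close>
lemma integral_A:
  assumes "0 < t" "t < T" "r0 \<le> R"
  shows "integral {r0..R} (\<lambda>r. of_real r powi (- k) * A t r) =
    - (of_real R powi (1 - k) * (A t R + B t R)) / (2 * of_int k)"
proof -
  let ?F = "\<lambda>r. - (of_real r powi (1 - k) * (A t r + B t r)) / (2 * of_int k)"
  have "((\<lambda>r. of_real r powi (- k) * A t r) has_integral ?F R - ?F r0) {r0..R}"
  proof (rule fundamental_theorem_of_calculus[OF assms(3)])
    fix r assume r: "r \<in> {r0..R}"
    then have nz: "r > 0" using r0 by auto
    have "((\<lambda>r. A t r + B t r) has_vector_derivative
        (\<i> * Om t r - of_int (k + 1) / of_real r * A t r)
          + (- \<i> * Om t r + of_int (k - 1) / of_real r * B t r)) (at r within {r0..R})"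
      using r assms by (intro has_vector_derivative_add
          has_vector_derivative_within_subset[OF A_deriv] has_vector_derivative_within_subset[OF B_deriv]) auto
    from has_vector_derivative_power_int_mult[OF this, of "1 - k"]
    have "((\<lambda>r. - (1 / (2 * of_int k)) * (of_real r powi (1 - k) * (A t r + B t r))) has_vector_derivative
       - (1 / (2 * of_int k)) * (of_real r powi (1 - k) * ((\<i> * Om t r - of_int (k + 1) / of_real r * A t r)
          + (- \<i> * Om t r + of_int (k - 1) / of_real r * B t r) + of_int (1 - k) / of_real r * (A t r + B t r))))
       (at r within {r0..R})"
      using nz by (intro has_vector_derivative_mult_right) auto
    also have "of_real r powi (1 - k) = of_real r * (of_real r powi (- k) :: complex)"
      using nz by (simp add: power_int_diff power_int_minus field_simps)
    finally have "(?F has_vector_derivative - (1 / (2 * of_int k)) * (of_real r * of_real r powi (- k)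
        * ((\<i> * Om t r - of_int (k + 1) / of_real r * A t r)
          + (- \<i> * Om t r + of_int (k - 1) / of_real r * B t r) + of_int (1 - k) / of_real r * (A t r + B t r))))
       (at r within {r0..R})"
      by simp
    then show "(?F has_vector_derivative of_real r powi (- k) * A t r) (at r within {r0..R})"
      by (rule has_vector_derivative_eq_rhs) (use nz k r in \<open>simp add: field_simps\<close>)
  qed
  then show ?thesis
    using boundary[of A] boundary[of B] assms by (simp add: integral_unique)
qed

text \<open>
  The time derivative of the preceding identity. It disposes of the radial integral of \<open>At\<close> that comes
  from the momentum equation, leaving only a term at the outer radius.
\<close>
lemma integral_A_time:
  assumes "0 < t" "t < T" "r0 \<le> R"
  shows "integral {r0..R} (\<lambda>r. of_real r powi (- k) * At t r) =
    - (of_real R powi (1 - k) * (At t R + Bt t R)) / (2 * of_int k)"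
proof -
  have "((\<lambda>t. integral (cbox r0 R) (\<lambda>r. of_real r powi (- k) * A t r)) has_vector_derivative
      integral (cbox r0 R) (\<lambda>r. of_real r powi (- k) * At t r)) (at t within {0<..<T})"
  proof (rule leibniz_rule_vector_derivative)
    fix t r assume "t \<in> {0<..<T}" "r \<in> cbox r0 R"
    then have "((\<lambda>t. A t r) has_vector_derivative At t r) (at t within {0<..<T})"
      using A_time by (auto intro: has_vector_derivative_at_within)
    then show "((\<lambda>t. of_real r powi (- k) * A t r) has_vector_derivative of_real r powi (- k) * At t r)
        (at t within {0<..<T})"
      by (rule has_vector_derivative_mult_right)
  next
    fix t assume "t \<in> {0<..<T}"
    then show "(\<lambda>r. of_real r powi (- k) * A t r) integrable_on cbox r0 R"
      using r0 by (auto intro!: integrable_continuous_real continuous_intros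
          continuous_on_subset[OF cont_radial[of A t]])
  next
    have "continuous_on ({0<..<T} \<times> cbox r0 R) (\<lambda>(t, r). At t r)"
      by (rule continuous_on_subset[OF cont[of At]]) auto
    then show "continuous_on ({0<..<T} \<times> cbox r0 R) (\<lambda>(t, r). of_real r powi (- k) * At t r)"
      using r0 unfolding case_prod_unfold by (auto intro!: continuous_intros)
  qed (use assms in auto)
  then have "((\<lambda>t. integral {r0..R} (\<lambda>r. of_real r powi (- k) * A t r)) has_vector_derivative
      integral {r0..R} (\<lambda>r. of_real r powi (- k) * At t r)) (at t)"
    using assms by (simp add: at_within_open[of t "{0<..<T}"])
  moreover have "((\<lambda>t. integral {r0..R} (\<lambda>r. of_real r powi (- k) * A t r)) has_vector_derivative
      - (of_real R powi (1 - k) * (At t R + Bt t R)) / (2 * of_int k)) (at t)"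
  proof (rule has_vector_derivative_transform_within_open[of _ _ _ "{0<..<T}"])
    have "((\<lambda>t. - (of_real R powi (1 - k) / (2 * of_int k)) * (A t R + B t R)) has_vector_derivative
      - (of_real R powi (1 - k) / (2 * of_int k)) * (At t R + Bt t R)) (at t)"
      using assms by (intro has_vector_derivative_mult_right has_vector_derivative_add A_time B_time) auto
    then show "((\<lambda>t. - (of_real R powi (1 - k) * (A t R + B t R)) / (2 * of_int k)) has_vector_derivative
      - (of_real R powi (1 - k) * (At t R + Bt t R)) / (2 * of_int k)) (at t)"
      by simp
  qed (use assms integral_A in auto)
  ultimately show ?thesis
    by (rule vector_derivative_unique_at)
qed

text \<open>
  In polar coordinates, the integral of \<open>w v / z ^ (k + 1)\<close> over the annulus between \<open>r0\<close> and \<open>R\<close>.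
\<close>
definition flux :: "real \<Rightarrow> real \<Rightarrow> complex" where
  "flux t R = integral {r0..R} (\<lambda>r. of_real r powi (- k) * P t r)"

lemma weighted_continuous:
  assumes "X \<in> {A, B, Om, Om1, P, Pb, S, Sb, At, Bt}" "0 < t" "t < T"
  shows "continuous_on {r0..} (\<lambda>r. of_real r powi m * X t r)"
  using r0 by (intro continuous_intros cont_radial assms) auto

text \<open>
  The momentum equation integrated from \<open>r0\<close> to \<open>R\<close>. The right-hand side is the expression to be
  determined; the left-hand side consists of terms at the radius \<open>R\<close>. At \<open>r0\<close> the no-slip condition
  leaves only the vorticity.
\<close>
lemma balance:
  assumes "0 < t" "t < T" "r0 \<le> R"
  shows "of_real R powi (1 - k) * (2 * Bt t R + (2 * \<i> * Om1 t R - \<i> * (P t R + Pb t R)))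
      + 2 * \<i> * of_int k * of_real R powi (- k) * Om t R
    = 2 * \<i> * of_real r0 powi (- k) * (of_real r0 * Om1 t r0 + of_int k * Om t r0)
      + 2 * \<i> * of_int k * flux t R"
proof -
  let ?C = "\<lambda>r. of_real r powi (1 - k) * (Bt t r - At t r + 2 * \<i> * Om1 t r - \<i> * (P t r + Pb t r)) / (2 * of_int k)
      + \<i> * of_real r powi (- k) * Om t r"
  have cont': "continuous_on {r0..R} (X t)" if "X \<in> {A, B, Om, Om1, P, Pb, S, Sb, At, Bt}" for X
    by (rule continuous_on_subset[OF cont_radial[OF that]]) (use assms in auto)
  have "((\<lambda>r. of_real r powi (- k) * (At t r + \<i> * P t r)) has_integral ?C R - ?C r0) {r0..R}"
  proof (rule fundamental_theorem_of_calculus_interior[OF assms(3)])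
    show "continuous_on {r0..R} ?C"
      using r0 k by (intro continuous_intros cont') auto
  qed (use momentum assms in auto)
  moreover have "((\<lambda>r. of_real r powi (- k) * At t r + \<i> * (of_real r powi (- k) * P t r)) has_integral
      integral {r0..R} (\<lambda>r. of_real r powi (- k) * At t r) + \<i> * flux t R) {r0..R}"
    unfolding flux_def
    by (intro has_integral_add has_integral_mult_right integrable_integral integrable_continuous_real
        continuous_on_subset[OF weighted_continuous] assms) auto
  then have "((\<lambda>r. of_real r powi (- k) * (At t r + \<i> * P t r)) has_integral
      integral {r0..R} (\<lambda>r. of_real r powi (- k) * At t r) + \<i> * flux t R) {r0..R}"
    by (simp add: algebra_simps)
  ultimately have "?C R - ?C r0 = integral {r0..R} (\<lambda>r. of_real r powi (- k) * At t r) + \<i> * flux t R"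
    by (rule has_integral_unique)
  then have "?C R - ?C r0 = - (of_real R powi (1 - k) * (At t R + Bt t R)) / (2 * of_int k) + \<i> * flux t R"
    unfolding integral_A_time[OF assms] .
  moreover have "?C r0 = \<i> * of_real r0 powi (- k) * (of_real r0 * Om1 t r0 + of_int k * Om t r0) / of_int k"
  proof -
    have "of_real r0 powi (1 - k) = of_real r0 * (of_real r0 powi (- k) :: complex)"
      using r0 by (simp add: power_int_diff power_int_minus field_simps)
    then show ?thesis
      using boundary[of At t] boundary[of Bt t] boundary[of P t] boundary[of Pb t] assms k
      by (simp add: field_simps)
  qed
  ultimately have "?C R = - (of_real R powi (1 - k) * (At t R + Bt t R)) / (2 * of_int k) + \<i> * flux t R
      + \<i> * of_real r0 powi (- k) * (of_real r0 * Om1 t r0 + of_int k * Om t r0) / of_int k"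
    by (simp add: algebra_simps)
  then have "2 * of_int k * ?C R = 2 * of_int k * (- (of_real R powi (1 - k) * (At t R + Bt t R)) / (2 * of_int k)
      + \<i> * flux t R + \<i> * of_real r0 powi (- k) * (of_real r0 * Om1 t r0 + of_int k * Om t r0) / of_int k)"
    by (rule arg_cong)
  moreover have "2 * of_int k * (x / (2 * of_int k) + y) = x + 2 * of_int k * y" for x y :: complex
    using k by (simp add: distrib_left)
  moreover have "2 * of_int k * (x / (2 * of_int k) + y + z / of_int k) = x + 2 * of_int k * y + 2 * z" for x y z :: complex
    using k by (simp add: distrib_left)
  ultimately have "of_real R powi (1 - k) * (Bt t R - At t R + 2 * \<i> * Om1 t R - \<i> * (P t R + Pb t R))
      + 2 * of_int k * (\<i> * of_real R powi (- k) * Om t R)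
    = - (of_real R powi (1 - k) * (At t R + Bt t R)) + 2 * of_int k * (\<i> * flux t R)
      + 2 * (\<i> * of_real r0 powi (- k) * (of_real r0 * Om1 t r0 + of_int k * Om t r0))"
    by (simp only:)
  then show ?thesis
    by (simp add: algebra_simps)
qed

text \<open>
  Since \<open>2\<i>wv = 2\<partial>(v\<^sup>2)\<close>, the flux is a boundary term plus the integral of \<open>r powi (- k - 1) * S\<close>.
  Both are controlled by a bound for \<open>v\<close> alone, hence uniformly in time.
\<close>
lemma flux_Cauchy:
  assumes t: "0 < t" "t < T" and K: "\<And>r. r0 \<le> r \<Longrightarrow> norm (S t r) \<le> K" and R: "r0 \<le> R" "R \<le> R'"
  shows "norm (flux t R' - flux t R) \<le> 3 * K * R powi (- k)"
proof (cases "R = R'")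
  case True
  have "0 \<le> K" using K[of r0] norm_ge_zero order_trans by blast
  then show ?thesis using True R r0 by simp
next
  case False
  \<comment> \<open>\<open>?f\<close> is the flux without its boundary term, and \<open>?g\<close> majorizes the variation of \<open>?f\<close>\<close>
  let ?f = "\<lambda>r. flux t r + (\<i> / 2) * (of_real r powi (- k) * S t r)"
  let ?g = "\<lambda>r. - (of_int (k + 1) * K / of_int k) * r powi (- k)"
  have flux_deriv: "(flux t has_vector_derivative of_real r powi (- k) * P t r) (at r within {r0..R'})"
    if "r \<in> {r0..R'}" for r
    unfolding flux_def[abs_def] using that
    by (intro integral_has_vector_derivative continuous_on_subset[OF weighted_continuous] t) auto
  have f_deriv: "(?f has_vector_derivative - \<i> * of_int (k + 1) * of_real r powi (- k - 1) * S t r)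
      (at r within {r0..R'})" if r: "r \<in> {r0..R'}" for r
  proof -
    have nz: "r \<noteq> 0" using r r0 by auto
    have "(S t has_vector_derivative 2 * \<i> * P t r - of_int (k + 2) / of_real r * S t r) (at r within {r0..R'})"
      by (rule has_vector_derivative_within_subset[OF S_deriv]) (use r t in auto)
    from has_vector_derivative_add[OF flux_deriv[OF r] has_vector_derivative_mult_right[OF
        has_vector_derivative_power_int_mult[OF this nz, of "- k"], of "\<i> / 2"]]
    show ?thesis
      by (rule has_vector_derivative_eq_rhs) (use nz in \<open>simp add: field_simps power_int_diff\<close>)
  qed
  have "norm (?f R' - ?f R) \<le> ?g R' - ?g R"
  proof (rule differentiable_bound_general[where f' = "\<lambda>r. - \<i> * of_int (k + 1) * of_real r powi (- k - 1) * S t r"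
        and \<phi>' = "\<lambda>r. of_int (k + 1) * K * r powi (- k - 1)"])
    show "R < R'" using False R by simp
    have "continuous_on {r0..R'} ?f"
      using f_deriv by (meson continuous_on_eq_continuous_within has_vector_derivative_continuous)
    then show "continuous_on {R..R'} ?f"
      by (rule continuous_on_subset) (use R in auto)
    show "continuous_on {R..R'} ?g"
      using R r0 by (intro continuous_intros) auto
    fix r assume r: "R < r" "r < R'"
    then have "(?f has_vector_derivative - \<i> * of_int (k + 1) * of_real r powi (- k - 1) * S t r) (at r within {r0..R'})"
      using R by (intro f_deriv) auto
    then show "(?f has_vector_derivative - \<i> * of_int (k + 1) * of_real r powi (- k - 1) * S t r) (at r)"
      using r R by (simp add: at_within_Icc_at)
    show "(?g has_vector_derivative of_int (k + 1) * K * r powi (- k - 1)) (at r)"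
      using r R r0 k unfolding has_real_derivative_iff_has_vector_derivative[symmetric]
      by (auto intro!: derivative_eq_intros simp: field_simps)
    have "norm (- \<i> * of_int (k + 1) * of_real r powi (- k - 1) * S t r)
        = of_int (k + 1) * r powi (- k - 1) * norm (S t r)"
      using r R r0 k by (simp add: norm_mult norm_power_int del: of_int_add)
    also have "\<dots> \<le> of_int (k + 1) * r powi (- k - 1) * K"
      using r R r0 k by (intro mult_left_mono K) auto
    finally show "norm (- \<i> * of_int (k + 1) * of_real r powi (- k - 1) * S t r)
        \<le> of_int (k + 1) * K * r powi (- k - 1)"
      by (simp add: mult_ac)
  qed
  also have "\<dots> \<le> 2 * K * R powi (- k)"
  proof -
    have "0 \<le> K" using K[of r0] norm_ge_zero order_trans by blast
    moreover have "of_int (k + 1) / of_int k \<le> (2::real)"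
      using k by (simp add: field_simps)
    ultimately have "of_int (k + 1) / of_int k * (K * R powi (- k)) \<le> 2 * (K * R powi (- k))"
      using R r0 by (intro mult_right_mono) auto
    moreover have "0 \<le> of_int (k + 1) * K / of_int k * R' powi (- k)"
      using R r0 k \<open>0 \<le> K\<close> by auto
    ultimately show ?thesis by (simp add: algebra_simps)
  qed
  finally have main: "norm (?f R' - ?f R) \<le> 2 * K * R powi (- k)" .
  \<comment> \<open>the boundary term of the integration by parts, at any radius from \<open>R\<close> on\<close>
  have S_bound: "norm ((\<i> / 2) * (of_real r powi (- k) * S t r)) \<le> K * R powi (- k) / 2" if "R \<le> r" for r
  proof -
    have "r powi (- k) \<le> R powi (- k)"
      using that R r0 k by (auto simp: power_int_minus power_int_def intro!: le_imp_inverse_le power_mono)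
    then have "r powi (- k) * norm (S t r) \<le> R powi (- k) * K"
      using that R r0 by (intro mult_mono K) auto
    then show ?thesis
      using that R r0 by (simp add: norm_mult norm_power_int mult_ac)
  qed
  have "flux t R' - flux t R = (?f R' - ?f R) - (\<i> / 2) * (of_real R' powi (- k) * S t R')
      + (\<i> / 2) * (of_real R powi (- k) * S t R)"
    by simp
  also have "norm \<dots> \<le> 2 * K * R powi (- k) + K * R powi (- k) / 2 + K * R powi (- k) / 2"
    by (rule order_trans[OF norm_triangle_ineq add_mono[OF order_trans[OF norm_triangle_ineq4
          add_mono[OF main S_bound]] S_bound]]) (use R in auto)
  finally show ?thesis by simp
qed

text \<open>
  Defined along one sequence of radii, which suffices because of the rate in the next lemma.
\<close>
definition flux_limit :: "real \<Rightarrow> complex" where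
  "flux_limit t = lim (\<lambda>n. flux t (r0 + real n))"

lemma flux_limit_rate:
  assumes "0 < s1" "s2 < T"
  shows "\<exists>C. \<forall>t\<in>{s1..s2}. \<forall>R\<ge>r0. norm (flux t R - flux_limit t) \<le> C * R powi (- k)"
proof -
  obtain K where K: "\<And>t r. t \<in> {s1..s2} \<Longrightarrow> r0 \<le> r \<Longrightarrow> norm (S t r) \<le> K"
    using bounded[OF assms] by blast
  have "norm (flux t R - flux_limit t) \<le> 3 * K * R powi (- k)" if t: "t \<in> {s1..s2}" and R: "r0 \<le> R" for t R
  proof -
    have t': "0 < t" "t < T" using t assms by auto
    have bound: "norm (flux t R' - flux t R) \<le> 3 * K * R powi (- k)" if "r0 \<le> R" "R \<le> R'" for R R'
      using flux_Cauchy[OF t' K[OF t] that] by simp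
    have radii: "filterlim (\<lambda>n. r0 + real n) at_top sequentially"
      by (intro filterlim_tendsto_add_at_top[OF tendsto_const] filterlim_real_sequentially)
    have rate: "(\<lambda>n. 3 * K * (r0 + real n) powi (- k)) \<longlonglongrightarrow> 0"
      using tendsto_mult_right_zero[OF filterlim_compose[OF power_int_neg_tendsto_0[OF k] radii], of "3 * K"]
      by simp
    have "Cauchy (\<lambda>n. flux t (r0 + real n))"
    proof (rule CauchyI')
      fix e :: real assume e: "0 < e"
      then obtain M where M: "\<And>n. n \<ge> M \<Longrightarrow> \<bar>3 * K * (r0 + real n) powi (- k)\<bar> < e"
        using LIMSEQ_D[OF rate e] by auto
      have "norm (flux t (r0 + real m) - flux t (r0 + real n)) < e" if "m \<ge> M" "n > m" for m n
        using bound[of "r0 + real m" "r0 + real n"] M[OF that(1)] that by (simp add: norm_minus_commute)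
      then show "\<exists>M. \<forall>m\<ge>M. \<forall>n>m. dist (flux t (r0 + real m)) (flux t (r0 + real n)) < e"
        by (auto simp: dist_norm)
    qed
    then have lim: "(\<lambda>n. flux t (r0 + real n)) \<longlonglongrightarrow> flux_limit t"
      unfolding flux_limit_def by (simp add: Cauchy_convergent_iff convergent_LIMSEQ_iff)
    have "norm (flux_limit t - flux t R) \<le> 3 * K * R powi (- k)"
    proof (rule Lim_norm_ubound[OF _ tendsto_diff[OF lim tendsto_const]])
      show "\<forall>\<^sub>F n in sequentially. norm (flux t (r0 + real n) - flux t R) \<le> 3 * K * R powi (- k)"
        using radii[unfolded filterlim_at_top, rule_format, of R] by eventually_elim (use bound R in auto)
    qed simp
    then show ?thesis by (simp add: norm_minus_commute)
  qed
  then show ?thesis by blast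
qed

lemma flux_tendsto:
  assumes "0 < t" "t < T"
  shows "(flux t \<longlongrightarrow> flux_limit t) at_top"
proof -
  obtain C where C: "\<And>R. R \<ge> r0 \<Longrightarrow> norm (flux t R - flux_limit t) \<le> C * R powi (- k)"
    using flux_limit_rate[OF assms] by auto
  have "((\<lambda>R. flux t R - flux_limit t) \<longlongrightarrow> 0) at_top"
  proof (rule Lim_null_comparison)
    show "\<forall>\<^sub>F R in at_top. norm (flux t R - flux_limit t) \<le> C * R powi (- k)"
      using eventually_ge_at_top[of r0] by eventually_elim (rule C)
    show "((\<lambda>R. C * R powi (- k)) \<longlongrightarrow> 0) at_top"
      by (rule tendsto_mult_right_zero[OF power_int_neg_tendsto_0[OF k]])
  qed
  then show ?thesis by (simp add: Lim_null[symmetric])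
qed

lemma flux_continuous:
  assumes "0 < s1" "s2 < T" "r0 \<le> R"
  shows "continuous_on {s1..s2} (\<lambda>t. flux t R)"
proof -
  have "continuous_on ({s1..s2} \<times> cbox r0 R) (\<lambda>(t, r). P t r)"
    by (rule continuous_on_subset[OF cont[of P]]) (use assms in auto)
  then have "continuous_on ({s1..s2} \<times> cbox r0 R) (\<lambda>(t, r). of_real r powi (- k) * P t r)"
    using r0 unfolding case_prod_unfold by (auto intro!: continuous_intros)
  from integral_continuous_on_param[OF this] show ?thesis
    by (simp add: flux_def)
qed

lemma flux_limit_uniform:
  assumes "0 < s1" "s2 < T"
  shows "uniform_limit {s1..s2} (\<lambda>R t. flux t R) flux_limit at_top"
proof -
  obtain C where C: "\<forall>t\<in>{s1..s2}. \<forall>R\<ge>r0. norm (flux t R - flux_limit t) \<le> C * R powi (- k)"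
    using flux_limit_rate[OF assms] by blast
  show ?thesis
  proof (rule uniform_limitI)
    fix e :: real assume "0 < e"
    have "((\<lambda>R. C * R powi (- k)) \<longlongrightarrow> 0) at_top"
      by (rule tendsto_mult_right_zero[OF power_int_neg_tendsto_0[OF k]])
    then have "\<forall>\<^sub>F R in at_top. C * R powi (- k) < e"
      using \<open>0 < e\<close> by (rule order_tendstoD)
    with eventually_ge_at_top[of r0]
    show "\<forall>\<^sub>F R in at_top. \<forall>t\<in>{s1..s2}. dist (flux t R) (flux_limit t) < e"
      by eventually_elim (use C in \<open>fastforce simp: dist_norm\<close>)
  qed
qed

lemma flux_limit_continuous:
  assumes "0 < s1" "s2 < T"
  shows "continuous_on {s1..s2} flux_limit"
proof (rule uniform_limit_theorem[OF _ flux_limit_uniform[OF assms]])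
  show "\<forall>\<^sub>F R in at_top. continuous_on {s1..s2} (\<lambda>t. flux t R)"
    using eventually_ge_at_top[of r0] by eventually_elim (rule flux_continuous[OF assms])
qed simp

lemma integral_flux_tendsto:
  assumes "0 < s1" "s2 < T"
  shows "((\<lambda>R. integral {s1..s2} (\<lambda>t. flux t R)) \<longlongrightarrow> integral {s1..s2} flux_limit) at_top"
proof -
  have ev: "\<forall>\<^sub>F R in at_top. flux t (max r0 R) = flux t R" for t
    using eventually_ge_at_top[of r0] by eventually_elim (simp add: max_absorb2)
  have "uniform_limit {s1..s2} (\<lambda>R t. flux t (max r0 R)) flux_limit at_top"
  proof -
    have "filterlim (\<lambda>R::real. max r0 R) at_top at_top"
      by (rule filterlim_at_top_mono[OF filterlim_ident]) auto
    from filterlim_compose[OF flux_limit_uniform[OF assms] this] show ?thesis .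
  qed
  then obtain I Jv where I: "\<And>R. ((\<lambda>t. flux t (max r0 R)) has_integral I R) {s1..s2}"
      "(flux_limit has_integral Jv) {s1..s2}" "(I \<longlongrightarrow> Jv) at_top"
    by (rule uniform_limit_integral) (use flux_continuous[OF assms] in auto)
  have "\<forall>\<^sub>F R in at_top. I R = integral {s1..s2} (\<lambda>t. flux t R)"
    using eventually_ge_at_top[of r0]
    by eventually_elim (metis I(1) integral_unique max.absorb2)
  with I(3) have "((\<lambda>R. integral {s1..s2} (\<lambda>t. flux t R)) \<longlongrightarrow> Jv) at_top"
    by (rule Lim_transform_eventually)
  then show ?thesis using I(2) by (simp add: integral_unique)
qed

definition defect :: "real \<Rightarrow> complex" where
  "defect t = 2 * \<i> * of_real r0 powi (- k) * (of_real r0 * Om1 t r0 + of_int k * Om t r0)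
     + 2 * \<i> * of_int k * flux_limit t"

lemma defect_continuous:
  assumes "0 < s1" "s2 < T"
  shows "continuous_on {s1..s2} defect"
  unfolding defect_def[abs_def]
  by (intro continuous_intros cont_time[of Om1] cont_time[of Om] flux_limit_continuous assms) auto

lemma time_average_derivative:
  assumes X: "X \<in> {Om, S, Sb, A}" and s: "0 < s1" "s2 < T"
    and d: "\<And>t r. 0 < t \<Longrightarrow> t < T \<Longrightarrow> r0 \<le> r \<Longrightarrow> (X t has_vector_derivative X' t r) (at r within {r0..})"
    and c: "continuous_on ({0<..<T} \<times> {r0..}) (\<lambda>(t, r). X' t r)"
    and r: "r > r0"
  shows "((\<lambda>r. integral {s1..s2} (\<lambda>t. X t r)) has_vector_derivative integral {s1..s2} (\<lambda>t. X' t r)) (at r)"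
proof -
  have "((\<lambda>r. integral (cbox s1 s2) (\<lambda>t. X t r)) has_vector_derivative
      integral (cbox s1 s2) (\<lambda>t. X' t r)) (at r within {r0<..})"
  proof (rule leibniz_rule_vector_derivative)
    fix x t assume "x \<in> {r0<..}" "t \<in> cbox s1 s2"
    then show "(X t has_vector_derivative X' t x) (at x within {r0<..})"
      using s by (intro has_vector_derivative_within_subset[OF d]) auto
  next
    fix x assume "x \<in> {r0<..}"
    then show "(\<lambda>t. X t x) integrable_on cbox s1 s2"
      using X s cont_time[of X s1 s2 x] by (auto intro!: integrable_continuous_real)
  next
    show "continuous_on ({r0<..} \<times> cbox s1 s2) (\<lambda>(r, t). X' t r)"
      unfolding case_prod_unfold
      by (rule continuous_on_compose2[OF c[unfolded case_prod_unfold], of _ "\<lambda>x. (snd x, fst x)", simplified])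
        (use s in \<open>auto intro!: continuous_intros\<close>)
  qed (use r in auto)
  then show ?thesis
    using r by (simp add: at_within_open[of r "{r0<..}"])
qed

text \<open>
  Suppose that the integral is \<open>c\<close>. After integration in time the term \<open>Bt\<close> of \<open>balance\<close> turns into a
  difference of two values of \<open>B\<close>, which tends to 0. The remaining terms at radius \<open>R\<close> then tend to \<open>c\<close>,
  and they are essentially \<open>r powi (1 - 2 * k)\<close> times the radial derivative of
  \<open>r powi k * (2 * \<i> * Om + U)\<close>, where \<open>U\<close> is bounded. So \<open>Om\<close> behaves like a multiple of \<open>c * r powi k\<close>,
  and by the equation for \<open>A\<close> the time integral of \<open>A\<close> behaves like a multiple of
  \<open>c * r powi (k + 1)\<close>. It is bounded, so \<open>c = 0\<close>.
\<close>
lemma integral_defect: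
  assumes s: "0 < s1" "s1 < s2" "s2 < T"
  shows "integral {s1..s2} defect = 0"
proof -
  let ?all = "{A, B, Om, Om1, P, Pb, S, Sb, At, Bt}"
  define av where "av X r = integral {s1..s2} (\<lambda>t. X t r)" for X :: "real \<Rightarrow> real \<Rightarrow> complex" and r
  define c where "c = integral {s1..s2} defect"
  have av: "((\<lambda>t. X t r) has_integral av X r) {s1..s2}" if "X \<in> ?all" "r0 \<le> r" for X r
    unfolding av_def using that s
    by (intro integrable_integral integrable_continuous_real cont_time[of X]) auto
  define g where "g R = of_real R powi (1 - k) * (2 * \<i> * av Om1 R - \<i> * (av P R + av Pb R))
      + 2 * \<i> * of_int k * of_real R powi (- k) * av Om R" for R
  have g_tendsto: "(g \<longlongrightarrow> c) at_top"
  proof -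
    \<comment> \<open>the contribution of the boundary circle to the defect\<close>
    define X0 where "X0 = integral {s1..s2} (\<lambda>t. 2 * \<i> * of_real r0 powi (- k) * (of_real r0 * Om1 t r0 + of_int k * Om t r0))"
    have X0: "((\<lambda>t. 2 * \<i> * of_real r0 powi (- k) * (of_real r0 * Om1 t r0 + of_int k * Om t r0)) has_integral X0) {s1..s2}"
      unfolding X0_def using s
      by (intro integrable_integral integrable_continuous_real continuous_intros cont_time[of Om1] cont_time[of Om]) auto
    have flux: "((\<lambda>t. flux t R) has_integral integral {s1..s2} (\<lambda>t. flux t R)) {s1..s2}" if "r0 \<le> R" for R
      using s that by (intro integrable_integral integrable_continuous_real flux_continuous) auto
    have "(flux_limit has_integral integral {s1..s2} flux_limit) {s1..s2}"
      using s by (intro integrable_integral integrable_continuous_real flux_limit_continuous) auto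
    then have c_eq: "c = X0 + 2 * \<i> * of_int k * integral {s1..s2} flux_limit"
      unfolding c_def defect_def[abs_def] by (intro integral_unique has_integral_add X0 has_integral_mult_right)
    \<comment> \<open>\<open>balance\<close> integrated over \<open>{s1..s2}\<close>\<close>
    have g_eq: "g R = X0 + 2 * \<i> * of_int k * integral {s1..s2} (\<lambda>t. flux t R)
        - of_real R powi (1 - k) * (2 * (B s2 R - B s1 R))" if R: "r0 \<le> R" for R
    proof -
      have Bt: "((\<lambda>t. Bt t R) has_integral B s2 R - B s1 R) {s1..s2}"
        using s R by (intro fundamental_theorem_of_calculus has_vector_derivative_at_within[OF B_time]) auto
      have "((\<lambda>t. of_real R powi (1 - k) * (2 * Bt t R + (2 * \<i> * Om1 t R - \<i> * (P t R + Pb t R)))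
            + 2 * \<i> * of_int k * of_real R powi (- k) * Om t R) has_integral
          of_real R powi (1 - k) * (2 * (B s2 R - B s1 R) + (2 * \<i> * av Om1 R - \<i> * (av P R + av Pb R)))
            + 2 * \<i> * of_int k * of_real R powi (- k) * av Om R) {s1..s2}"
        using R by (intro has_integral_add has_integral_diff has_integral_mult_right Bt av) auto
      moreover have "((\<lambda>t. of_real R powi (1 - k) * (2 * Bt t R + (2 * \<i> * Om1 t R - \<i> * (P t R + Pb t R)))
            + 2 * \<i> * of_int k * of_real R powi (- k) * Om t R) has_integral
          X0 + 2 * \<i> * of_int k * integral {s1..s2} (\<lambda>t. flux t R)) {s1..s2}"
      proof (rule has_integral_eq)
        show "((\<lambda>t. 2 * \<i> * of_real r0 powi (- k) * (of_real r0 * Om1 t r0 + of_int k * Om t r0)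
            + 2 * \<i> * of_int k * flux t R) has_integral X0 + 2 * \<i> * of_int k * integral {s1..s2} (\<lambda>t. flux t R)) {s1..s2}"
          using R by (intro has_integral_add has_integral_mult_right X0 flux)
      qed (use balance R s in auto)
      ultimately have "of_real R powi (1 - k) * (2 * (B s2 R - B s1 R) + (2 * \<i> * av Om1 R - \<i> * (av P R + av Pb R)))
            + 2 * \<i> * of_int k * of_real R powi (- k) * av Om R
          = X0 + 2 * \<i> * of_int k * integral {s1..s2} (\<lambda>t. flux t R)"
        by (rule has_integral_unique)
      then show ?thesis unfolding g_def by (simp add: algebra_simps)
    qed
    have "((\<lambda>R. of_real R powi (1 - k) * (2 * (B s2 R - B s1 R))) \<longlongrightarrow> 0) at_top"
    proof -
      obtain L where L: "(B s1 \<longlongrightarrow> L) at_top" "(B s2 \<longlongrightarrow> L) at_top"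
        using far_field s by force
      have "((\<lambda>R. norm (2 * (B s2 R - B s1 R))) \<longlongrightarrow> 0) at_top"
        using tendsto_norm[OF tendsto_mult_left[OF tendsto_diff[OF L(2,1)], of 2]] by simp
      then show ?thesis
      proof (rule Lim_null_comparison[rotated])
        show "\<forall>\<^sub>F R in at_top. norm (of_real R powi (1 - k) * (2 * (B s2 R - B s1 R))) \<le> norm (2 * (B s2 R - B s1 R))"
          using eventually_ge_at_top[of 1]
        proof eventually_elim
          case (elim R)
          then have "R powi (1 - k) \<le> 1"
            using k by (simp add: power_int_def power_le_one inverse_le_1_iff)
          then show ?case
            using elim by (simp add: norm_mult norm_power_int mult_left_le_one_le)
        qed
      qed
    qed
    from tendsto_diff[OF tendsto_add[OF tendsto_const[of X0] tendsto_mult_left[OF integral_flux_tendsto, of s1 s2 "2 * \<i> * of_int k"]] this]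
    have "((\<lambda>R. X0 + 2 * \<i> * of_int k * integral {s1..s2} (\<lambda>t. flux t R)
        - of_real R powi (1 - k) * (2 * (B s2 R - B s1 R))) \<longlongrightarrow> c) at_top"
      using s c_eq by simp
    then show ?thesis
      by (rule Lim_transform_eventually)
        (use eventually_ge_at_top[of r0] in \<open>eventually_elim, simp add: g_eq\<close>)
  qed

  obtain K where K: "\<And>X t r. X \<in> {A, S, Sb} \<Longrightarrow> t \<in> {s1..s2} \<Longrightarrow> r0 \<le> r \<Longrightarrow> norm (X t r) \<le> K"
    using bounded[OF s(1,3)] by blast
  have av_bound: "norm (av X r) \<le> K * (s2 - s1)" if "X \<in> {A, S, Sb}" "r0 \<le> r" for X r
  proof -
    have "norm (av X r) \<le> K * measure lborel (cbox s1 s2)"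
    proof (rule has_integral_bound)
      have "norm (A s1 r0) \<le> K" by (rule K) (use s in auto)
      then show "0 \<le> K" by (meson norm_ge_zero order_trans)
      show "((\<lambda>t. X t r) has_integral av X r) (cbox s1 s2)"
        unfolding cbox_interval by (rule av) (use that in auto)
    qed (use K that in auto)
    then show ?thesis using s by simp
  qed
  have av_deriv: "(av X has_vector_derivative integral {s1..s2} (\<lambda>t. X' t r)) (at r)"
    if "r > r0" "X \<in> {Om, S, Sb, A}"
      "\<And>t r. 0 < t \<Longrightarrow> t < T \<Longrightarrow> r0 \<le> r \<Longrightarrow> (X t has_vector_derivative X' t r) (at r within {r0..})"
      "continuous_on ({0<..<T} \<times> {r0..}) (\<lambda>(t, r). X' t r)" for X X' r
    unfolding av_def[abs_def]
    by (rule time_average_derivative[OF that(2) s(1,3) that(3,4,1)])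
  have joint: "continuous_on ({0<..<T} \<times> {r0..}) (\<lambda>x. X (fst x) (snd x))" if "X \<in> ?all" for X
    using cont[OF that] by (simp add: case_prod_unfold)
  have Om_av: "(av Om has_vector_derivative av Om1 r) (at r)" if "r > r0" for r
    unfolding av_def[of Om1] using that
    by (intro av_deriv Om_deriv) (auto intro: cont)
  have A_av: "(av A has_vector_derivative \<i> * av Om r - of_int (k + 1) / of_real r * av A r) (at r)" if "r > r0" for r
  proof -
    have "(av A has_vector_derivative integral {s1..s2} (\<lambda>t. \<i> * Om t r - of_int (k + 1) / of_real r * A t r)) (at r)"
      using r0 that by (intro av_deriv A_deriv) (auto simp: case_prod_unfold intro!: continuous_intros joint[of A] joint[of Om] joint[of S] joint[of Sb] joint[of P] joint[of Pb])
    moreover have "((\<lambda>t. \<i> * Om t r - of_int (k + 1) / of_real r * A t r) has_integral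
        \<i> * av Om r - of_int (k + 1) / of_real r * av A r) {s1..s2}"
      using that by (intro has_integral_diff has_integral_mult_right av) auto
    ultimately show ?thesis by (simp only: integral_unique)
  qed
  have S_av: "(av S has_vector_derivative 2 * \<i> * av P r - of_int (k + 2) / of_real r * av S r) (at r)" if "r > r0" for r
  proof -
    have "(av S has_vector_derivative integral {s1..s2} (\<lambda>t. 2 * \<i> * P t r - of_int (k + 2) / of_real r * S t r)) (at r)"
      using r0 that by (intro av_deriv S_deriv) (auto simp: case_prod_unfold intro!: continuous_intros joint[of A] joint[of Om] joint[of S] joint[of Sb] joint[of P] joint[of Pb])
    moreover have "((\<lambda>t. 2 * \<i> * P t r - of_int (k + 2) / of_real r * S t r) has_integral
        2 * \<i> * av P r - of_int (k + 2) / of_real r * av S r) {s1..s2}"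
      using that by (intro has_integral_diff has_integral_mult_right av) auto
    ultimately show ?thesis by (simp only: integral_unique)
  qed
  have Sb_av: "(av Sb has_vector_derivative - 2 * \<i> * av Pb r + of_int (k - 2) / of_real r * av Sb r) (at r)" if "r > r0" for r
  proof -
    have "(av Sb has_vector_derivative integral {s1..s2} (\<lambda>t. - 2 * \<i> * Pb t r + of_int (k - 2) / of_real r * Sb t r)) (at r)"
      using r0 that by (intro av_deriv Sb_deriv) (auto simp: case_prod_unfold intro!: continuous_intros joint[of A] joint[of Om] joint[of S] joint[of Sb] joint[of P] joint[of Pb])
    moreover have "((\<lambda>t. - 2 * \<i> * Pb t r + of_int (k - 2) / of_real r * Sb t r) has_integral
        - 2 * \<i> * av Pb r + of_int (k - 2) / of_real r * av Sb r) {s1..s2}"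
      using that by (intro has_integral_add has_integral_mult_right av) auto
    ultimately show ?thesis by (simp only: integral_unique)
  qed

  \<comment> \<open>The quadratic terms \<open>- \<i> * (P + Pb)\<close> are \<open>U' - U2 / r\<close>, where \<open>U2\<close> is bounded as well: no
    derivative survives once \<open>U\<close> is added to a multiple of \<open>Om\<close>\<close>
  define U where "U r = (av Sb r - av S r) / 2" for r
  define U2 where "U2 r = (of_int (k - 2) * av Sb r + of_int (k + 2) * av S r) / 2" for r
  have U_bound: "norm (U r) \<le> K * (s2 - s1)" if "r0 \<le> r" for r
  proof -
    have "norm (av Sb r - av S r) \<le> K * (s2 - s1) + K * (s2 - s1)"
      using that by (intro order_trans[OF norm_triangle_ineq4] add_mono av_bound) auto
    then show ?thesis unfolding U_def by (simp add: norm_divide)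
  qed
  have U2_bound: "norm (U2 r) \<le> (\<bar>of_int (k - 2)\<bar> * (K * (s2 - s1)) + \<bar>of_int (k + 2)\<bar> * (K * (s2 - s1))) / 2"
    if "r0 \<le> r" for r
  proof -
    have "norm (of_int (k - 2) * av Sb r + of_int (k + 2) * av S r)
      \<le> \<bar>of_int (k - 2)\<bar> * (K * (s2 - s1)) + \<bar>of_int (k + 2)\<bar> * (K * (s2 - s1))"
      unfolding norm_of_int[where 'a=complex, symmetric]
      using that by (intro order_trans[OF norm_triangle_ineq] add_mono)
         (auto simp only: norm_mult intro!: mult_left_mono av_bound norm_ge_zero)
    then show ?thesis unfolding U2_def by (simp add: norm_divide)
  qed
  have U_tendsto: "((\<lambda>r. of_real r powi (- k) * U r) \<longlongrightarrow> 0) at_top"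
    and U2_tendsto: "((\<lambda>r. of_real r powi (- k) * U2 r) \<longlongrightarrow> 0) at_top"
    by (rule power_int_neg_tendsto_0_mult_bounded[OF k U_bound] power_int_neg_tendsto_0_mult_bounded[OF k U2_bound],
        assumption)+
  define F' where "F' r = of_real r powi (2 * k - 1) * (g r + of_real r powi (- k) * (U2 r + of_int k * U r))" for r
  have "((\<lambda>r. of_real r powi k * (2 * \<i> * av Om r + U r)) has_vector_derivative F' r) (at r)" if "r > r0" for r
  proof -
    have nz: "r \<noteq> 0" "r > 0" using that r0 by auto
    have "((\<lambda>r. 2 * \<i> * av Om r + (av Sb r - av S r) / 2) has_vector_derivative
        2 * \<i> * av Om1 r + ((- 2 * \<i> * av Pb r + of_int (k - 2) / of_real r * av Sb r)
          - (2 * \<i> * av P r - of_int (k + 2) / of_real r * av S r)) / 2) (at r)"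
      using that by (intro has_vector_derivative_add has_vector_derivative_mult_right has_vector_derivative_divide
          has_vector_derivative_diff Om_av S_av Sb_av)
    from has_vector_derivative_power_int_mult[OF this nz(1), of k]
    show ?thesis unfolding U_def[symmetric]
    proof (rule has_vector_derivative_eq_rhs)
      have p1: "of_real r powi (2 * k - 1) * (of_real r powi (1 - k) * x) = of_real r powi k * x"
        and p2: "of_real r powi (2 * k - 1) * (of_real r powi (- k) * x) = of_real r powi k * (x / of_real r)" for x :: complex
        using nz by (simp_all flip: mult.assoc power_int_add)
          (simp add: power_int_diff)
      show "of_real r powi k * (2 * \<i> * av Om1 r + ((- 2 * \<i> * av Pb r + of_int (k - 2) / of_real r * av Sb r)
          - (2 * \<i> * av P r - of_int (k + 2) / of_real r * av S r)) / 2
          + of_int k / of_real r * (2 * \<i> * av Om r + U r)) = F' r"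
      proof -
        have "F' r = of_real r powi (2 * k - 1) * (of_real r powi (1 - k) * (2 * \<i> * av Om1 r - \<i> * (av P r + av Pb r))
            + of_real r powi (- k) * (2 * \<i> * of_int k * av Om r + U2 r + of_int k * U r))"
          by (simp add: F'_def g_def algebra_simps)
        also have "\<dots> = of_real r powi k * (2 * \<i> * av Om1 r - \<i> * (av P r + av Pb r))
            + of_real r powi k * ((2 * \<i> * of_int k * av Om r + U2 r + of_int k * U r) / of_real r)"
          by (simp only: distrib_left[of "of_real r powi (2 * k - 1)"] p1 p2)
        finally have F'_eq: "F' r = of_real r powi k * (2 * \<i> * av Om1 r - \<i> * (av P r + av Pb r))
            + of_real r powi k * ((2 * \<i> * of_int k * av Om r + U2 r + of_int k * U r) / of_real r)" .
        show ?thesis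
          unfolding F'_eq using nz by (simp add: U2_def field_simps)
      qed
    qed
  qed
  then have "((\<lambda>r. (of_real r powi k * (2 * \<i> * av Om r + U r)) / of_real r powi (2 * k)) \<longlongrightarrow> c / of_int (2 * k)) at_top"
  proof (rule growth_from_derivative[rotated])
    have "((\<lambda>r. of_real r powi (- k) * (U2 r + of_int k * U r)) \<longlongrightarrow> 0) at_top"
      using tendsto_add[OF U2_tendsto tendsto_mult_right_zero[OF U_tendsto, of "of_int k"]]
      by (simp add: algebra_simps)
    then have "((\<lambda>r. g r + of_real r powi (- k) * (U2 r + of_int k * U r)) \<longlongrightarrow> c) at_top"
      using tendsto_add[OF g_tendsto] by force
    then show "((\<lambda>r. F' r / of_real r powi (2 * k - 1)) \<longlongrightarrow> c) at_top"
      by (rule Lim_transform_eventually)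
        (use eventually_gt_at_top[of 0] in \<open>eventually_elim, simp add: F'_def\<close>)
  qed (use k in auto)
  then have Om_growth: "((\<lambda>r. \<i> * (of_real r powi (- k) * av Om r)) \<longlongrightarrow> c / of_int (4 * k)) at_top"
  proof -
    assume "((\<lambda>r. (of_real r powi k * (2 * \<i> * av Om r + U r)) / of_real r powi (2 * k)) \<longlongrightarrow> c / of_int (2 * k)) at_top"
    then have "((\<lambda>r. 2 * \<i> * (of_real r powi (- k) * av Om r) + of_real r powi (- k) * U r) \<longlongrightarrow> c / of_int (2 * k)) at_top"
    proof (rule Lim_transform_eventually)
      show "\<forall>\<^sub>F r in at_top. (of_real r powi k * (2 * \<i> * av Om r + U r)) / of_real r powi (2 * k)
          = 2 * \<i> * (of_real r powi (- k) * av Om r) + of_real r powi (- k) * U r"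
        using eventually_gt_at_top[of 0]
      proof eventually_elim
        case (elim r)
        then have "of_real r powi (2 * k) = of_real r powi k * (of_real r powi k :: complex)"
          by (simp flip: power_int_add)
        then show ?case using elim by (simp add: power_int_minus field_simps)
      qed
    qed
    from tendsto_mult_left[OF tendsto_diff[OF this U_tendsto], of "1 / 2"]
    show ?thesis by simp
  qed
  \<comment> \<open>the second radial integration, from the vorticity to the velocity\<close>
  have "((\<lambda>r. of_real r powi (k + 1) * av A r / of_real r powi (2 * k + 2)) \<longlongrightarrow> c / of_int (4 * k) / of_int (2 * k + 2)) at_top"
  proof (rule growth_from_derivative[where a = r0])
    fix r assume r: "r > r0"
    show "((\<lambda>r. of_real r powi (k + 1) * av A r) has_vector_derivative of_real r powi (k + 1) * (\<i> * av Om r)) (at r)"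
      using has_vector_derivative_power_int_mult[OF A_av[OF r], of "k + 1"] r r0 by simp
  next
    show "((\<lambda>r. of_real r powi (k + 1) * (\<i> * av Om r) / of_real r powi (2 * k + 2 - 1)) \<longlongrightarrow> c / of_int (4 * k)) at_top"
      using Om_growth
    proof (rule Lim_transform_eventually)
      show "\<forall>\<^sub>F r in at_top. \<i> * (of_real r powi (- k) * av Om r) = of_real r powi (k + 1) * (\<i> * av Om r) / of_real r powi (2 * k + 2 - 1)"
        using eventually_gt_at_top[of 0]
      proof eventually_elim
        case (elim r)
        then have "of_real r powi (2 * k + 2 - 1) = of_real r powi (k + 1) * (of_real r powi k :: complex)"
          using power_int_add[of "complex_of_real r" "k + 1" k] by (simp add: add.commute)
        then show ?case using elim by (simp add: power_int_minus field_simps)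
      qed
    qed
  qed (use k in auto)
  moreover have "((\<lambda>r. of_real r powi (k + 1) * av A r / of_real r powi (2 * k + 2)) \<longlongrightarrow> 0) at_top"
  proof (rule Lim_transform_eventually)
    show "((\<lambda>r. of_real r powi (- (k + 1)) * av A r) \<longlongrightarrow> 0) at_top"
      by (rule power_int_neg_tendsto_0_mult_bounded[OF _ av_bound]) (use k in auto)
    show "\<forall>\<^sub>F r in at_top. of_real r powi (- (k + 1)) * av A r = of_real r powi (k + 1) * av A r / of_real r powi (2 * k + 2)"
      using eventually_gt_at_top[of 0]
    proof eventually_elim
      case (elim r)
      then have "of_real r powi (2 * k + 2) = of_real r powi (k + 1) * (of_real r powi (k + 1) :: complex)"
        by (simp flip: power_int_add)
      then show ?case using elim by (simp only: power_int_minus) (simp add: field_simps)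
    qed
  qed
  ultimately have "c / of_int (4 * k) / of_int (2 * k + 2) = 0"
    using tendsto_unique[OF trivial_limit_at_top_linorder] by blast
  moreover have "(of_int (4 * k) :: complex) \<noteq> 0" "(of_int (2 * k + 2) :: complex) \<noteq> 0"
    using k by (simp_all only: of_int_eq_0_iff)
  ultimately show ?thesis by (simp only: c_def divide_eq_0_iff) blast
qed

lemma flux_limit_value:
  assumes "0 < t" "t < T"
  shows "(flux t \<longlongrightarrow> - (of_real r0 powi (- k) * (of_real r0 * Om1 t r0 + of_int k * Om t r0)) / of_int k) at_top"
proof -
  have "defect t = 0"
    by (rule continuous_zero_if_integrals_zero[where T = T]) (use assms defect_continuous integral_defect in auto)
  then have "2 * \<i> * (of_real r0 powi (- k) * (of_real r0 * Om1 t r0 + of_int k * Om t r0) + of_int k * flux_limit t) = 0"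
    unfolding defect_def by (simp add: algebra_simps)
  then have "of_real r0 powi (- k) * (of_real r0 * Om1 t r0 + of_int k * Om t r0) + of_int k * flux_limit t = 0"
    by simp
  then have "flux_limit t = - (of_real r0 powi (- k) * (of_real r0 * Om1 t r0 + of_int k * Om t r0)) / of_int k"
    using k by (simp add: field_simps eq_neg_iff_add_eq_0)
  then show ?thesis using flux_tendsto[OF assms] by simp
qed

end

section \<open>Derivatives up to the boundary circle\<close>

lemma ext_dom_annular: "ext_dom r0 = annular {r0<..}" "ext_dom_cl r0 = annular {r0..}"
  by (auto simp: ext_dom_def ext_dom_cl_def annular_def)

lemma annular_Ioi_subset: "annular {r0<..} \<subseteq> annular {r0..}"
  by (auto simp: annular_def)

lemma open_annular_Ioi: "open (annular {r0<..})"
  unfolding annular_def using open_Collect_less[of "\<lambda>_::complex. r0" cmod] by (simp add: continuous_intros)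

lemma continuous_zero_at_left_end:
  fixes g :: "real \<Rightarrow> complex"
  assumes "continuous_on {r0..} g" "\<And>r. r > r0 \<Longrightarrow> g r = 0"
  shows "g r0 = 0"
proof -
  have "(g \<longlongrightarrow> g r0) (at_right r0)"
    using assms(1) by (metis atLeast_iff continuous_on at_within_Ici_at_right order_refl)
  moreover have "(g \<longlongrightarrow> 0) (at_right r0)"
    by (rule tendsto_eventually) (use assms(2) in \<open>auto simp: eventually_at_filter\<close>)
  ultimately show ?thesis
    using tendsto_unique trivial_limit_at_right_real by blast
qed

text \<open>
  The real directional derivatives up to the boundary, in complex form. Only linearity of the
  Frechet derivative is involved, so the boundary circle is no exception.
\<close>
lemma pd_wirtinger_on:
  fixes f :: "complex \<Rightarrow> complex"
  assumes "f differentiable_on ext_dom_cl r0"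
    and "continuous_on (ext_dom_cl r0) (pd r0 1 f)" "continuous_on (ext_dom_cl r0) (pd r0 \<i> f)"
  shows "wirtinger_on (annular {r0..}) f (\<lambda>z. pd r0 1 f z - \<i> * pd r0 \<i> f z) (\<lambda>z. pd r0 1 f z + \<i> * pd r0 \<i> f z)"
  unfolding wirtinger_on_def ext_dom_annular(2)[symmetric]
proof (intro conjI ballI)
  fix z assume z: "z \<in> ext_dom_cl r0"
  let ?D = "frechet_derivative f (at z within ext_dom_cl r0)"
  have D: "(f has_derivative ?D) (at z within ext_dom_cl r0)"
    using assms(1) z by (simp add: differentiable_on_def frechet_derivative_works[symmetric])
  have "?D h = (h * (pd r0 1 f z - \<i> * pd r0 \<i> f z) + cnj h * (pd r0 1 f z + \<i> * pd r0 \<i> f z)) / 2" for h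
  proof -
    have lin: "linear ?D" using D by (rule has_derivative_linear)
    have "?D (Re h *\<^sub>R 1 + Im h *\<^sub>R \<i>) = Re h *\<^sub>R pd r0 1 f z + Im h *\<^sub>R pd r0 \<i> f z"
      by (simp only: linear_add[OF lin] linear_scale[OF lin] pd_def)
    moreover have "Re h *\<^sub>R 1 + Im h *\<^sub>R \<i> = h"
      by (simp add: complex_eq_iff)
    moreover have "Re h *\<^sub>R x + Im h *\<^sub>R y = (h * (x - \<i> * y) + cnj h * (x + \<i> * y)) / 2" for x y
      by (simp add: complex_eq_iff field_simps)
    ultimately show ?thesis by simp
  qed
  then show "(f has_derivative (\<lambda>h. (h * (pd r0 1 f z - \<i> * pd r0 \<i> f z) + cnj h * (pd r0 1 f z + \<i> * pd r0 \<i> f z)) / 2))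
      (at z within ext_dom_cl r0)"
    using D by (simp add: has_derivative_eq_rhs fun_eq_iff)
qed (use assms in \<open>auto intro!: continuous_intros\<close>)

lemma pd_wirtinger_on_of_real:
  fixes f :: "complex \<Rightarrow> real"
  assumes "f differentiable_on ext_dom r0" and "continuous_on (ext_dom r0) (gradient r0 f)"
  shows "wirtinger_on (annular {r0<..}) (\<lambda>z. of_real (f z)) (\<lambda>z. cnj (gradient r0 f z)) (gradient r0 f)"
  unfolding wirtinger_on_def
proof (intro conjI ballI)
  fix z assume z: "z \<in> annular {r0<..}"
  let ?D = "frechet_derivative f (at z within ext_dom_cl r0)"
  have int: "at z within ext_dom_cl r0 = at z"
    using z annular_Ioi_subset open_annular_Ioi unfolding ext_dom_annular
    by (intro at_within_interior) (meson interiorI)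
  have "f differentiable (at z)"
    using assms(1) z open_annular_Ioi by (simp add: ext_dom_annular differentiable_on_eq_differentiable_at)
  then have D: "(f has_derivative ?D) (at z)"
    by (simp add: int frechet_derivative_works[symmetric])
  have "of_real (?D h) = (h * cnj (gradient r0 f z) + cnj h * gradient r0 f z) / 2" for h
  proof -
    have lin: "linear ?D" using D by (rule has_derivative_linear)
    have "Re h *\<^sub>R 1 + Im h *\<^sub>R \<i> = h"
      by (simp add: complex_eq_iff)
    then have "?D h = ?D (Re h *\<^sub>R 1 + Im h *\<^sub>R \<i>)"
      by (simp only:)
    also have "\<dots> = Re h * pd r0 1 f z + Im h * pd r0 \<i> f z"
      by (simp only: linear_add[OF lin] linear_scale[OF lin] pd_def real_scaleR_def)
    finally show ?thesis
      by (simp add: complex_eq_iff gradient_def field_simps)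
  qed
  moreover have "((\<lambda>z. complex_of_real (f z)) has_derivative (\<lambda>h. of_real (?D h))) (at z within annular {r0<..})"
    using has_derivative_at_withinI[OF D] by (rule has_derivative_of_real)
  ultimately show "((\<lambda>z. of_real (f z)) has_derivative (\<lambda>h. (h * cnj (gradient r0 f z) + cnj h * gradient r0 f z) / 2))
      (at z within annular {r0<..})"
    by (simp only:)
qed (use assms in \<open>auto simp: ext_dom_annular intro!: continuous_intros\<close>)

section \<open>The Navier-Stokes flow in complex form\<close>

locale exterior_flow =
  fixes r0 T :: real and vinf :: complex and v0 :: "complex \<Rightarrow> complex"
    and v :: "real \<Rightarrow> complex \<Rightarrow> complex" and p :: "real \<Rightarrow> complex \<Rightarrow> real"
  assumes r0: "r0 > 0" and solution: "NS_solution r0 T vinf v0 v p"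
begin

text \<open>
  The closed and the open exterior domain.
\<close>
abbreviation "Dcl \<equiv> annular {r0..}"
abbreviation "Dom \<equiv> annular {r0<..}"

definition w :: "real \<Rightarrow> complex \<Rightarrow> complex" where "w t z = of_real (curl r0 (v t) z)"
definition dt_v :: "real \<Rightarrow> complex \<Rightarrow> complex" where "dt_v t z = vector_derivative (\<lambda>s. v s z) (at t)"
definition dzbar_v :: "real \<Rightarrow> complex \<Rightarrow> complex" where
  "dzbar_v t z = pd r0 1 (v t) z + \<i> * pd r0 \<i> (v t) z"

text \<open>
  Four times the second Wirtinger derivatives of \<open>v\<close>; the last operator in the name is applied first.
  The Laplacian is \<open>(dzbar_dz_v + dz_dzbar_v) / 2\<close> by definition, before any symmetry of second
  derivatives is known.
\<close>
definition "dz_dz_v t z = (pd r0 1 (pd r0 1 (v t)) z - \<i> * pd r0 \<i> (pd r0 1 (v t)) z) - \<i> * (pd r0 1 (pd r0 \<i> (v t)) z - \<i> * pd r0 \<i> (pd r0 \<i> (v t)) z)"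
definition "dzbar_dz_v t z = (pd r0 1 (pd r0 1 (v t)) z + \<i> * pd r0 \<i> (pd r0 1 (v t)) z) - \<i> * (pd r0 1 (pd r0 \<i> (v t)) z + \<i> * pd r0 \<i> (pd r0 \<i> (v t)) z)"
definition "dz_dzbar_v t z = (pd r0 1 (pd r0 1 (v t)) z - \<i> * pd r0 \<i> (pd r0 1 (v t)) z) + \<i> * (pd r0 1 (pd r0 \<i> (v t)) z - \<i> * pd r0 \<i> (pd r0 \<i> (v t)) z)"
definition "dzbar_dzbar_v t z = (pd r0 1 (pd r0 1 (v t)) z + \<i> * pd r0 \<i> (pd r0 1 (v t)) z) + \<i> * (pd r0 1 (pd r0 \<i> (v t)) z + \<i> * pd r0 \<i> (pd r0 \<i> (v t)) z)"

text \<open>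
  The total head \<open>p - \<bar>v\<bar>\<^sup>2 / 2\<close>, where the sign of \<open>p\<close> is the one of the equation of motion,
  and its gradient as the equation of motion gives it.
\<close>
definition "head_gradient t z = dt_v t z - (dzbar_dz_v t z + dz_dzbar_v t z) / 2 + \<i> * w t z * v t z"
definition "head t z = of_real (p t z) - (v t z * cnj (v t z)) / 2"

lemma radii_pos: "{r0..} \<subseteq> {0<..}" "{r0<..} \<subseteq> {0<..}"
  using r0 by auto

lemma regular: "velocity_regular r0 T v"
  using solution by (simp add: NS_solution_def)

lemma joint_continuity:
  "continuous_on ({0<..<T} \<times> Dcl) (\<lambda>(t, z). v t z)"
  "continuous_on ({0<..<T} \<times> Dcl) (\<lambda>(t, z). dt_v t z)"
  "e \<in> {1, \<i>} \<Longrightarrow> continuous_on ({0<..<T} \<times> Dcl) (\<lambda>(t, z). pd r0 e (v t) z)"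
  "e \<in> {1, \<i>} \<Longrightarrow> e' \<in> {1, \<i>} \<Longrightarrow> continuous_on ({0<..<T} \<times> Dcl) (\<lambda>(t, z). pd r0 e (pd r0 e' (v t)) z)"
  using regular unfolding velocity_regular_def Let_def ext_dom_annular dt_v_def by blast+

lemma slice_continuous:
  assumes "continuous_on ({0<..<T} \<times> D) (\<lambda>(t, z). f t z)" "0 < t" "t < T"
  shows "continuous_on D (f t)"
proof -
  have "continuous_on D (\<lambda>z. case (t, z) of (t, z) \<Rightarrow> f t z)"
    by (rule continuous_on_compose2[OF assms(1)]) (use assms in \<open>auto intro!: continuous_intros\<close>)
  then show ?thesis by simp
qed

lemma joint_continuous_cmp:
  assumes "continuous_on D (\<lambda>(t, z). f t z)"
  shows "continuous_on D (\<lambda>x. f (fst x) (snd x))"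
  using assms by (simp add: case_prod_unfold)

lemmas joint_cmp = joint_continuous_cmp[OF joint_continuity(1)] joint_continuous_cmp[OF joint_continuity(2)]
  joint_continuous_cmp[OF joint_continuity(3)] joint_continuous_cmp[OF joint_continuity(4)]

lemma joint_continuity_derived:
  "continuous_on ({0<..<T} \<times> Dcl) (\<lambda>(t, z). w t z)"
  "continuous_on ({0<..<T} \<times> Dcl) (\<lambda>(t, z). dz_dz_v t z)"
  "continuous_on ({0<..<T} \<times> Dcl) (\<lambda>(t, z). dzbar_dz_v t z)"
  "continuous_on ({0<..<T} \<times> Dcl) (\<lambda>(t, z). dz_dzbar_v t z)"
  unfolding w_def curl_def dz_dz_v_def dzbar_dz_v_def dz_dzbar_v_def case_prod_unfold
  by (intro continuous_intros joint_cmp; simp)+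

lemma wirtinger_pd:
  assumes "0 < t" "t < T" "e \<in> {1, \<i>}"
  shows "wirtinger_on Dcl (v t) (\<lambda>z. pd r0 1 (v t) z - \<i> * pd r0 \<i> (v t) z) (dzbar_v t)"
    and "wirtinger_on Dcl (pd r0 e (v t)) (\<lambda>z. pd r0 1 (pd r0 e (v t)) z - \<i> * pd r0 \<i> (pd r0 e (v t)) z)
      (\<lambda>z. pd r0 1 (pd r0 e (v t)) z + \<i> * pd r0 \<i> (pd r0 e (v t)) z)"
proof -
  have "v t differentiable_on ext_dom_cl r0" "pd r0 e (v t) differentiable_on ext_dom_cl r0"
    using regular assms by (auto simp: velocity_regular_def Let_def)
  moreover have "continuous_on Dcl (pd r0 e' (v t))" "continuous_on Dcl (pd r0 e' (pd r0 e (v t)))" if "e' \<in> {1, \<i>}" for e'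
    using slice_continuous[OF joint_continuity(3)[OF that] assms(1,2)]
      slice_continuous[OF joint_continuity(4)[OF that assms(3)] assms(1,2)] .
  ultimately show "wirtinger_on Dcl (v t) (\<lambda>z. pd r0 1 (v t) z - \<i> * pd r0 \<i> (v t) z) (dzbar_v t)"
    and "wirtinger_on Dcl (pd r0 e (v t)) (\<lambda>z. pd r0 1 (pd r0 e (v t)) z - \<i> * pd r0 \<i> (pd r0 e (v t)) z)
      (\<lambda>z. pd r0 1 (pd r0 e (v t)) z + \<i> * pd r0 \<i> (pd r0 e (v t)) z)"
    unfolding dzbar_v_def[abs_def] by (auto intro!: pd_wirtinger_on simp: ext_dom_annular)
qed

text \<open>
  Continuity carries the equation to the boundary circle, where the derivatives are needed as well.
\<close>
lemma divergence_free:
  assumes t: "0 < t" "t < T" and z: "z \<in> Dcl"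
  shows "divergence r0 (v t) z = 0"
proof (cases "z \<in> Dom")
  case True
  then show ?thesis
    using solution t by (auto simp: NS_solution_def ext_dom_annular)
next
  case False
  obtain \<phi> where z_eq: "z = of_real r0 * cis \<phi>"
    using False z by (metis annular_def mem_Collect_eq atLeast_iff greaterThan_iff linorder_not_less order_antisym rcis_cmod_Arg rcis_def)
  have "complex_of_real (divergence r0 (v t) (of_real r0 * cis \<phi>)) = 0"
  proof (rule continuous_zero_at_left_end[where g = "\<lambda>r. complex_of_real (divergence r0 (v t) (of_real r * cis \<phi>))"])
    have "continuous_on Dcl (pd r0 e (v t))" if "e \<in> {1, \<i>}" for e
      using slice_continuous[OF joint_continuity(3)[OF that] t] .
    then show "continuous_on {r0..} (\<lambda>r. complex_of_real (divergence r0 (v t) (of_real r * cis \<phi>)))"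
      unfolding divergence_def using radii_pos
      by (intro continuous_intros continuous_on_circle_compose[where U = "{r0..}" and h = "\<lambda>_. \<phi>" and g = "\<lambda>r. r"]) auto
    show "complex_of_real (divergence r0 (v t) (of_real r * cis \<phi>)) = 0" if "r > r0" for r
      using solution t that r0 by (simp add: NS_solution_def ext_dom_def norm_mult)
  qed
  then show ?thesis by (simp add: z_eq)
qed

lemma wirtinger_v:
  assumes t: "0 < t" "t < T"
  shows "wirtinger_on Dcl (v t) (\<lambda>z. \<i> * w t z) (dzbar_v t)"
proof (rule wirtinger_on_cong[OF wirtinger_pd(1)[OF t, of 1]])
  fix z assume "z \<in> Dcl"
  from divergence_free[OF t this]
  show "pd r0 1 (v t) z - \<i> * pd r0 \<i> (v t) z = \<i> * w t z"
    by (simp add: w_def curl_def divergence_def complex_eq_iff)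
qed auto

text \<open>
  The first two parts are derivatives of \<open>2\<partial>v\<close> and \<open>2\<partial>'v\<close>; the last one differentiates the vorticity,
  as \<open>w = - \<i> * 2\<partial>v\<close> on the closed domain.
\<close>
lemma wirtinger_second:
  assumes t: "0 < t" "t < T"
  shows "wirtinger_on Dcl (\<lambda>z. \<i> * w t z) (dz_dz_v t) (dzbar_dz_v t)"
    and "wirtinger_on Dcl (dzbar_v t) (dz_dzbar_v t) (dzbar_dzbar_v t)"
    and "wirtinger_on Dcl (w t) (\<lambda>z. - \<i> * dz_dz_v t z) (\<lambda>z. - \<i> * dzbar_dz_v t z)"
proof -
  have 1: "wirtinger_on Dcl (pd r0 1 (v t)) (\<lambda>z. pd r0 1 (pd r0 1 (v t)) z - \<i> * pd r0 \<i> (pd r0 1 (v t)) z)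
      (\<lambda>z. pd r0 1 (pd r0 1 (v t)) z + \<i> * pd r0 \<i> (pd r0 1 (v t)) z)"
    by (rule wirtinger_pd(2)[OF t]) simp
  have 2: "wirtinger_on Dcl (pd r0 \<i> (v t)) (\<lambda>z. pd r0 1 (pd r0 \<i> (v t)) z - \<i> * pd r0 \<i> (pd r0 \<i> (v t)) z)
      (\<lambda>z. pd r0 1 (pd r0 \<i> (v t)) z + \<i> * pd r0 \<i> (pd r0 \<i> (v t)) z)"
    by (rule wirtinger_pd(2)[OF t]) simp
  have "wirtinger_on Dcl (\<lambda>z. pd r0 1 (v t) z - \<i> * pd r0 \<i> (v t) z) (dz_dz_v t) (dzbar_dz_v t)"
    unfolding dz_dz_v_def[abs_def] dzbar_dz_v_def[abs_def] by (rule wirtinger_on_diff[OF 1 wirtinger_on_cmult[OF 2]])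
  then show iw: "wirtinger_on Dcl (\<lambda>z. \<i> * w t z) (dz_dz_v t) (dzbar_dz_v t)"
  proof (rule wirtinger_on_cong)
    fix z assume "z \<in> Dcl"
    from divergence_free[OF t this]
    show "pd r0 1 (v t) z - \<i> * pd r0 \<i> (v t) z = \<i> * w t z"
      by (simp add: w_def curl_def divergence_def complex_eq_iff)
  qed auto
  show "wirtinger_on Dcl (dzbar_v t) (dz_dzbar_v t) (dzbar_dzbar_v t)"
    by (rule wirtinger_on_cong[OF wirtinger_on_diff[OF 1 wirtinger_on_cmult[OF 2, of "- \<i>"]]])
      (simp_all add: dzbar_v_def dz_dzbar_v_def dzbar_dzbar_v_def)
  show "wirtinger_on Dcl (w t) (\<lambda>z. - \<i> * dz_dz_v t z) (\<lambda>z. - \<i> * dzbar_dz_v t z)"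
    by (rule wirtinger_on_cong[OF wirtinger_on_cmult[OF iw, of "- \<i>"]]) auto
qed

lemma wirtinger_cnj_v:
  assumes t: "0 < t" "t < T"
  shows "wirtinger_on Dcl (\<lambda>z. cnj (v t z)) (\<lambda>z. cnj (dzbar_v t z)) (\<lambda>z. - \<i> * w t z)"
  by (rule wirtinger_on_cong[OF wirtinger_on_cnj[OF wirtinger_v[OF t]]]) (auto simp: w_def)

lemma wirtinger_square:
  assumes t: "0 < t" "t < T"
  shows "wirtinger_on Dcl (\<lambda>z. v t z * v t z) (\<lambda>z. 2 * \<i> * (w t z * v t z)) (\<lambda>z. 2 * dzbar_v t z * v t z)"
    and "wirtinger_on Dcl (\<lambda>z. cnj (v t z) * cnj (v t z)) (\<lambda>z. 2 * cnj (dzbar_v t z) * cnj (v t z)) (\<lambda>z. - 2 * \<i> * (w t z * cnj (v t z)))"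
  by (rule wirtinger_on_cong[OF wirtinger_on_mult[OF wirtinger_v[OF t] wirtinger_v[OF t]]]; simp add: algebra_simps)
    (rule wirtinger_on_cong[OF wirtinger_on_mult[OF wirtinger_cnj_v[OF t] wirtinger_cnj_v[OF t]]]; simp add: algebra_simps)

text \<open>
  The convection term is \<open>(v * 2\<partial>v + cnj v * 2\<partial>'v) / 2\<close>, and \<open>2\<partial>v = \<i> * w\<close>.
\<close>
lemma gradient_pressure:
  assumes t: "0 < t" "t < T" and z: "z \<in> Dom"
  shows "gradient r0 (p t) z = dt_v t z - (dzbar_dz_v t z + dz_dzbar_v t z) / 2 + (\<i> * w t z * v t z + dzbar_v t z * cnj (v t z)) / 2"
proof -
  have lap: "laplacian r0 (v t) z = (dzbar_dz_v t z + dz_dzbar_v t z) / 2"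
    by (simp add: laplacian_def dzbar_dz_v_def dz_dzbar_v_def field_simps)
  have conv: "convection r0 (v t) z = (\<i> * w t z * v t z + dzbar_v t z * cnj (v t z)) / 2"
  proof -
    have "pd r0 1 (v t) z - \<i> * pd r0 \<i> (v t) z = \<i> * w t z"
      using divergence_free[OF t, of z] z annular_Ioi_subset[of r0]
      by (auto simp add: w_def curl_def divergence_def complex_eq_iff)
    moreover have "Re a *\<^sub>R x + Im a *\<^sub>R y = ((x - \<i> * y) * a + (x + \<i> * y) * cnj a) / 2" for a x y
      by (simp add: complex_eq_iff field_simps)
    ultimately show ?thesis
      unfolding convection_def dzbar_v_def by simp
  qed
  have eq: "dt_v t z - laplacian r0 (v t) z + convection r0 (v t) z = gradient r0 (p t) z"
    using solution t z unfolding NS_solution_def ext_dom_annular dt_v_def by auto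
  show ?thesis unfolding eq[symmetric] lap conv ..
qed

lemma continuous_fields:
  assumes t: "0 < t" "t < T"
  shows "continuous_on Dcl (v t)" "continuous_on Dcl (dt_v t)" "continuous_on Dcl (w t)" "continuous_on Dcl (dz_dz_v t)"
    "continuous_on Dcl (dzbar_dz_v t)" "continuous_on Dcl (dz_dzbar_v t)" "continuous_on Dcl (dzbar_v t)"
  using slice_continuous[OF joint_continuity(1) t] slice_continuous[OF joint_continuity(2) t]
    slice_continuous[OF joint_continuity_derived(1) t] slice_continuous[OF joint_continuity_derived(2) t]
    slice_continuous[OF joint_continuity_derived(3) t] slice_continuous[OF joint_continuity_derived(4) t]
    wirtinger_v[OF t]
  by (auto simp: wirtinger_on_def)

text \<open>
  The convection term is \<open>\<partial>'(\<bar>v\<bar>\<^sup>2) + \<i>wv\<close>, and its first summand joins the pressure. As the head is real, its other derivative is the conjugate.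
\<close>
lemma wirtinger_head:
  assumes t: "0 < t" "t < T"
  shows "wirtinger_on Dom (head t) (\<lambda>z. cnj (head_gradient t z)) (head_gradient t)"
proof -
  have c: "continuous_on Dom f" if "continuous_on Dcl f" for f :: "complex \<Rightarrow> complex"
    using that annular_Ioi_subset continuous_on_subset by blast
  have "continuous_on Dom (\<lambda>z. dt_v t z - (dzbar_dz_v t z + dz_dzbar_v t z) / 2 + (\<i> * w t z * v t z + dzbar_v t z * cnj (v t z)) / 2)"
    by (intro continuous_intros c continuous_fields[OF t]) auto
  then have "continuous_on Dom (gradient r0 (p t))"
    using gradient_pressure[OF t] by (simp cong: continuous_on_cong)
  then have p: "wirtinger_on Dom (\<lambda>z. of_real (p t z)) (\<lambda>z. cnj (gradient r0 (p t) z)) (gradient r0 (p t))"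
    using solution t by (intro pd_wirtinger_on_of_real) (auto simp: NS_solution_def ext_dom_annular)
  have vv: "wirtinger_on Dom (\<lambda>z. 1 / 2 * (v t z * cnj (v t z)))
      (\<lambda>z. 1 / 2 * (\<i> * w t z * cnj (v t z) + v t z * cnj (dzbar_v t z)))
      (\<lambda>z. 1 / 2 * (dzbar_v t z * cnj (v t z) + v t z * (- \<i> * w t z)))"
    by (intro wirtinger_on_cmult wirtinger_on_subset[OF wirtinger_on_mult[OF wirtinger_v[OF t] wirtinger_cnj_v[OF t]] annular_Ioi_subset])
  have [simp]: "cnj (w t z) = w t z" for z by (simp add: w_def)
  show ?thesis
    by (rule wirtinger_on_cong[OF wirtinger_on_diff[OF p vv]])
      (simp_all add: head_def head_gradient_def gradient_pressure[OF t] field_simps)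
qed

lemma noslip:
  assumes t: "0 < t" "t < T" and z: "cmod z = r0"
  shows "v t z = 0" "dt_v t z = 0"
proof -
  show v: "v t z = 0"
    using solution t z by (simp add: NS_solution_def)
  have "((\<lambda>s. v s z) has_vector_derivative 0) (at t)"
    by (rule has_vector_derivative_transform_within_open[OF has_vector_derivative_const[of 0], of "{0<..<T}"])
      (use solution t z in \<open>auto simp: NS_solution_def\<close>)
  then show "dt_v t z = 0"
    unfolding dt_v_def by (rule vector_derivative_at)
qed

text \<open>
  The functions required by \<open>angular_mode_flow\<close>, in the order \<open>Om\<close>, \<open>Om1\<close>, \<open>A\<close>, \<open>B\<close>, \<open>P\<close>, \<open>Pb\<close>, \<open>S\<close>,
  \<open>Sb\<close>, \<open>At\<close>, \<open>Bt\<close>.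
\<close>
definition "vort_mode k t = mode k (w t)"
definition "vort_mode_dr k t r = (mode (k - 1) (\<lambda>z. - \<i> * dz_dz_v t z) r + mode (k + 1) (\<lambda>z. - \<i> * dzbar_dz_v t z) r) / 2"
definition "mA k t = mode (k + 1) (v t)"
definition "mB k t = mode (k - 1) (\<lambda>z. cnj (v t z))"
definition "mP k t = mode (k + 1) (\<lambda>z. w t z * v t z)"
definition "mPb k t = mode (k - 1) (\<lambda>z. w t z * cnj (v t z))"
definition "mS k t = mode (k + 2) (\<lambda>z. v t z * v t z)"
definition "mSb k t = mode (k - 2) (\<lambda>z. cnj (v t z) * cnj (v t z))"
definition "mAt k t = mode (k + 1) (dt_v t)"
definition "mBt k t = mode (k - 1) (\<lambda>z. cnj (dt_v t z))"

lemmas mode_defs = vort_mode_def vort_mode_dr_def mA_def mB_def mP_def mPb_def mS_def mSb_def mAt_def mBt_def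

lemma cnj_w: "cnj (w t z) = w t z"
  by (simp add: w_def)

lemma vorticity_mode_derivative:
  assumes t: "0 < t" "t < T" and r: "r0 \<le> r"
  shows "(vort_mode k t has_vector_derivative vort_mode_dr k t r) (at r within {r0..})"
    and "mode (k + 1) (dzbar_dz_v t) r = \<i> * (vort_mode_dr k t r - of_int k / of_real r * vort_mode k t r)"
    and "mode (k - 1) (dz_dz_v t) r = \<i> * (vort_mode_dr k t r + of_int k / of_real r * vort_mode k t r)"
proof -
  note w = wirtinger_second(3)[OF t]
  show "(vort_mode k t has_vector_derivative vort_mode_dr k t r) (at r within {r0..})"
    unfolding vort_mode_def vort_mode_dr_def using r by (intro mode_radial_derivative[OF w] radii_pos) auto
  have "mode (k - 1) (\<lambda>z. - \<i> * dz_dz_v t z) r - mode (k + 1) (\<lambda>z. - \<i> * dzbar_dz_v t z) r = 2 * of_int k / of_real r * vort_mode k t r"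
    unfolding vort_mode_def using r by (intro mode_angular_derivative[OF w] radii_pos) auto
  then have "mode (k + 1) (\<lambda>z. - \<i> * dzbar_dz_v t z) r = vort_mode_dr k t r - of_int k / of_real r * vort_mode k t r"
    "mode (k - 1) (\<lambda>z. - \<i> * dz_dz_v t z) r = vort_mode_dr k t r + of_int k / of_real r * vort_mode k t r"
    by (simp_all add: vort_mode_dr_def field_simps)
  then show "mode (k + 1) (dzbar_dz_v t) r = \<i> * (vort_mode_dr k t r - of_int k / of_real r * vort_mode k t r)"
    "mode (k - 1) (dz_dz_v t) r = \<i> * (vort_mode_dr k t r + of_int k / of_real r * vort_mode k t r)"
    unfolding mode_cmult by (metis complex_i_mult_minus mult_minus_left minus_minus)+
qed

lemma velocity_mode_derivatives:
  assumes t: "0 < t" "t < T" and r: "r0 \<le> r"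
  shows "(mA k t has_vector_derivative \<i> * vort_mode k t r - of_int (k + 1) / of_real r * mA k t r) (at r within {r0..})"
    and "(mB k t has_vector_derivative - \<i> * vort_mode k t r + of_int (k - 1) / of_real r * mB k t r) (at r within {r0..})"
    and "(mS k t has_vector_derivative 2 * \<i> * mP k t r - of_int (k + 2) / of_real r * mS k t r) (at r within {r0..})"
    and "(mSb k t has_vector_derivative - 2 * \<i> * mPb k t r + of_int (k - 2) / of_real r * mSb k t r) (at r within {r0..})"
proof -
  have r': "r \<in> {r0..}" "convex {r0..}" using r by auto
  note dz = mode_derivative_dz[OF _ radii_pos(1) r'(2,1)] and dzbar = mode_derivative_dzbar[OF _ radii_pos(1) r'(2,1)]
  show "(mA k t has_vector_derivative \<i> * vort_mode k t r - of_int (k + 1) / of_real r * mA k t r) (at r within {r0..})"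
    using dz[OF wirtinger_v[OF t], of "k + 1"] by (simp add: mA_def vort_mode_def mode_cmult)
  show "(mB k t has_vector_derivative - \<i> * vort_mode k t r + of_int (k - 1) / of_real r * mB k t r) (at r within {r0..})"
    using dzbar[OF wirtinger_cnj_v[OF t], of "k - 1"] unfolding mode_cmult by (simp add: mB_def vort_mode_def)
  show "(mS k t has_vector_derivative 2 * \<i> * mP k t r - of_int (k + 2) / of_real r * mS k t r) (at r within {r0..})"
    using dz[OF wirtinger_square(1)[OF t], of "k + 2"] unfolding mode_cmult by (simp add: mS_def mP_def add.commute)
  show "(mSb k t has_vector_derivative - 2 * \<i> * mPb k t r + of_int (k - 2) / of_real r * mSb k t r) (at r within {r0..})"
    using dzbar[OF wirtinger_square(2)[OF t], of "k - 2"] unfolding mode_cmult by (simp add: mSb_def mPb_def)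
qed

text \<open>
  The Laplacian contributes only the mode of \<open>2\<partial>'(\<i> * w)\<close>, by the agreement of the modes of the
  mixed second derivatives; it is expressed through the mode of \<open>w\<close> and its radial derivative.
\<close>
lemma momentum_modes:
  assumes t: "0 < t" "t < T" and r: "r0 < r"
  shows "mode (k + 1) (head_gradient t) r = mAt k t r - \<i> * (vort_mode_dr k t r - of_int k / of_real r * vort_mode k t r) + \<i> * mP k t r"
    and "mode (k - 1) (\<lambda>z. cnj (head_gradient t z)) r = mBt k t r + \<i> * (vort_mode_dr k t r + of_int k / of_real r * vort_mode k t r) - \<i> * mPb k t r"
proof -
  have U: "r \<in> {r0<..}" "open {r0<..}" "convex {r0<..}" using r by auto
  have R: "r \<in> {r0..}" using r by auto
  note sub = wirtinger_on_subset[OF _ annular_Ioi_subset]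
  note cc = continuous_fields[OF t]
  have agree: "mode j (dz_dzbar_v t) r = mode j (dzbar_dz_v t) r" for j
    by (rule second_order_modes_agree[OF radii_pos(2) U(3,2,1) sub[OF wirtinger_v[OF t]]
        sub[OF wirtinger_second(1)[OF t]] sub[OF wirtinger_second(2)[OF t]]])
  have head_gradient_mode: "mode j (head_gradient t) r = mode j (dt_v t) r - mode j (dzbar_dz_v t) r + \<i> * mode j (\<lambda>z. w t z * v t z) r" for j
  proof -
    have "mode j (head_gradient t) r = mode j (\<lambda>z. (dt_v t z - (1 / 2) * (dzbar_dz_v t z + dz_dzbar_v t z)) + \<i> * (w t z * v t z)) r"
      by (simp add: head_gradient_def[abs_def] mult.assoc)
    also have "\<dots> = mode j (dt_v t) r - (1 / 2) * (mode j (dzbar_dz_v t) r + mode j (dz_dzbar_v t) r) + \<i> * mode j (\<lambda>z. w t z * v t z) r"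
      by (subst mode_add[OF _ _ radii_pos(1) R], (intro continuous_intros cc; fail)+,
          subst mode_diff[OF _ _ radii_pos(1) R], (intro continuous_intros cc; fail)+,
          unfold mode_cmult, subst mode_add[OF _ _ radii_pos(1) R], (intro continuous_intros cc; fail)+, rule refl)
    finally show ?thesis by (simp add: agree)
  qed
  show "mode (k + 1) (head_gradient t) r = mAt k t r - \<i> * (vort_mode_dr k t r - of_int k / of_real r * vort_mode k t r) + \<i> * mP k t r"
    unfolding head_gradient_mode vorticity_mode_derivative(2)[OF t less_imp_le[OF r]] by (simp add: mAt_def mP_def)
  \<comment> \<open>both sides come from \<open>2\<partial>w\<close>, as \<open>w\<close> is real\<close>
  have conj_a: "mode (- (k - 1)) (dzbar_dz_v t) r = cnj (- mode (k - 1) (dz_dz_v t) r)"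
  proof -
    have "mode (k - 1) (\<lambda>z. cnj (dzbar_dz_v t z)) r = - mode (k - 1) (dz_dz_v t) r"
    proof -
      have wc: "wirtinger_on Dcl (w t) (\<lambda>z. cnj (- \<i> * dzbar_dz_v t z)) (\<lambda>z. cnj (- \<i> * dz_dz_v t z))"
        using wirtinger_on_cnj[OF wirtinger_second(3)[OF t]] by (simp add: cnj_w)
      have "mode (k - 1) (\<lambda>z. cnj (- \<i> * dzbar_dz_v t z)) r = mode (k - 1) (\<lambda>z. - \<i> * dz_dz_v t z) r"
      proof -
        have 1: "mode (k - 1) (\<lambda>z. cnj (- \<i> * dzbar_dz_v t z)) r - of_int k / of_real r * mode k (w t) r
            = mode (k - 1) (\<lambda>z. - \<i> * dz_dz_v t z) r - of_int k / of_real r * mode k (w t) r"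
          using mode_derivative_dz[OF sub[OF wc] radii_pos(2) U(3,1), of k]
            mode_derivative_dz[OF sub[OF wirtinger_second(3)[OF t]] radii_pos(2) U(3,1), of k]
          unfolding at_within_open[OF U(1,2)] by (rule vector_derivative_unique_at)
        then show ?thesis by simp
      qed
      then have "\<i> * mode (k - 1) (\<lambda>z. cnj (dzbar_dz_v t z)) r = \<i> * (- mode (k - 1) (dz_dz_v t) r)"
        unfolding mode_cmult[symmetric] by (simp add: mode_cmult[of _ "- \<i>", simplified])
      then show ?thesis by (metis complex_i_not_zero mult_cancel_left)
    qed
    then show ?thesis using mode_cnj[of "k - 1" "dzbar_dz_v t" r] by (metis complex_cnj_cnj)
  qed
  have "mode (k - 1) (\<lambda>z. cnj (head_gradient t z)) r = cnj (mode (- (k - 1)) (head_gradient t) r)"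
    by (rule mode_cnj)
  also have "\<dots> = mode (k - 1) (\<lambda>z. cnj (dt_v t z)) r + mode (k - 1) (dz_dz_v t) r - \<i> * mode (k - 1) (\<lambda>z. cnj (w t z * v t z)) r"
    unfolding head_gradient_mode conj_a mode_cnj by simp
  finally show "mode (k - 1) (\<lambda>z. cnj (head_gradient t z)) r = mBt k t r + \<i> * (vort_mode_dr k t r + of_int k / of_real r * vort_mode k t r) - \<i> * mPb k t r"
    unfolding vorticity_mode_derivative(3)[OF t less_imp_le[OF r]] by (simp add: mBt_def mPb_def cnj_w)
qed

text \<open>
  The angular and the radial component of the momentum equation: the first determines the mode of the
  head, the second its derivative.
\<close>
lemma pressure_mode:
  assumes t: "0 < t" "t < T" and r: "r0 < r"
  shows "mBt k t r - mAt k t r + 2 * \<i> * vort_mode_dr k t r - \<i> * (mP k t r + mPb k t r) = 2 * of_int k / of_real r * mode k (head t) r"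
    and "(mode k (head t) has_vector_derivative (mAt k t r - \<i> * (vort_mode_dr k t r - of_int k / of_real r * vort_mode k t r) + \<i> * mP k t r)
      + of_int k / of_real r * mode k (head t) r) (at r)"
proof -
  have U: "r \<in> {r0<..}" "open {r0<..}" "convex {r0<..}" using r by auto
  have "mode (k - 1) (\<lambda>z. cnj (head_gradient t z)) r - mode (k + 1) (head_gradient t) r = 2 * of_int k / of_real r * mode k (head t) r"
    by (rule mode_angular_derivative[OF wirtinger_head[OF t] radii_pos(2) U(1)])
  then show "mBt k t r - mAt k t r + 2 * \<i> * vort_mode_dr k t r - \<i> * (mP k t r + mPb k t r) = 2 * of_int k / of_real r * mode k (head t) r"
    unfolding momentum_modes[OF t r] by (simp add: algebra_simps)
  show "(mode k (head t) has_vector_derivative (mAt k t r - \<i> * (vort_mode_dr k t r - of_int k / of_real r * vort_mode k t r) + \<i> * mP k t r)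
      + of_int k / of_real r * mode k (head t) r) (at r)"
    using mode_derivative_dzbar[OF wirtinger_head[OF t] radii_pos(2) U(3,1), of k]
    unfolding momentum_modes[OF t r] at_within_open[OF U(1,2)] .
qed

text \<open>
  Inserting the first component into the second eliminates the head. The function differentiated is
  \<open>r powi (- k) * (head + \<i> * w)\<close> in the mode \<open>k\<close>; adding \<open>\<i> * w\<close> absorbs the viscous term.
\<close>
lemma momentum_balance:
  assumes t: "0 < t" "t < T" and r: "r0 < r" and k: "k \<noteq> 0"
  shows "((\<lambda>r. of_real r powi (1 - k) * (mBt k t r - mAt k t r + 2 * \<i> * vort_mode_dr k t r - \<i> * (mP k t r + mPb k t r)) / (2 * of_int k)
          + \<i> * of_real r powi (- k) * vort_mode k t r)
        has_vector_derivative of_real r powi (- k) * (mAt k t r + \<i> * mP k t r)) (at r)"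
proof -
  have U: "r \<in> {r0<..}" "open {r0<..}" "convex {r0<..}" using r by auto
  have nz: "r \<noteq> 0" using r r0 by simp
  have "(vort_mode k t has_vector_derivative vort_mode_dr k t r) (at r within {r0<..})"
    by (rule has_vector_derivative_within_subset[OF vorticity_mode_derivative(1)[OF t less_imp_le[OF r]]]) auto
  then have Om: "(vort_mode k t has_vector_derivative vort_mode_dr k t r) (at r)"
    unfolding at_within_open[OF U(1,2)] .
  have "((\<lambda>r. of_real r powi (- k) * (mode k (head t) r + \<i> * vort_mode k t r)) has_vector_derivative
      of_real r powi (- k) * (((mAt k t r - \<i> * (vort_mode_dr k t r - of_int k / of_real r * vort_mode k t r) + \<i> * mP k t r)
      + of_int k / of_real r * mode k (head t) r) + \<i> * vort_mode_dr k t r + of_int (- k) / of_real r * (mode k (head t) r + \<i> * vort_mode k t r))) (at r)"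
    by (intro has_vector_derivative_power_int_mult has_vector_derivative_add has_vector_derivative_mult_right
        pressure_mode(2)[OF t r] Om nz)
  also have "(mAt k t r - \<i> * (vort_mode_dr k t r - of_int k / of_real r * vort_mode k t r) + \<i> * mP k t r)
      + of_int k / of_real r * mode k (head t) r + \<i> * vort_mode_dr k t r + of_int (- k) / of_real r * (mode k (head t) r + \<i> * vort_mode k t r)
    = mAt k t r + \<i> * mP k t r"
    by (simp add: algebra_simps)
  finally show ?thesis
  proof (rule has_vector_derivative_transform_within_open[OF _ U(2,1)])
    fix x assume "x \<in> {r0<..}"
    then have x: "r0 < x" "x \<noteq> 0" using r0 by auto
    have "of_real x powi (1 - k) = of_real x * (of_real x powi (- k) :: complex)"
      using x by (simp add: power_int_diff power_int_minus field_simps)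
    then show "of_real x powi (- k) * (mode k (head t) x + \<i> * vort_mode k t x) =
      of_real x powi (1 - k) * (mBt k t x - mAt k t x + 2 * \<i> * vort_mode_dr k t x - \<i> * (mP k t x + mPb k t x)) / (2 * of_int k)
          + \<i> * of_real x powi (- k) * vort_mode k t x"
      unfolding pressure_mode(1)[OF t x(1)] using x k by (simp add: field_simps)
  qed
qed

lemma velocity_tendsto:
  assumes "0 < t" "t < T"
  shows "(v t \<longlongrightarrow> vinf) at_infinity"
proof -
  have "uniform_limit {t..t} (\<lambda>z t. v t z) (\<lambda>t. vinf) at_infinity"
    using solution assms unfolding NS_solution_def by blast
  then show ?thesis
    using tendsto_uniform_limitI by fastforce
qed

text \<open>
  Compactness handles a bounded part of the domain and uniform convergence the neighbourhood of infinity.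
\<close>
lemma velocity_bounded:
  assumes "0 < s1" "s2 < T"
  shows "\<exists>K\<ge>0. \<forall>t\<in>{s1..s2}. \<forall>z\<in>Dcl. norm (v t z) \<le> K"
proof -
  have "uniform_limit {s1..s2} (\<lambda>z t. v t z) (\<lambda>t. vinf) at_infinity"
    using solution assms unfolding NS_solution_def by blast
  from uniform_limitD[OF this, of 1] obtain b where b': "\<forall>z. b \<le> norm z \<longrightarrow> (\<forall>t\<in>{s1..s2}. dist (v t z) vinf < 1)"
    by (auto simp: eventually_at_infinity)
  then have b: "dist (v t z) vinf < 1" if "b \<le> norm z" "t \<in> {s1..s2}" for z t
    using that by blast
  have c: "compact ({s1..s2} \<times> {z. r0 \<le> cmod z \<and> cmod z \<le> b})"
  proof -
    have "{z. r0 \<le> cmod z \<and> cmod z \<le> b} = cball 0 b \<inter> - ball 0 r0" by auto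
    then show ?thesis by (intro compact_Times) (simp_all add: compact_Int_closed closed_Compl)
  qed
  have "continuous_on ({s1..s2} \<times> {z. r0 \<le> cmod z \<and> cmod z \<le> b}) (\<lambda>(t, z). v t z)"
    by (rule continuous_on_subset[OF joint_continuity(1)]) (use assms in \<open>auto simp: annular_def\<close>)
  from compact_imp_bounded[OF compact_continuous_image[OF this c]]
  obtain M where M: "\<And>t z. t \<in> {s1..s2} \<Longrightarrow> r0 \<le> cmod z \<Longrightarrow> cmod z \<le> b \<Longrightarrow> norm (v t z) \<le> M"
    by (fastforce simp: bounded_iff)
  have "norm (v t z) \<le> max 0 (max M (norm vinf + 1))" if t: "t \<in> {s1..s2}" and z: "z \<in> Dcl" for t z
  proof (cases "cmod z \<le> b")
    case True
    then show ?thesis using M[OF t, of z] z by (simp add: annular_def)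
  next
    case False
    then have "norm (v t z - vinf) < 1" using b[OF _ t, of z] by (simp add: dist_norm)
    then have "norm (v t z) \<le> norm vinf + 1" using norm_triangle_sub[of "v t z" vinf] by linarith
    then show ?thesis by simp
  qed
  then show ?thesis by (intro exI[of _ "max 0 (max M (norm vinf + 1))"]) simp
qed

lemma mode_zero_at_boundary:
  assumes "\<And>z. cmod z = r0 \<Longrightarrow> f z = 0"
  shows "mode j f r0 = 0"
  using assms r0 by (simp add: mode_def norm_mult)

lemma angular_modes_flow:
  assumes k: "k \<ge> 1"
  shows "angular_mode_flow r0 T k (mA k) (mB k) (vort_mode k) (vort_mode_dr k) (mP k) (mPb k) (mS k) (mSb k) (mAt k) (mBt k)"
proof
  show "r0 > 0" "k \<ge> 1" using r0 k by auto
next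
  have jc: "continuous_on ({0<..<T} \<times> {r0..}) (\<lambda>(t, r). mode j (f t) r)"
    if "continuous_on ({0<..<T} \<times> Dcl) (\<lambda>(t, z). f t z)" for j f
    by (rule mode_joint_continuous[OF that radii_pos(1)])
  note cmp = joint_cmp(1,2) joint_continuity_derived[THEN joint_continuous_cmp]
  have vort_mode_dr_alt: "vort_mode_dr k t r = - (\<i> / 2) * (mode (k - 1) (dz_dz_v t) r + mode (k + 1) (dzbar_dz_v t) r)" for t r
    unfolding vort_mode_dr_def mode_cmult by (simp add: field_simps)
  fix X assume "X \<in> {mA k, mB k, vort_mode k, vort_mode_dr k, mP k, mPb k, mS k, mSb k, mAt k, mBt k}"
  moreover have "continuous_on ({0<..<T} \<times> {r0..}) (\<lambda>(t, r). mA k t r)"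
    unfolding mA_def by (intro jc joint_continuity)
  moreover have "continuous_on ({0<..<T} \<times> {r0..}) (\<lambda>(t, r). mAt k t r)"
    unfolding mAt_def by (intro jc joint_continuity)
  moreover have "continuous_on ({0<..<T} \<times> {r0..}) (\<lambda>(t, r). vort_mode k t r)"
    unfolding vort_mode_def by (intro jc joint_continuity_derived)
  moreover have "continuous_on ({0<..<T} \<times> {r0..}) (\<lambda>(t, r). vort_mode_dr k t r)"
    using jc[OF joint_continuity_derived(2), of "k - 1"] jc[OF joint_continuity_derived(3), of "k + 1"]
    unfolding vort_mode_dr_alt case_prod_unfold by (intro continuous_intros)
  moreover have "continuous_on ({0<..<T} \<times> {r0..}) (\<lambda>(t, r). mB k t r)"
    unfolding mB_def by (rule jc) (unfold case_prod_unfold, intro continuous_intros cmp)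
  moreover have "continuous_on ({0<..<T} \<times> {r0..}) (\<lambda>(t, r). mBt k t r)"
    unfolding mBt_def by (rule jc) (unfold case_prod_unfold, intro continuous_intros cmp)
  moreover have "continuous_on ({0<..<T} \<times> {r0..}) (\<lambda>(t, r). mP k t r)"
    unfolding mP_def by (rule jc) (unfold case_prod_unfold, intro continuous_intros cmp)
  moreover have "continuous_on ({0<..<T} \<times> {r0..}) (\<lambda>(t, r). mPb k t r)"
    unfolding mPb_def by (rule jc) (unfold case_prod_unfold, intro continuous_intros cmp)
  moreover have "continuous_on ({0<..<T} \<times> {r0..}) (\<lambda>(t, r). mS k t r)"
    unfolding mS_def by (rule jc) (unfold case_prod_unfold, intro continuous_intros cmp)
  moreover have "continuous_on ({0<..<T} \<times> {r0..}) (\<lambda>(t, r). mSb k t r)"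
    unfolding mSb_def by (rule jc) (unfold case_prod_unfold, intro continuous_intros cmp)
  ultimately show "continuous_on ({0<..<T} \<times> {r0..}) (\<lambda>(t, r). X t r)"
    by auto
next
  fix t r assume t: "0 < t" "t < T" and r: "r0 \<le> r"
  show "(mA k t has_vector_derivative \<i> * vort_mode k t r - of_int (k + 1) / of_real r * mA k t r) (at r within {r0..})"
    "(mB k t has_vector_derivative - \<i> * vort_mode k t r + of_int (k - 1) / of_real r * mB k t r) (at r within {r0..})"
    "(vort_mode k t has_vector_derivative vort_mode_dr k t r) (at r within {r0..})"
    "(mS k t has_vector_derivative 2 * \<i> * mP k t r - of_int (k + 2) / of_real r * mS k t r) (at r within {r0..})"
    "(mSb k t has_vector_derivative - 2 * \<i> * mPb k t r + of_int (k - 2) / of_real r * mSb k t r) (at r within {r0..})"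
    using velocity_mode_derivatives[OF t r] vorticity_mode_derivative(1)[OF t r] by auto
  have dt_v: "((\<lambda>s. v s z) has_vector_derivative dt_v s z) (at s)" if "s \<in> {0<..<T}" "z \<in> Dcl" for s z
    using regular that unfolding velocity_regular_def Let_def ext_dom_annular dt_v_def
    by (auto simp: vector_derivative_works[symmetric])
  show "((\<lambda>t. mA k t r) has_vector_derivative mAt k t r) (at t)"
    unfolding mA_def mAt_def using t r radii_pos dt_v continuous_fields(1) joint_continuity(2)
    by (intro mode_time_derivative[where U = "{r0..}" and I = "{0<..<T}"]) auto
  show "((\<lambda>t. mB k t r) has_vector_derivative mBt k t r) (at t)"
    unfolding mB_def mBt_def
  proof (rule mode_time_derivative[where U = "{r0..}" and I = "{0<..<T}"])
    show "continuous_on ({0<..<T} \<times> Dcl) (\<lambda>(t, z). cnj (dt_v t z))"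
      unfolding case_prod_unfold by (intro continuous_intros joint_cmp)
  qed (use t r radii_pos dt_v continuous_fields(1) in \<open>auto intro!: continuous_intros has_vector_derivative_cnj\<close>)
next
  fix t r assume "0 < t" "t < T" "r0 < r"
  then show "((\<lambda>r. of_real r powi (1 - k) * (mBt k t r - mAt k t r + 2 * \<i> * vort_mode_dr k t r - \<i> * (mP k t r + mPb k t r)) / (2 * of_int k)
          + \<i> * of_real r powi (- k) * vort_mode k t r)
        has_vector_derivative of_real r powi (- k) * (mAt k t r + \<i> * mP k t r)) (at r)"
    using k by (intro momentum_balance) auto
next
  fix X t assume X: "X \<in> {mA k, mB k, mP k, mPb k, mAt k, mBt k}" and t: "0 < t" "t < T"
  note [simp] = noslip[OF t]
  have "mA k t r0 = 0" "mB k t r0 = 0" "mP k t r0 = 0" "mPb k t r0 = 0" "mAt k t r0 = 0" "mBt k t r0 = 0"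
    unfolding mode_defs by (rule mode_zero_at_boundary; simp)+
  with X show "X t r0 = 0" by auto
next
  fix s1 s2 :: real assume s: "0 < s1" "s2 < T"
  obtain K where K: "K \<ge> 0" "\<And>t z. t \<in> {s1..s2} \<Longrightarrow> z \<in> Dcl \<Longrightarrow> norm (v t z) \<le> K"
    using velocity_bounded[OF s] by blast
  have "norm (mA k t r) \<le> 2 * pi * K" "norm (mS k t r) \<le> 2 * pi * (K * K)" "norm (mSb k t r) \<le> 2 * pi * (K * K)"
    if t: "t \<in> {s1..s2}" and r: "r0 \<le> r" for t r
  proof -
    have "norm (v t (of_real r * cis \<phi>)) \<le> K" for \<phi>
      using r r0 by (intro K t annular_circle) auto
    then show "norm (mA k t r) \<le> 2 * pi * K" "norm (mS k t r) \<le> 2 * pi * (K * K)" "norm (mSb k t r) \<le> 2 * pi * (K * K)"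
      unfolding mode_defs using K(1) by (intro norm_mode_le; simp add: norm_mult mult_mono)+
  qed
  then have "\<forall>X\<in>{mA k, mS k, mSb k}. \<forall>t\<in>{s1..s2}. \<forall>r\<ge>r0. norm (X t r) \<le> max (2 * pi * K) (2 * pi * (K * K))"
    by (auto simp: le_max_iff_disj)
  then show "\<exists>K. \<forall>X\<in>{mA k, mS k, mSb k}. \<forall>t\<in>{s1..s2}. \<forall>r\<ge>r0. norm (X t r) \<le> K"
    by blast
next
  have "(mB k t \<longlongrightarrow> mode (k - 1) (\<lambda>_. cnj vinf) r0) at_top" if t: "0 < t" "t < T" for t
    unfolding mB_def using t r0
    by (intro mode_tendsto continuous_intros continuous_fields tendsto_cnj velocity_tendsto)
  then show "\<exists>L. \<forall>t. 0 < t \<and> t < T \<longrightarrow> (mB k t \<longlongrightarrow> L) at_top"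
    by blast
qed

lemma vorticity_flux_limit:
  assumes k: "k \<ge> 1" and t: "0 < t" "t < T"
  shows "((\<lambda>R. integral {r0..R} (\<lambda>r. of_real r powi (- k) * mP k t r)) \<longlongrightarrow>
    - (of_real r0 powi (- k) * (of_real r0 * vort_mode_dr k t r0 + of_int k * vort_mode k t r0)) / of_int k) at_top"
proof -
  interpret angular_mode_flow r0 T k "mA k" "mB k" "vort_mode k" "vort_mode_dr k" "mP k" "mPb k" "mS k" "mSb k" "mAt k" "mBt k"
    by (rule angular_modes_flow[OF k])
  show ?thesis
    using flux_limit_value[OF t] unfolding flux_def .
qed

text \<open>
  The integrand is the derivative of \<open>\<i> * r powi (- k)\<close> times a mode of \<open>cnj v\<close>, which vanishes on the
  boundary circle and is bounded. This is why \<open>vinf\<close> may be inserted in the final formula.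
\<close>
lemma vorticity_moment_limit:
  assumes k: "k \<ge> 1" and t: "0 < t" "t < T"
  shows "((\<lambda>R. integral {r0..R} (\<lambda>r. of_real r powi (- k) * mode (k + 1) (w t) r)) \<longlongrightarrow> 0) at_top"
proof -
  let ?C = "mode k (\<lambda>z. cnj (v t z))"
  let ?F = "\<lambda>r. \<i> * (of_real r powi (- k) * ?C r)"
  have "?C r0 = 0"
    by (rule mode_zero_at_boundary) (simp add: noslip[OF t])
  have eq: "integral {r0..R} (\<lambda>r. of_real r powi (- k) * mode (k + 1) (w t) r) = ?F R" if R: "r0 \<le> R" for R
  proof -
    have "((\<lambda>r. of_real r powi (- k) * mode (k + 1) (w t) r) has_integral ?F R - ?F r0) {r0..R}"
    proof (rule fundamental_theorem_of_calculus[OF R])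
      fix r assume r: "r \<in> {r0..R}"
      then have nz: "r \<noteq> 0" using r0 by auto
      have "(?C has_vector_derivative (mode (k + 1) (\<lambda>z. - \<i> * w t z) r + of_int k / of_real r * ?C r)) (at r within {r0..})"
        using r by (intro mode_derivative_dzbar[OF wirtinger_cnj_v[OF t] radii_pos(1)]) auto
      then have "(?C has_vector_derivative (mode (k + 1) (\<lambda>z. - \<i> * w t z) r + of_int k / of_real r * ?C r)) (at r within {r0..R})"
        by (rule has_vector_derivative_within_subset) auto
      from has_vector_derivative_mult_right[OF has_vector_derivative_power_int_mult[OF this nz, of "- k"], of "\<i>"]
      show "(?F has_vector_derivative of_real r powi (- k) * mode (k + 1) (w t) r) (at r within {r0..R})"
        by (rule has_vector_derivative_eq_rhs) (simp add: mode_cmult[of _ "- \<i>", simplified] algebra_simps)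
    qed
    then show ?thesis
      using \<open>?C r0 = 0\<close> by (simp add: integral_unique)
  qed
  obtain K where K: "\<And>z. z \<in> Dcl \<Longrightarrow> norm (v t z) \<le> K"
    using velocity_bounded[OF t] by (metis atLeastAtMost_iff order_refl)
  have "norm (?C r) \<le> 2 * pi * K" if "r \<ge> r0" for r
    using that r0 by (intro norm_mode_le) (auto intro!: K annular_circle)
  then have "(?F \<longlongrightarrow> 0) at_top"
    by (intro tendsto_mult_right_zero power_int_neg_tendsto_0_mult_bounded[OF k])
  then show ?thesis
    by (rule Lim_transform_eventually)
      (use eventually_ge_at_top[of r0] in \<open>eventually_elim, simp add: eq\<close>)
qed

text \<open>
  On a bounded annulus the integral is, in polar coordinates, a multiple of the moment minus the flux.
  Integrability of the vorticity is what identifies the limit over growing annuli with the integral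
  over the whole domain.
\<close>
lemma vorticity_integral:
  assumes k: "k \<ge> 1" and t: "0 < t" "t < T"
  shows "(LINT z:Dom|lborel. (vinf - v t z) * z powi (- k - 1) * w t z) =
    of_real r0 powi (- k) * (of_real r0 * vort_mode_dr k t r0 + of_int k * vort_mode k t r0) / of_int k"
proof -
  define f where "f z = (vinf - v t z) * z powi (- k - 1) * w t z" for z
  \<comment> \<open>exhaust the domain by bounded annuli, on which the integrand is continuous\<close>
  define A where "A n = {z. r0 < cmod z \<and> cmod z \<le> r0 + real n}" for n :: nat
  note cc = continuous_fields[OF t]
  have cf: "continuous_on Dcl f"
    unfolding f_def[abs_def] using r0 by (intro continuous_intros cc) (auto simp: annular_def)
  obtain K where K: "\<And>z. z \<in> Dcl \<Longrightarrow> norm (v t z) \<le> K"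
    using velocity_bounded[OF t] by (metis atLeastAtMost_iff order_refl)
  have int_f: "set_integrable lborel Dom f"
    unfolding set_integrable_def
  proof (rule Bochner_Integration.integrable_bound)
    have "set_integrable lborel Dom (curl r0 (v t))"
      using solution t by (simp add: NS_solution_def ext_dom_annular)
    then show "integrable lborel (\<lambda>z. ((norm vinf + K) * r0 powi (- k - 1)) * (indicat_real Dom z *\<^sub>R curl r0 (v t) z))"
      unfolding set_integrable_def by (rule integrable_mult_right)
    show "(\<lambda>z. indicat_real Dom z *\<^sub>R f z) \<in> borel_measurable lborel"
      using borel_measurable_continuous_on_indicator[OF borel_open[OF open_annular_Ioi] continuous_on_subset[OF cf annular_Ioi_subset]]
      by simp
    have f_bound: "norm (f z) \<le> (norm vinf + K) * r0 powi (- k - 1) * \<bar>curl r0 (v t) z\<bar>" if z: "z \<in> Dom" for z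
    proof -
      have "norm (vinf - v t z) \<le> norm vinf + K"
        using K[of z] z annular_Ioi_subset by (intro order_trans[OF norm_triangle_ineq4]) auto
      moreover have "norm (z powi (- k - 1)) \<le> r0 powi (- k - 1)"
      proof -
        have "cmod z powi (- k - 1) = inverse (cmod z ^ nat (k + 1))" "r0 powi (- k - 1) = inverse (r0 ^ nat (k + 1))"
          using k power_int_minus[of "cmod z" "k + 1"] power_int_minus[of r0 "k + 1"] by (simp_all add: power_int_def)
        then show ?thesis
          using z r0 by (auto simp: norm_power_int annular_def intro!: le_imp_inverse_le power_mono)
      qed
      ultimately show ?thesis
        unfolding f_def norm_mult using r0 by (intro mult_mono mult_nonneg_nonneg) (auto simp: w_def intro: order_trans[OF norm_ge_zero])
    qed
    have "norm (indicat_real Dom z *\<^sub>R f z)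
        \<le> norm (((norm vinf + K) * r0 powi (- k - 1)) * (indicat_real Dom z *\<^sub>R curl r0 (v t) z))" for z
    proof (cases "z \<in> Dom")
      case True
      then have "norm (f z) \<le> (norm vinf + K) * r0 powi (- k - 1) * \<bar>curl r0 (v t) z\<bar>"
        by (rule f_bound)
      also have "\<dots> \<le> \<bar>(norm vinf + K) * r0 powi (- k - 1)\<bar> * \<bar>curl r0 (v t) z\<bar>"
        by (intro mult_right_mono abs_ge_self abs_ge_zero)
      finally show ?thesis using True by (simp add: abs_mult)
    qed simp
    then show "AE z in lborel. norm (indicat_real Dom z *\<^sub>R f z)
        \<le> norm (((norm vinf + K) * r0 powi (- k - 1)) * (indicat_real Dom z *\<^sub>R curl r0 (v t) z))"
      by simp
  qed
  have U: "(\<Union>n. A n) = Dom"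
  proof -
    have "\<exists>n. cmod z \<le> r0 + real n" for z
      using real_arch_simple[of "cmod z - r0"] by (simp add: algebra_simps)
    then show ?thesis by (auto simp: A_def annular_def)
  qed
  have "(\<lambda>n. LINT z:A n|lborel. f z) \<longlonglongrightarrow> (LINT z:(\<Union>n. A n)|lborel. f z)"
  proof (rule set_integral_cont_up)
    show "set_integrable lborel (\<Union>n. A n) f" unfolding U by (rule int_f)
    show "A n \<in> sets lborel" for n unfolding A_def by measurable
    show "incseq A" by (auto simp: incseq_def A_def)
  qed
  moreover have "(LINT z:A n|lborel. f z) = vinf * integral {r0..r0 + real n} (\<lambda>r. of_real r powi (- k) * mode (k + 1) (w t) r)
      - integral {r0..r0 + real n} (\<lambda>r. of_real r powi (- k) * mP k t r)" for n
  proof -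
    have "(LINT z:A n|lborel. f z) = integral {r0..r0 + real n} (\<lambda>r. of_real r * integral {0..2*pi} (\<lambda>\<phi>. f (of_real r * cis \<phi>)))"
      unfolding A_def using r0 by (intro polar_integral continuous_on_subset[OF cf]) (auto simp: annular_def)
    also have "\<dots> = integral {r0..r0 + real n} (\<lambda>r. vinf * (of_real r powi (- k) * mode (k + 1) (w t) r) - of_real r powi (- k) * mP k t r)"
    proof (rule integral_cong)
      fix r assume r: "r \<in> {r0..r0 + real n}"
      then have pos: "r > 0" "r \<in> {r0..}" using r0 by auto
      have "f (of_real r * cis \<phi>) = of_real r powi (- k - 1) * ((vinf * w t (of_real r * cis \<phi>) - w t (of_real r * cis \<phi>) * v t (of_real r * cis \<phi>)) * cis (- of_int (k + 1) * \<phi>))" for \<phi>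
      proof -
        have "of_int (- k - 1) * \<phi> = - of_int (k + 1) * \<phi>"
          by (simp add: algebra_simps)
        then have "cis \<phi> powi (- k - 1) = cis (- of_int (k + 1) * \<phi>)"
          by (simp only: cis_power_int)
        then show ?thesis
          by (simp add: f_def power_int_mult_distrib algebra_simps)
      qed
      then have "integral {0..2*pi} (\<lambda>\<phi>. f (of_real r * cis \<phi>)) = of_real r powi (- k - 1) * mode (k + 1) (\<lambda>z. vinf * w t z - w t z * v t z) r"
        by (simp add: mode_def)
      also have "mode (k + 1) (\<lambda>z. vinf * w t z - w t z * v t z) r = vinf * mode (k + 1) (w t) r - mP k t r"
        unfolding mP_def by (subst mode_diff[OF _ _ radii_pos(1) pos(2)]) (auto intro!: continuous_intros cc simp: mode_cmult)
      also have "of_real r powi (- k - 1) = of_real r powi (- k) / (of_real r :: complex)"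
        using pos by (simp add: power_int_diff)
      finally show "of_real r * integral {0..2*pi} (\<lambda>\<phi>. f (of_real r * cis \<phi>)) =
          vinf * (of_real r powi (- k) * mode (k + 1) (w t) r) - of_real r powi (- k) * mP k t r"
        using pos by (simp add: field_simps)
    qed
    also have "\<dots> = vinf * integral {r0..r0 + real n} (\<lambda>r. of_real r powi (- k) * mode (k + 1) (w t) r)
      - integral {r0..r0 + real n} (\<lambda>r. of_real r powi (- k) * mP k t r)"
    proof -
      have cm: "continuous_on {r0..r0 + real n} (mode j g)" if "continuous_on Dcl g" for j g
        by (rule continuous_on_subset[OF mode_continuous[OF that radii_pos(1)]]) auto
      have "(\<lambda>r. of_real r powi (- k) * mode (k + 1) g r) integrable_on {r0..r0 + real n}" if "continuous_on Dcl g" for g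
        using r0 by (intro integrable_continuous_real continuous_intros cm that) auto
      note i = this[OF cc(3)] this[of "\<lambda>z. w t z * v t z", folded mP_def]
      have "(\<lambda>r. of_real r powi (- k) * mP k t r) integrable_on {r0..r0 + real n}"
        by (rule i(2)) (intro continuous_intros cc)
      with i(1) show ?thesis
        by (subst Henstock_Kurzweil_Integration.integral_diff) (auto intro: integrable_on_mult_right)
    qed
    finally show ?thesis .
  qed
  moreover have "(\<lambda>n. vinf * integral {r0..r0 + real n} (\<lambda>r. of_real r powi (- k) * mode (k + 1) (w t) r)
      - integral {r0..r0 + real n} (\<lambda>r. of_real r powi (- k) * mP k t r)) \<longlonglongrightarrow>
    vinf * 0 - (- (of_real r0 powi (- k) * (of_real r0 * vort_mode_dr k t r0 + of_int k * vort_mode k t r0)) / of_int k)"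
  proof -
    have radii: "filterlim (\<lambda>n. r0 + real n) at_top sequentially"
      by (intro filterlim_tendsto_add_at_top[OF tendsto_const] filterlim_real_sequentially)
    show ?thesis
      by (intro tendsto_diff tendsto_mult_left filterlim_compose[OF vorticity_moment_limit[OF k t] radii]
          filterlim_compose[OF vorticity_flux_limit[OF k t] radii])
  qed
  ultimately show ?thesis
    unfolding f_def[symmetric] U using LIMSEQ_unique by fastforce
qed

text \<open>
  In the mode 0 the angular component of the momentum equation does not contain the pressure. It
  extends to the boundary by continuity, and there only the viscous term is left.
\<close>
lemma zero_mode_boundary:
  assumes t: "0 < t" "t < T"
  shows "vort_mode_dr 0 t r0 = 0"
proof -
  let ?g = "\<lambda>r. mBt 0 t r - mAt 0 t r + 2 * \<i> * vort_mode_dr 0 t r - \<i> * (mP 0 t r + mPb 0 t r)"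
  note cc = continuous_fields[OF t]
  have "?g r0 = 0"
  proof (rule continuous_zero_at_left_end[where g = ?g])
    show "continuous_on {r0..} ?g"
      unfolding mode_defs by (intro continuous_intros mode_continuous[OF _ radii_pos(1)] cc) auto
    show "?g r = 0" if "r0 < r" for r
      using pressure_mode(1)[OF t that, of 0] by simp
  qed
  moreover have "mAt 0 t r0 = 0" "mBt 0 t r0 = 0" "mP 0 t r0 = 0" "mPb 0 t r0 = 0"
    unfolding mode_defs by (rule mode_zero_at_boundary; simp add: noslip[OF t])+
  ultimately show ?thesis by simp
qed

lemma cnj_modes:
  assumes t: "0 < t" "t < T"
  shows "vort_mode k t r = cnj (vort_mode (- k) t r)" and "vort_mode_dr k t r0 = cnj (vort_mode_dr (- k) t r0)"
proof -
  show *: "vort_mode k t r = cnj (vort_mode (- k) t r)" for r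
    using mode_cnj[of k "w t" r] by (simp add: vort_mode_def cnj_w)
  have "(vort_mode k t has_vector_derivative cnj (vort_mode_dr (- k) t r0)) (at r0 within {r0..})"
    using has_vector_derivative_cnj[OF vorticity_mode_derivative(1)[OF t order_refl, of "- k"]]
    by (simp add: *[abs_def, symmetric])
  with vorticity_mode_derivative(1)[OF t order_refl, of k]
  show "vort_mode_dr k t r0 = cnj (vort_mode_dr (- k) t r0)"
    by (intro vector_derivative_unique_within[of r0 "{r0..}"]) (auto simp: at_within_Ici_at_right)
qed

lemma ang_coeff_mode: "ang_coeff (curl r0 (v t)) k = (\<lambda>r. vort_mode k t r / (2 * of_real pi))"
proof
  fix r
  have "cis (- of_int k * \<phi>) = exp (- \<i> * of_int k * of_real \<phi>)" for \<phi>
    by (simp add: cis_conv_exp mult_ac)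
  then show "ang_coeff (curl r0 (v t)) k r = vort_mode k t r / (2 * of_real pi)"
    by (simp add: ang_coeff_def vort_mode_def mode_def w_def)
qed

lemma ang_coeff_derivative:
  assumes t: "0 < t" "t < T"
  shows "(ang_coeff (curl r0 (v t)) k has_vector_derivative vort_mode_dr k t r0 / (2 * of_real pi)) (at r0 within {r0..})"
  unfolding ang_coeff_mode
  by (intro has_vector_derivative_divide vorticity_mode_derivative(1)[OF t order_refl])

end

section \<open>The boundary condition for the vorticity\<close>

theorem theorem2p5:
  fixes r0 T :: real
    and vinf :: complex
    and v0 :: "complex \<Rightarrow> complex"
    and v :: "real \<Rightarrow> complex \<Rightarrow> complex"
    and p :: "real \<Rightarrow> complex \<Rightarrow> real"
    and w :: "real \<Rightarrow> complex \<Rightarrow> real"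
  assumes "r0 > 0"
    and "initial_datum r0 vinf v0"
    and "NS_solution r0 T vinf v0 v p"
    and "\<And>t z. w t z = curl r0 (v t) z"
  shows "\<forall>t\<in>{0<..<T}. \<forall>k::int.
    ang_coeff (w t) k differentiable (at r0 within {r0..}) \<and>
    of_real r0 * vector_derivative (ang_coeff (w t) k) (at r0 within {r0..})
      + of_int \<bar>k\<bar> * ang_coeff (w t) k r0 =
    (if k \<ge> 0
     then of_int \<bar>k\<bar> * of_real r0 powi \<bar>k\<bar> / (2 * of_real pi) *
       (LINT z:ext_dom r0|lborel.
          (vinf - v t z) * z powi (- \<bar>k\<bar> - 1) * of_real (w t z))
     else of_int \<bar>k\<bar> * of_real r0 powi \<bar>k\<bar> / (2 * of_real pi) *
       (LINT z:ext_dom r0|lborel.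
          cnj ((vinf - v t z) * z powi (- \<bar>k\<bar> - 1)) * of_real (w t z)))"
proof (intro ballI allI conjI)
  fix t :: real and k :: int assume "t \<in> {0<..<T}"
  then have t: "0 < t" "t < T" by auto
  interpret exterior_flow r0 T vinf v0 v p
    using assms(1,3) by unfold_locales
  have w_eq: "w t = curl r0 (v t)"
    using assms(4) by (simp add: fun_eq_iff)
  note der = ang_coeff_derivative[OF t]
  show "ang_coeff (w t) k differentiable (at r0 within {r0..})"
    unfolding w_eq using der by (rule differentiableI_vector)
  have "at r0 within {r0..} \<noteq> bot"
    by (simp add: at_within_Ici_at_right)
  then have vd: "vector_derivative (ang_coeff (w t) k) (at r0 within {r0..}) = vort_mode_dr k t r0 / (2 * of_real pi)" for k
    unfolding w_eq by (rule vector_derivative_within[OF _ der])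
  have lhs: "of_real r0 * vector_derivative (ang_coeff (w t) k) (at r0 within {r0..}) + of_int \<bar>k\<bar> * ang_coeff (w t) k r0
      = (of_real r0 * vort_mode_dr k t r0 + of_int \<bar>k\<bar> * vort_mode k t r0) / (2 * of_real pi)" for k
    unfolding vd by (simp add: w_eq ang_coeff_mode field_simps)
  define I where "I n = (LINT z:ext_dom r0|lborel. (vinf - v t z) * z powi (- n - 1) * of_real (w t z))" for n
  have pos: "of_real r0 * vort_mode_dr n t r0 + of_int n * vort_mode n t r0 = of_int n * of_real r0 powi n * I n" if "n \<ge> 1" for n
  proof -
    have "I n = of_real r0 powi (- n) * (of_real r0 * vort_mode_dr n t r0 + of_int n * vort_mode n t r0) / of_int n"
      using vorticity_integral[OF that t]
      unfolding I_def ext_dom_annular w_def w_eq .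
    then show ?thesis
      using that r0 by (simp add: power_int_minus field_simps)
  qed
  show "of_real r0 * vector_derivative (ang_coeff (w t) k) (at r0 within {r0..})
      + of_int \<bar>k\<bar> * ang_coeff (w t) k r0 =
    (if k \<ge> 0
     then of_int \<bar>k\<bar> * of_real r0 powi \<bar>k\<bar> / (2 * of_real pi) *
       (LINT z:ext_dom r0|lborel.
          (vinf - v t z) * z powi (- \<bar>k\<bar> - 1) * of_real (w t z))
     else of_int \<bar>k\<bar> * of_real r0 powi \<bar>k\<bar> / (2 * of_real pi) *
       (LINT z:ext_dom r0|lborel.
          cnj ((vinf - v t z) * z powi (- \<bar>k\<bar> - 1)) * of_real (w t z)))"
  proof -
    consider "k = 0" | "k \<ge> 1" | "- k \<ge> 1" by linarith
    then show ?thesis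
    proof cases
      case 1
      then show ?thesis unfolding lhs using zero_mode_boundary[OF t] by simp
    next
      case 2
      then show ?thesis unfolding lhs using pos[OF 2] by (simp add: I_def)
    next
      case 3
      have "of_real r0 * vort_mode_dr k t r0 + of_int \<bar>k\<bar> * vort_mode k t r0
          = cnj (of_real r0 * vort_mode_dr (- k) t r0 + of_int (- k) * vort_mode (- k) t r0)"
        using 3 cnj_modes[OF t, of k] by simp
      also have "\<dots> = of_int \<bar>k\<bar> * of_real r0 powi \<bar>k\<bar> * cnj (I (- k))"
        unfolding pos[OF 3] using 3 by (simp add: complex_cnj_power_int)
      also have "cnj (I (- k)) = (LINT z:ext_dom r0|lborel.
          cnj ((vinf - v t z) * z powi (- \<bar>k\<bar> - 1)) * of_real (w t z))"
        unfolding I_def set_lebesgue_integral_def Bochner_Integration.integral_cnj[symmetric]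
        using 3 by (simp add: scaleR_conv_of_real)
      finally show ?thesis unfolding lhs using 3 by simp
    qed
  qed
qed

end
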